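(* Let $q$ satisfy the standing assumptions below, let $S=(S_n)_{n\ge0}$ be the random walk with $S_0=0$ and i.i.d. increments of law $q$, and fix a reference distribution $\alpha\in\mathcal{P}(\mathbb{R})$. Let $\eta:\mathbb{Z}\to\mathcal{P}(\mathbb{R})$ be a stochastic scenery with $|\{z:\eta(z)\neq\alpha\}|<\infty$, and let $X=(X_n)_{n\ge0}$ be the sequence of observations induced by $S$ and $\eta$. Then there is a function $F$ of the observation sequence alone (depending on $q$ and $\alpha$ but not on $\eta$), assigning to $(x_n)_{n\ge0}\in\mathbb{R}^{\mathbb{N}}$ a scenery $F((x_n))\in\mathcal{P}(\mathbb{R})^{\mathbb{Z}}$, such that for every such $\eta$, almost surely $$F\big((X_n)_{n\ge0}\big)=\eta\circ T$$ for some map $T:\mathbb{Z}\to\mathbb{Z}$ which is either a shift $z\mapsto z+c$ or a shift composed with a reflection $z\mapsto -z+c$ ($c\in\mathbb{Z}$; $T$ may depend on $\eta$).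
   Context: Standing assumptions on the probability mass function $q$ on $\mathbb{Z}$: $\sum_z z\,q(z)=0$; $\sum_z z^2q(z)<\infty$; $q(z)=q(-z)$ for all $z$; $\gcd\{n\ge1: q^{*n}(0)>0\}=1$, where $q^{*n}$ is the $n$-fold convolution of $q$; and the additive subgroup generated by the support of $q$ is $\mathbb{Z}$. $\mathcal{P}(\mathbb{R})$ denotes the set of Borel probability measures on $\mathbb{R}$. A stochastic scenery is a map $\eta:\mathbb{Z}\to\mathcal{P}(\mathbb{R})$. The sequence of observations induced by $S$ and $\eta$ is the process $X=(X_n)_{n\ge0}$ such that, conditionally on the whole path $S$, the $X_n$ are independent with $P[X_n\in\cdot\mid S]=\eta(S_n)$. *)

theory Defs
  imports "HOL-Probability.Probability"
begin

primrec conv_pow :: "int pmf \<Rightarrow> nat \<Rightarrow> int pmf" where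
  "conv_pow q 0 = return_pmf 0"
| "conv_pow q (Suc n) = bind_pmf (conv_pow q n) (\<lambda>x. map_pmf (\<lambda>y. x + y) q)"

definition int_subgroup_gen :: "int set \<Rightarrow> int set" where
  "int_subgroup_gen A = \<Inter>{G. 0 \<in> G \<and> (\<forall>a\<in>G. \<forall>b\<in>G. a - b \<in> G) \<and> A \<subseteq> G}"

definition standing_assms :: "int pmf \<Rightarrow> bool" where
  "standing_assms q \<longleftrightarrow>
     (\<lambda>z. real_of_int z ^ 2 * pmf q z) summable_on UNIV
   \<and> (\<Sum>\<^sub>\<infinity>z. real_of_int z * pmf q z) = 0
   \<and> (\<forall>z. pmf q z = pmf q (-z))
   \<and> Gcd {n::nat. n \<ge> 1 \<and> pmf (conv_pow q n) 0 > 0} = 1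
   \<and> int_subgroup_gen (set_pmf q) = UNIV"

definition walk_law :: "int pmf \<Rightarrow> (nat \<Rightarrow> int) measure" where
  "walk_law q = distr (PiM UNIV (\<lambda>_::nat. measure_pmf q))
                      (PiM UNIV (\<lambda>_::nat. count_space (UNIV::int set)))
                      (\<lambda>\<xi> n. \<Sum>i<n. \<xi> i)"

definition obs_law :: "int pmf \<Rightarrow> (int \<Rightarrow> real measure) \<Rightarrow> (nat \<Rightarrow> real) measure" where
  "obs_law q \<eta> = bind (walk_law q) (\<lambda>s. PiM UNIV (\<lambda>n. \<eta> (s n)))"

definition is_scenery :: "(int \<Rightarrow> real measure) \<Rightarrow> bool" where
  "is_scenery \<eta> \<longleftrightarrow> (\<forall>z. prob_space (\<eta> z) \<and> sets (\<eta> z) = sets borel)"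

end

(*
The function F need not be measurable, so it suffices to find countably many functionals of the
observations that converge almost surely to constants determining the scenery up to a shift and a
reflection. Let p_t be the t-step transition probabilities and u_n = p_{2n}(0). For bounded test
functions f_0, ..., f_k with mean zero under \<alpha> and gaps t_1, ..., t_k \<ge> 1, the weighted averages
  (sum_{n<N} u_n f_0(X_{2n}) f_1(X_{2n+t_1}) ... f_k(X_{2n+t_1+...+t_k})) / (sum_{n<N} u_n^2)
have an L^2 limit, the sum over all paths z_0, ..., z_k of defects of
  prod_i (integral of f_i against \<eta>(z_i)) * prod_i p_{t_i}(z_i - z_{i-1}),
because u_n decays like n^(-1/2), so that sum u_n^2 diverges and the variance is of the order of the
denominator. A sequence of N along which the variances are summable gives almost sure convergence.

Conversely, these path sums determine the scenery. Since the characteristic function of q equals 1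
only at 0 and has modulus < 1 elsewhere, the behaviour for large t isolates the Fourier transform
near 0, where a trigonometric polynomial has a sign; hence each kernel p_t may be replaced by the
indicator of {d, -d}, for every d. Products and linear combinations of test functions separate the
values of the scenery, so one knows which sequences of values are realised by paths with prescribed
absolute increments. Paths returning to the two extreme defects then recover the scenery.
*)
theory Submission
  imports Defs "HOL-Real_Asymp.Real_Asymp"
begin

section \<open>Path sums determine the scenery\<close>

text \<open>Unweighted averages would not do: the number of visits to a defect up to time N, divided
  by its mean, converges only in law, to a random limit. The weights u_n, of order n^(-1/2), turn
  the sum into a logarithmic average, whose fluctuations are of smaller order than its mean. Windows
  start at even times because the Fourier integrand \<phi>^(2n) of u_n is nonnegative. This makes u
  decreasing, and errors can be measured by the differences u_n - u_(n+1), which telescope. Centring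
  the test functions at \<alpha> confines all path sums to the finitely many defects. Because q is
  symmetric, only the even part of a function of the increment can be recovered: distances, not
  directions. The point of the reconstruction is therefore that the choice of orientation is the
  same for all defects, which leaves a single reflection undetermined.\<close>

definition defects :: "'m \<Rightarrow> (int \<Rightarrow> 'm) \<Rightarrow> int set" where
  "defects \<alpha> \<eta> = {z. \<eta> z \<noteq> \<alpha>}"

primrec path_sum ::
  "'m \<Rightarrow> (int \<Rightarrow> 'm) \<Rightarrow> ((int \<Rightarrow> real) \<times> ('m \<Rightarrow> real)) list \<Rightarrow> int \<Rightarrow> real" where
  "path_sum \<alpha> \<eta> [] x = 1"
| "path_sum \<alpha> \<eta> (p # w) x =
     (\<Sum>y\<in>defects \<alpha> \<eta>. fst p (y - x) * snd p (\<eta> y) * path_sum \<alpha> \<eta> w y)"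

lemma path_sum_cong_kernel:
  assumes "\<And>x' y. x' \<in> insert x (defects \<alpha> \<eta>) \<Longrightarrow> y \<in> defects \<alpha> \<eta> \<Longrightarrow> \<kappa> (y - x') = \<kappa>' (y - x')"
  shows "path_sum \<alpha> \<eta> (u @ (\<kappa>, h) # w) x = path_sum \<alpha> \<eta> (u @ (\<kappa>', h) # w) x"
  using assms
proof (induction u arbitrary: x)
  case (Cons p u)
  have "path_sum \<alpha> \<eta> (u @ (\<kappa>, h) # w) y = path_sum \<alpha> \<eta> (u @ (\<kappa>', h) # w) y"
    if "y \<in> defects \<alpha> \<eta>" for y
    using Cons.prems that by (intro Cons.IH) auto
  thus ?case by simp
qed auto

lemma path_sum_sum_kernel:
  assumes "finite \<Delta>"
  shows "path_sum \<alpha> \<eta> (u @ (\<lambda>z. \<Sum>d\<in>\<Delta>. c d * k d z, h) # w) x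
       = (\<Sum>d\<in>\<Delta>. c d * path_sum \<alpha> \<eta> (u @ (k d, h) # w) x)"
proof (induction u arbitrary: x)
  case Nil
  show ?case
    by (simp add: sum_distrib_left sum_distrib_right sum.swap[of _ \<Delta>] mult_ac)
next
  case (Cons p u)
  show ?case
    by (simp add: Cons.IH sum_distrib_left sum_distrib_right sum.swap[of _ \<Delta>] mult_ac)
qed

lemma path_sum_add_mark:
  "path_sum \<alpha> \<eta> (u @ (\<kappa>, \<lambda>m. f m + h m) # w) x
     = path_sum \<alpha> \<eta> (u @ (\<kappa>, f) # w) x + path_sum \<alpha> \<eta> (u @ (\<kappa>, h) # w) x"
  by (induction u arbitrary: x) (simp_all add: algebra_simps sum.distrib)

lemma path_sum_scale_mark:
  "path_sum \<alpha> \<eta> (u @ (\<kappa>, \<lambda>m. c * f m) # w) x = c * path_sum \<alpha> \<eta> (u @ (\<kappa>, f) # w) x"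
  by (induction u arbitrary: x) (simp_all add: algebra_simps sum_distrib_left)

definition jump_kernel :: "int \<Rightarrow> int \<Rightarrow> real" where
  "jump_kernel d z = of_bool (z = d) + of_bool (z = - d)"

text \<open>A further step of length 0 reads a second mark at the same site. Division by 2
  compensates for \<open>jump_kernel 0\<close>, whose two indicators coincide and give the value 2
  at 0.\<close>

lemma path_sum_mult_mark:
  assumes "finite (defects \<alpha> \<eta>)"
  shows "path_sum \<alpha> \<eta> (u @ (\<kappa>, \<lambda>m. f m * h m) # w) x
     = path_sum \<alpha> \<eta> (u @ (\<kappa>, f) # (jump_kernel 0, h) # w) x / 2"
proof (induction u arbitrary: x)
  case Nil
  have "(\<Sum>y'\<in>defects \<alpha> \<eta>. jump_kernel 0 (y' - y) * h (\<eta> y') * path_sum \<alpha> \<eta> w y')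
      = 2 * h (\<eta> y) * path_sum \<alpha> \<eta> w y" if "y \<in> defects \<alpha> \<eta>" for y
  proof -
    have "(\<Sum>y'\<in>defects \<alpha> \<eta>. jump_kernel 0 (y' - y) * h (\<eta> y') * path_sum \<alpha> \<eta> w y')
       = (\<Sum>y'\<in>defects \<alpha> \<eta>. if y' = y then 2 * h (\<eta> y') * path_sum \<alpha> \<eta> w y' else 0)"
      by (intro sum.cong) (auto simp: jump_kernel_def)
    thus ?thesis using that assms by simp
  qed
  thus ?case by (simp add: sum_divide_distrib mult_ac)
next
  case (Cons p u)
  have "path_sum \<alpha> \<eta> ((p # u) @ (\<kappa>, \<lambda>m. f m * h m) # w) x
    = (\<Sum>y\<in>defects \<alpha> \<eta>. fst p (y - x) * snd p (\<eta> y) * path_sum \<alpha> \<eta> (u @ (\<kappa>, f) # (jump_kernel 0, h) # w) y / 2)"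
    unfolding append_Cons path_sum.simps(2) Cons.IH by (simp only: times_divide_eq_right)
  thus ?case unfolding append_Cons path_sum.simps(2) by (simp only: sum_divide_distrib)
qed

lemma path_sum_nonneg:
  assumes "\<And>p z. p \<in> set w \<Longrightarrow> fst p z \<ge> 0"
    and "\<And>p y. p \<in> set w \<Longrightarrow> y \<in> defects \<alpha> \<eta> \<Longrightarrow> snd p (\<eta> y) \<ge> 0"
  shows "path_sum \<alpha> \<eta> w x \<ge> 0"
  using assms
proof (induction w arbitrary: x)
  case (Cons p w)
  have "path_sum \<alpha> \<eta> w y \<ge> 0" for y using Cons.prems by (intro Cons.IH) auto
  hence "fst p (y - x) * snd p (\<eta> y) * path_sum \<alpha> \<eta> w y \<ge> 0" if "y \<in> defects \<alpha> \<eta>" for y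
    using Cons.prems that by (intro mult_nonneg_nonneg) auto
  thus ?case by (simp add: sum_nonneg)
qed auto

text \<open>The passage from numbers to combinatorics: for nonnegative kernels and marks nothing
  cancels, so a positive sum means that an admissible path exists.\<close>

lemma path_sum_Cons_pos_iff:
  assumes "finite (defects \<alpha> \<eta>)"
    and "\<And>p z. p \<in> set (a # w) \<Longrightarrow> fst p z \<ge> 0"
    and "\<And>p y. p \<in> set (a # w) \<Longrightarrow> y \<in> defects \<alpha> \<eta> \<Longrightarrow> snd p (\<eta> y) \<ge> 0"
  shows "path_sum \<alpha> \<eta> (a # w) x > 0 \<longleftrightarrow>
    (\<exists>y\<in>defects \<alpha> \<eta>. fst a (y - x) > 0 \<and> snd a (\<eta> y) > 0 \<and> path_sum \<alpha> \<eta> w y > 0)"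
proof -
  have nn: "path_sum \<alpha> \<eta> w y \<ge> 0" for y using assms by (intro path_sum_nonneg) auto
  have nn': "fst a (y - x) * snd a (\<eta> y) * path_sum \<alpha> \<eta> w y \<ge> 0" if "y \<in> defects \<alpha> \<eta>" for y
    using nn assms that by (intro mult_nonneg_nonneg) auto
  have eq: "(fst a (y - x) * snd a (\<eta> y) * path_sum \<alpha> \<eta> w y > 0) \<longleftrightarrow>
     fst a (y - x) > 0 \<and> snd a (\<eta> y) > 0 \<and> path_sum \<alpha> \<eta> w y > 0" if "y \<in> defects \<alpha> \<eta>" for y
    using nn[of y] assms(2)[of a "y - x"] assms(3)[of a y] that
    by (auto simp: zero_less_mult_iff dest: order.antisym)
  have "path_sum \<alpha> \<eta> (a # w) x > 0 \<longleftrightarrow> (\<exists>y\<in>defects \<alpha> \<eta>. fst a (y - x) * snd a (\<eta> y) * path_sum \<alpha> \<eta> w y > 0)"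
    using sum_pos2[OF assms(1)] nn' sum_nonpos[of "defects \<alpha> \<eta>" "\<lambda>y. fst a (y - x) * snd a (\<eta> y) * path_sum \<alpha> \<eta> w y"]
    by (smt (verit) path_sum.simps(2) sum.cong)
  thus ?thesis using eq by blast
qed

section \<open>Separating the values of a scenery by products of test functions\<close>

inductive_set mark_algebra :: "('m \<Rightarrow> real) set \<Rightarrow> ('m \<Rightarrow> real) set" for B where
  base: "f \<in> B \<Longrightarrow> f \<in> mark_algebra B"
| add: "f \<in> mark_algebra B \<Longrightarrow> h \<in> mark_algebra B \<Longrightarrow> (\<lambda>m. f m + h m) \<in> mark_algebra B"
| scale: "f \<in> mark_algebra B \<Longrightarrow> (\<lambda>m. c * f m) \<in> mark_algebra B"
| mult: "f \<in> B \<Longrightarrow> h \<in> mark_algebra B \<Longrightarrow> (\<lambda>m. f m * h m) \<in> mark_algebra B"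

text \<open>Lagrange interpolation: each value \<nu> to be killed contributes a factor
  \<open>f - f \<nu>\<close> with \<open>f\<close> separating it from \<mu>. Constants need not
  belong to the algebra, so the factor is multiplied out, and the last assumption supplies a
  starting function that does not vanish at \<mu>.\<close>

lemma mark_algebra_indicator:
  assumes "finite M" "\<mu> \<notin> M" "\<And>\<nu>. \<nu> \<in> M \<Longrightarrow> \<exists>f\<in>B. f \<nu> \<noteq> f \<mu>" "\<exists>f\<in>B. f \<mu> \<noteq> 0"
  shows "\<exists>h\<in>mark_algebra B. h \<mu> = 1 \<and> (\<forall>\<nu>\<in>M. h \<nu> = 0)"
proof -
  have "\<exists>h\<in>mark_algebra B. h \<mu> \<noteq> 0 \<and> (\<forall>\<nu>\<in>M. h \<nu> = 0)"
    using assms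
  proof (induction M rule: finite_induct)
    case empty
    then show ?case using mark_algebra.base by blast
  next
    case (insert \<nu> M)
    then obtain h where h: "h \<in> mark_algebra B" "h \<mu> \<noteq> 0" "\<forall>\<nu>\<in>M. h \<nu> = 0" by auto
    obtain f where f: "f \<in> B" "f \<nu> \<noteq> f \<mu>" using insert by blast
    define g where "g = (\<lambda>m. f m * h m + - f \<nu> * h m)"
    have "g \<in> mark_algebra B" unfolding g_def
      using f h by (intro mark_algebra.add mark_algebra.mult mark_algebra.scale)
    moreover have "g \<mu> \<noteq> 0" using f h by (auto simp: g_def algebra_simps)
    moreover have "\<forall>\<nu>'\<in>insert \<nu> M. g \<nu>' = 0" using h by (auto simp: g_def)
    ultimately show ?case by blast
  qed
  then obtain h where h: "h \<in> mark_algebra B" "h \<mu> \<noteq> 0" "\<forall>\<nu>\<in>M. h \<nu> = 0" by blast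
  show ?thesis
    by (rule bexI[OF _ mark_algebra.scale[OF h(1), of "inverse (h \<mu>)"]]) (use h in auto)
qed

text \<open>All that the reconstruction needs from probability. Later \<open>B\<close> consists of
  the means of centred indicators, \<open>p\<close> is the family of transition probabilities, and
  \<open>eq\<close> holds because both sceneries have the same limits. In \<open>kernel\<close> only
  the even part of \<open>c\<close> can be claimed, since the transition probabilities are
  symmetric.\<close>

locale two_sceneries =
  fixes \<alpha> :: 'm and \<eta> \<eta>' :: "int \<Rightarrow> 'm" and B :: "('m \<Rightarrow> real) set" and p :: "nat \<Rightarrow> int \<Rightarrow> real"
  assumes fin: "finite (defects \<alpha> \<eta>)" "finite (defects \<alpha> \<eta>')"
    and sep: "\<mu> \<in> insert \<alpha> (range \<eta> \<union> range \<eta>') \<Longrightarrow> \<nu> \<in> range \<eta> \<union> range \<eta>' \<Longrightarrow> \<mu> \<noteq> \<nu> \<Longrightarrow> \<exists>f\<in>B. f \<mu> \<noteq> f \<nu>"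
    and zero: "f \<in> B \<Longrightarrow> f \<alpha> = 0"
    and kernel: "(\<And>t. t \<ge> 1 \<Longrightarrow> (\<Sum>d\<in>{-M..M}. p t d * c d) = 0) \<Longrightarrow> \<bar>d\<bar> \<le> M \<Longrightarrow> c d + c (- d) = 0"
    and eq: "f0 \<in> B \<Longrightarrow> w \<in> lists (p ` {1..} \<times> B) \<Longrightarrow>
       path_sum \<alpha> \<eta> ((\<lambda>_. 1, f0) # w) 0 = path_sum \<alpha> \<eta>' ((\<lambda>_. 1, f0) # w) 0"
begin

definition agree :: "((int \<Rightarrow> real) \<times> ('m \<Rightarrow> real)) list \<Rightarrow> bool" where
  "agree w \<longleftrightarrow> path_sum \<alpha> \<eta> w 0 = path_sum \<alpha> \<eta>' w 0"

text \<open>Kernels are exchanged one at a time from left to right: for the last element of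
  \<open>v\<close> the induction hypothesis allows every transition kernel in its place. The path
  sum is linear in that kernel, and \<open>kernel\<close> is applied to the difference of the two
  sceneries as a function of the increment.\<close>

lemma agree_jump_base:
  assumes "f0 \<in> B" "v \<in> lists (range jump_kernel \<times> B)" "w \<in> lists (p ` {1..} \<times> B)"
  shows "agree ((\<lambda>_. 1, f0) # v @ w)"
  using assms(2,3)
proof (induction v arbitrary: w rule: rev_induct)
  case Nil
  then show ?case using eq assms by (simp add: agree_def)
next
  case (snoc a v)
  obtain d h where a: "a = (jump_kernel d, h)" "h \<in> B" using snoc.prems by auto
  define u where "u = (\<lambda>_::int. 1::real, f0) # v"
  define \<delta> where "\<delta> e = (\<lambda>z. of_bool (z = e) :: real)" for e :: int
  define P where "P \<eta> k = path_sum \<alpha> \<eta> (u @ (k, h) # w) 0" for \<eta> k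
  define D where "D = defects \<alpha> \<eta> \<union> defects \<alpha> \<eta>'"
  define M0 where "M0 = (\<Sum>x\<in>insert 0 D. \<bar>x\<bar>)"
  have finD: "finite (insert 0 D)" using fin by (simp add: D_def)
  have le: "\<bar>x\<bar> \<le> M0" if "x \<in> insert 0 D" for x
    unfolding M0_def by (rule member_le_sum[OF that _ finD]) simp
  have M0: "\<bar>y - x\<bar> \<le> 2 * M0" if "x \<in> insert 0 D" "y \<in> D" for x y
    using le[OF that(1)] le[of y] that(2) by simp
  \<comment> \<open>\<open>M\<close> bounds every increment between relevant sites, the starting
    point 0 included, and also the jump \<open>d\<close> itself. On \<open>{-M..M}\<close> any
    kernel is a combination of point masses.\<close>
  define M where "M = max \<bar>d\<bar> (2 * M0)"
  have exp: "P \<zeta> k = (\<Sum>e\<in>{-M..M}. k e * P \<zeta> (\<delta> e))" if "\<zeta> \<in> {\<eta>, \<eta>'}" for \<zeta> k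
  proof -
    have "P \<zeta> k = P \<zeta> (\<lambda>z. \<Sum>e\<in>{-M..M}. k e * \<delta> e z)"
      unfolding P_def
    proof (rule path_sum_cong_kernel)
      fix x y assume "x \<in> insert 0 (defects \<alpha> \<zeta>)" "y \<in> defects \<alpha> \<zeta>"
      hence "\<bar>y - x\<bar> \<le> 2 * M0" using that by (intro M0) (auto simp: D_def)
      hence "\<bar>y - x\<bar> \<le> M" unfolding M_def by simp
      hence "(y - x) \<in> {-M..M}" by auto
      thus "k (y - x) = (\<Sum>e\<in>{-M..M}. k e * \<delta> e (y - x))"
      proof -
        assume "y - x \<in> {-M..M}"
        moreover have "(\<Sum>e\<in>{-M..M}. k e * \<delta> e (y - x)) = (\<Sum>e\<in>{-M..M}. if e = y - x then k e else 0)"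
          by (intro sum.cong) (auto simp: \<delta>_def)
        ultimately show ?thesis by (simp only: sum.delta finite_atLeastAtMost_int if_True)
      qed
    qed
    thus ?thesis unfolding P_def by (simp add: path_sum_sum_kernel)
  qed
  have "(P \<eta> (\<delta> d) - P \<eta>' (\<delta> d)) + (P \<eta> (\<delta> (-d)) - P \<eta>' (\<delta> (-d))) = 0"
  proof (rule kernel)
    show "\<bar>d\<bar> \<le> M" by (simp add: M_def)
    fix t :: nat assume "t \<ge> 1"
    hence "agree ((\<lambda>_. 1, f0) # v @ ((p t, h) # w))"
      using snoc a by (intro snoc.IH) auto
    hence "P \<eta> (p t) = P \<eta>' (p t)" by (simp add: agree_def P_def u_def)
    thus "(\<Sum>e\<in>{-M..M}. p t e * (P \<eta> (\<delta> e) - P \<eta>' (\<delta> e))) = 0"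
      unfolding exp[of \<eta> "p t", simplified] exp[of \<eta>' "p t", simplified]
      by (simp only: right_diff_distrib sum_subtractf diff_self)
  qed
  moreover have "P \<zeta> (jump_kernel d) = P \<zeta> (\<delta> d) + P \<zeta> (\<delta> (-d))" if "\<zeta> \<in> {\<eta>, \<eta>'}" for \<zeta>
  proof -
    have "P \<zeta> (jump_kernel d) = (\<Sum>e\<in>{-M..M}. (if e = d then P \<zeta> (\<delta> e) else 0) + (if e = -d then P \<zeta> (\<delta> e) else 0))"
      unfolding exp[OF that, of "jump_kernel d"] by (intro sum.cong) (auto simp: jump_kernel_def)
    also have "\<dots> = P \<zeta> (\<delta> d) + P \<zeta> (\<delta> (-d))"
    proof -
      have "\<bar>d\<bar> \<le> M" by (simp add: M_def)
      hence "d \<in> {-M..M}" "-d \<in> {-M..M}" by auto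
      thus ?thesis by (simp only: sum.distrib sum.delta finite_atLeastAtMost_int if_True)
    qed
    finally show ?thesis .
  qed
  ultimately have "P \<eta> (jump_kernel d) = P \<eta>' (jump_kernel d)" by simp
  thus ?case by (simp add: agree_def P_def u_def a)
qed

text \<open>Prefix and kernel stay arbitrary in the induction because the case of a product moves
  its first factor into the prefix, followed by a jump of length 0.\<close>

lemma agree_extend:
  assumes "h \<in> mark_algebra B"
    and "\<And>f w. f \<in> B \<Longrightarrow> w \<in> lists (range jump_kernel \<times> B) \<Longrightarrow> agree (u @ (\<kappa>, f) # w)"
    and "w \<in> lists (range jump_kernel \<times> B)"
  shows "agree (u @ (\<kappa>, h) # w)"
  using assms
proof (induction arbitrary: u \<kappa> w)
  case (base f)
  then show ?case by blast
next
  case (add f h)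
  then show ?case by (simp add: agree_def path_sum_add_mark)
next
  case (scale f c)
  then show ?case by (simp add: agree_def path_sum_scale_mark)
next
  case (mult f h)
  have "agree ((u @ [(\<kappa>, f)]) @ (jump_kernel 0, h) # w)"
    using mult.prems mult.hyps by (intro mult.IH) auto
  then show ?case by (simp add: agree_def path_sum_mult_mark fin)
qed

lemma agree_mark_algebra:
  assumes "h0 \<in> mark_algebra B" "v \<in> lists (range jump_kernel \<times> mark_algebra B)"
    "w \<in> lists (range jump_kernel \<times> B)"
  shows "agree ((\<lambda>_. 1, h0) # v @ w)"
  using assms(2,3)
proof (induction v arbitrary: w rule: rev_induct)
  case Nil
  then show ?case
    using agree_extend[OF assms(1), of "[]" "\<lambda>_. 1" w] agree_jump_base[of _ _ "[]"] by simp
next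
  case (snoc a v)
  then obtain d h where a: "a = (jump_kernel d, h)" "h \<in> mark_algebra B" by auto
  have "agree (((\<lambda>_. 1, h0) # v) @ (jump_kernel d, h) # w)"
  proof (rule agree_extend[OF a(2)])
    fix f w assume "f \<in> B" "w \<in> lists (range jump_kernel \<times> B)"
    thus "agree (((\<lambda>_. 1, h0) # v) @ (jump_kernel d, f) # w)"
      using snoc.IH[of "(jump_kernel d, f) # w"] snoc.prems(1) by simp
  qed (use snoc.prems(2) in simp)
  then show ?case by (simp add: a)
qed

section \<open>Words read along paths with prescribed distances\<close>

primrec trace :: "(int \<Rightarrow> 'm) \<Rightarrow> (int \<times> 'm) list \<Rightarrow> int \<Rightarrow> bool" where
  "trace \<zeta> [] x = True"
| "trace \<zeta> (a # w) x = (\<exists>y. \<bar>y - x\<bar> = fst a \<and> \<zeta> y = snd a \<and> trace \<zeta> w y)"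

text \<open>With jump kernels and indicator marks the path sum adds nonnegative weights over the
  realisations of the word, hence is positive exactly when the word is realised; equal sums
  therefore transfer realisability. The value \<alpha> is excluded because path sums visit defects
  only.\<close>

lemma trace_transfer:
  assumes "\<mu>0 \<in> (range \<eta> \<union> range \<eta>') - {\<alpha>}"
    and "snd ` set w \<subseteq> (range \<eta> \<union> range \<eta>') - {\<alpha>}"
  shows "(\<exists>x. \<eta> x = \<mu>0 \<and> trace \<eta> w x) \<longleftrightarrow> (\<exists>x. \<eta>' x = \<mu>0 \<and> trace \<eta>' w x)"
proof -
  let ?M = "insert \<alpha> (range \<eta> \<union> range \<eta>')"
  have "range \<eta> \<subseteq> insert \<alpha> (\<eta> ` defects \<alpha> \<eta>)" "range \<eta>' \<subseteq> insert \<alpha> (\<eta>' ` defects \<alpha> \<eta>')"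
    by (auto simp: defects_def)
  hence finM: "finite ?M" using fin by (meson finite.insertI finite_UnI finite_imageI finite_subset)
  have "\<exists>h\<in>mark_algebra B. h \<mu> = 1 \<and> (\<forall>\<nu>\<in>?M - {\<mu>}. h \<nu> = 0)" if "\<mu> \<in> ?M - {\<alpha>}" for \<mu>
  proof (rule mark_algebra_indicator)
    show "\<exists>f\<in>B. f \<mu> \<noteq> 0" using sep[of \<alpha> \<mu>] zero that by fastforce
    show "\<exists>f\<in>B. f \<nu> \<noteq> f \<mu>" if "\<nu> \<in> ?M - {\<mu>}" for \<nu>
      using sep[of \<nu> \<mu>] that \<open>\<mu> \<in> ?M - {\<alpha>}\<close> by auto
  qed (use finM in auto)
  then obtain I where "\<forall>\<mu>\<in>?M - {\<alpha>}. I \<mu> \<in> mark_algebra B \<and> I \<mu> \<mu> = 1 \<and> (\<forall>\<nu>\<in>?M - {\<mu>}. I \<mu> \<nu> = 0)"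
    by metis
  hence I: "I \<mu> \<in> mark_algebra B" "I \<mu> \<mu> = 1" "\<And>\<nu>. \<nu> \<in> ?M - {\<mu>} \<Longrightarrow> I \<mu> \<nu> = 0"
    if "\<mu> \<in> ?M - {\<alpha>}" for \<mu>
    using that by blast+
  have Ival: "I \<mu> (\<zeta> y) = of_bool (\<zeta> y = \<mu>)" if "\<mu> \<in> ?M - {\<alpha>}" "\<zeta> \<in> {\<eta>, \<eta>'}" for \<mu> \<zeta> y
    using I(2,3)[OF that(1)] that(2) by (cases "\<zeta> y = \<mu>") auto
  define W where "W = map (\<lambda>(d, \<mu>). (jump_kernel d, I \<mu>))"
  have pos: "path_sum \<alpha> \<zeta> (W v) x > 0 \<longleftrightarrow> trace \<zeta> v x"
    if "\<zeta> \<in> {\<eta>, \<eta>'}" "snd ` set v \<subseteq> ?M - {\<alpha>}" "\<forall>a\<in>set v. fst a \<ge> 0" for \<zeta> v x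
    using that
  proof (induction v arbitrary: x)
    case (Cons a v)
    have mem: "snd a \<in> ?M - {\<alpha>}" using Cons.prems by auto
    have *: "path_sum \<alpha> \<zeta> (W (a # v)) x > 0 \<longleftrightarrow>
      (\<exists>y\<in>defects \<alpha> \<zeta>. fst ((jump_kernel (fst a), I (snd a))) (y - x) > 0
         \<and> snd ((jump_kernel (fst a), I (snd a))) (\<zeta> y) > 0 \<and> path_sum \<alpha> \<zeta> (W v) y > 0)"
      unfolding W_def list.map prod.case_eq_if
    proof (rule path_sum_Cons_pos_iff)
      show "finite (defects \<alpha> \<zeta>)" using Cons.prems fin by auto
    next
      fix b z assume "b \<in> set ((jump_kernel (fst a), I (snd a)) # map (\<lambda>p. (jump_kernel (fst p), I (snd p))) v)"
      thus "0 \<le> fst b z" by (auto simp: jump_kernel_def)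
    next
      fix b y assume "b \<in> set ((jump_kernel (fst a), I (snd a)) # map (\<lambda>p. (jump_kernel (fst p), I (snd p))) v)"
      hence "snd b \<in> (\<lambda>c. I (snd c)) ` set (a # v)" by force
      then obtain c where c: "c \<in> set (a # v)" "snd b = I (snd c)" by blast
      define \<mu> where "\<mu> = snd c"
      have "\<mu> \<in> snd ` set (a # v)" unfolding \<mu>_def using c(1) by (rule imageI)
      hence "\<mu> \<in> ?M - {\<alpha>}" "snd b = I \<mu>" using Cons.prems(2) c(2) by (auto simp: \<mu>_def)
      thus "0 \<le> snd b (\<zeta> y)" using Ival Cons.prems(1) by simp
    qed
    have **: "(jump_kernel (fst a) z > 0) \<longleftrightarrow> \<bar>z\<bar> = fst a" for z
      using Cons.prems(3) by (auto simp: jump_kernel_def abs_if)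
    have IH: "path_sum \<alpha> \<zeta> (W v) y > 0 \<longleftrightarrow> trace \<zeta> v y" for y
      using Cons.prems by (intro Cons.IH) auto
    have "of_bool (\<zeta> y = snd a) > (0::real) \<longleftrightarrow> \<zeta> y = snd a" for y by simp
    moreover have "y \<in> defects \<alpha> \<zeta>" if "\<zeta> y = snd a" for y using mem that by (simp add: defects_def)
    ultimately show ?case
      unfolding * fst_conv snd_conv ** Ival[OF mem Cons.prems(1)] IH trace.simps by blast
  qed (simp add: W_def)
  \<comment> \<open>A negative length is realised by no step, whereas \<open>jump_kernel\<close>
    cannot tell \<open>d\<close> from \<open>- d\<close>; words containing one are treated
    apart.\<close>
  have triv: "\<not> trace \<zeta> v x" if "\<exists>a\<in>set v. fst a < 0" for \<zeta> v x
    using that by (induction v arbitrary: x) auto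
  show ?thesis
  proof (cases "\<exists>a\<in>set w. fst a < 0")
    case True
    thus ?thesis using triv by blast
  next
    case False
    hence nn: "\<forall>a\<in>set w. fst a \<ge> 0" by auto
    have wM: "snd ` set w \<subseteq> ?M - {\<alpha>}" and m0: "\<mu>0 \<in> ?M - {\<alpha>}" using assms by auto
    have "I (snd a) \<in> mark_algebra B" if "a \<in> set w" for a
      using wM imageI[OF that, of snd] by (intro I(1)) blast
    hence "W w \<in> lists (range jump_kernel \<times> mark_algebra B)"
      by (auto simp: W_def lists_eq_set)
    hence ag: "agree ((\<lambda>_. 1, I \<mu>0) # W w)"
      using agree_mark_algebra[of "I \<mu>0" "W w" "[]"] I(1)[OF m0] by simp
    have st: "path_sum \<alpha> \<zeta> ((\<lambda>_. 1, I \<mu>0) # W w) 0 > 0 \<longleftrightarrow> (\<exists>x. \<zeta> x = \<mu>0 \<and> trace \<zeta> w x)"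
      if z: "\<zeta> \<in> {\<eta>, \<eta>'}" for \<zeta>
    proof -
      have "path_sum \<alpha> \<zeta> ((\<lambda>_. 1, I \<mu>0) # W w) 0 > 0 \<longleftrightarrow>
       (\<exists>y\<in>defects \<alpha> \<zeta>. fst ((\<lambda>_. 1::real, I \<mu>0)) (y - 0) > 0
         \<and> snd ((\<lambda>_::int. 1::real, I \<mu>0)) (\<zeta> y) > 0 \<and> path_sum \<alpha> \<zeta> (W w) y > 0)"
      proof (rule path_sum_Cons_pos_iff)
        show "finite (defects \<alpha> \<zeta>)" using z fin by auto
      next
        fix b z assume "b \<in> set ((\<lambda>_::int. 1::real, I \<mu>0) # W w)"
        thus "0 \<le> fst b z" by (auto simp: jump_kernel_def W_def)
      next
        fix b y assume "b \<in> set ((\<lambda>_::int. 1::real, I \<mu>0) # W w)"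
        hence "snd b \<in> I ` insert \<mu>0 (snd ` set w)" by (force simp: W_def)
        then obtain \<mu> where "\<mu> \<in> insert \<mu>0 (snd ` set w)" "snd b = I \<mu>" by blast
        hence "\<mu> \<in> ?M - {\<alpha>}" "snd b = I \<mu>" using wM m0 by auto
        thus "0 \<le> snd b (\<zeta> y)" using Ival z by simp
      qed
      moreover have "y \<in> defects \<alpha> \<zeta>" if "\<zeta> y = \<mu>0" for y
        using m0 that by (simp add: defects_def)
      moreover have "of_bool (\<zeta> y = \<mu>0) > (0::real) \<longleftrightarrow> \<zeta> y = \<mu>0" for y by simp
      ultimately show ?thesis
        unfolding fst_conv snd_conv Ival[OF m0 z] pos[OF z wM nn] using zero_less_one by blast
    qed
    show ?thesis using st[of \<eta>] st[of \<eta>'] ag by (simp add: agree_def)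
  qed
qed

text \<open>Serves to compare diameters: applied to the extreme defects, in both directions, it
  shows that the two defect sets have the same diameter and that they are empty together.\<close>

lemma pair_transfer:
  assumes "x \<in> defects \<alpha> \<eta>'" "y \<in> defects \<alpha> \<eta>'"
  shows "\<exists>x'\<in>defects \<alpha> \<eta>. \<exists>y'\<in>defects \<alpha> \<eta>. \<bar>y' - x'\<bar> = \<bar>y - x\<bar>"
proof -
  have "\<exists>z. \<eta>' z = \<eta>' x \<and> trace \<eta>' [(\<bar>y - x\<bar>, \<eta>' y)] z" by auto
  hence "\<exists>z. \<eta> z = \<eta>' x \<and> trace \<eta> [(\<bar>y - x\<bar>, \<eta>' y)] z"
    using assms trace_transfer[of "\<eta>' x" "[(\<bar>y - x\<bar>, \<eta>' y)]"] by (auto simp: defects_def)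
  then obtain x' y' where "\<eta> x' = \<eta>' x" "\<bar>y' - x'\<bar> = \<bar>y - x\<bar>" "\<eta> y' = \<eta>' y" by auto
  thus ?thesis using assms unfolding defects_def by (metis (mono_tags) mem_Collect_eq)
qed

text \<open>A walk a, b, v, a, b, v' with a, b the extreme defects of \<open>\<eta>'\<close> is matched by a walk on the
  defects of \<open>\<eta>\<close> that visits the extreme defects a0, b0 in the same order before v and before v',
  unless v is the midpoint of a and b.\<close>

lemma orientation:
  assumes diam: "b - a = b0 - a0"
    and ab: "a \<in> defects \<alpha> \<eta>'" "b \<in> defects \<alpha> \<eta>'" "defects \<alpha> \<eta>' \<subseteq> {a..b}"
    and ab0: "defects \<alpha> \<eta> \<subseteq> {a0..b0}"
  shows "(\<forall>v\<in>defects \<alpha> \<eta>'. \<eta> (v + (a0 - a)) = \<eta>' v) \<or> (\<forall>v\<in>defects \<alpha> \<eta>'. \<eta> (- v + (a + b0)) = \<eta>' v)"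
proof (rule ccontr)
  assume "\<not> ?thesis"
  \<comment> \<open>\<open>v1\<close> refutes the translation taking \<open>a\<close> to
    \<open>a0\<close>, and \<open>v2\<close> the reflection taking \<open>a\<close> to
    \<open>b0\<close>.\<close>
  then obtain v1 v2 where v1: "v1 \<in> defects \<alpha> \<eta>'" "\<eta> (v1 + (a0 - a)) \<noteq> \<eta>' v1"
    and v2: "v2 \<in> defects \<alpha> \<eta>'" "\<eta> (- v2 + (a + b0)) \<noteq> \<eta>' v2" by blast
  have bnd: "a0 \<le> y \<and> y \<le> b0" if "\<eta> y = \<mu>" "\<mu> \<noteq> \<alpha>" for y \<mu>
    using ab0 that by (auto simp: defects_def)
  have bnd': "a \<le> v \<and> v \<le> b" if "v \<in> defects \<alpha> \<eta>'" for v
    using ab(3) that by auto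
  have ne: "\<eta>' v \<noteq> \<alpha>" if "v \<in> defects \<alpha> \<eta>'" for v using that by (simp add: defects_def)
  note nes = ne[OF ab(1)] ne[OF ab(2)] ne[OF v1(1)] ne[OF v2(1)]
  note bnds = bnd'[OF v1(1)] bnd'[OF v2(1)]
  show False
  proof (cases "v1 - a = b - v1")
    \<comment> \<open>Translation and reflection agree at the midpoint, so either orientation of the
      extreme defects puts the site matched to \<open>v1\<close> at
      \<open>v1 + (a0 - a)\<close>.\<close>
    case True
    let ?w = "[(b - a, \<eta>' b), (b - v1, \<eta>' v1)]"
    have "trace \<eta>' ?w a"
      by (simp, rule exI[of _ b], simp add: bnd'[OF ab(2)], rule exI[of _ v1], use bnds in simp)
    hence "\<exists>x. \<eta>' x = \<eta>' a \<and> trace \<eta>' ?w x" by blast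
    moreover have "snd ` set ?w \<subseteq> range \<eta> \<union> range \<eta>' - {\<alpha>}" using nes by simp
    moreover have "\<eta>' a \<in> range \<eta> \<union> range \<eta>' - {\<alpha>}" using nes by simp
    ultimately have "\<exists>x. \<eta> x = \<eta>' a \<and> trace \<eta> ?w x"
      using trace_transfer[of "\<eta>' a" ?w] by blast
    then obtain x y z where w: "\<eta> x = \<eta>' a" "\<bar>y - x\<bar> = b - a" "\<eta> y = \<eta>' b"
       "\<bar>z - y\<bar> = b - v1" "\<eta> z = \<eta>' v1"
      unfolding trace.simps fst_conv snd_conv by blast
    note bs = bnd[OF w(1) nes(1)] bnd[OF w(3) nes(2)] bnd[OF w(5) nes(3)]
    have "z = v1 + (a0 - a)" using bs w(2,4) True diam by linarith
    thus False using v1(2) w(5) by simp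
  next
    case False
    let ?w = "[(b - a, \<eta>' b), (b - v1, \<eta>' v1), (v1 - a, \<eta>' a), (b - a, \<eta>' b), (b - v2, \<eta>' v2)]"
    have "trace \<eta>' ?w a"
      by (simp, rule exI[of _ b], simp add: bnd'[OF ab(2)], rule exI[of _ v1],
          simp add: bnds, rule exI[of _ a], simp add: bnds, rule exI[of _ b],
          simp add: bnd'[OF ab(2)], rule exI[of _ v2], use bnds in simp)
    hence "\<exists>x. \<eta>' x = \<eta>' a \<and> trace \<eta>' ?w x" by blast
    moreover have "snd ` set ?w \<subseteq> range \<eta> \<union> range \<eta>' - {\<alpha>}" using nes by simp
    moreover have "\<eta>' a \<in> range \<eta> \<union> range \<eta>' - {\<alpha>}" using nes by simp
    ultimately have "\<exists>x. \<eta> x = \<eta>' a \<and> trace \<eta> ?w x"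
      using trace_transfer[of "\<eta>' a" ?w] by blast
    then obtain x y z x' y' z' where w: "\<eta> x = \<eta>' a" "\<bar>y - x\<bar> = b - a" "\<eta> y = \<eta>' b"
       "\<bar>z - y\<bar> = b - v1" "\<eta> z = \<eta>' v1" "\<bar>x' - z\<bar> = v1 - a" "\<eta> x' = \<eta>' a"
       "\<bar>y' - x'\<bar> = b - a" "\<eta> y' = \<eta>' b" "\<bar>z' - y'\<bar> = b - v2" "\<eta> z' = \<eta>' v2"
      unfolding trace.simps fst_conv snd_conv by blast
    note bs = bnd[OF w(1) nes(1)] bnd[OF w(3) nes(2)] bnd[OF w(5) nes(3)]
      bnd[OF w(7) nes(1)] bnd[OF w(9) nes(2)] bnd[OF w(11) nes(4)]
    consider "x = a0" "y = b0" | "x = b0" "y = a0" using bs(1,2) w(2) diam by linarith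
    thus False
    proof cases
      case 1
      have "z = v1 + (a0 - a)" using bs(3) w(4) 1 diam by linarith
      thus False using v1(2) w(5) by simp
    next
      case 2
      have z: "z = a0 + b - v1" using bs(3) w(4) 2 diam by linarith
      have x': "x' = b0 \<or> x' = a0" using bs(4,5) w(8) diam by linarith
      \<comment> \<open>\<open>x' = a0\<close> would make \<open>v1\<close> equidistant from
        \<open>a\<close> and \<open>b\<close>. Hence the second passage is reversed like the first,
        and \<open>v2\<close> is matched to its reflection.\<close>
      have "x' = b0" using x' w(6) z False diam by linarith
      hence "y' = a0" using bs(5) w(8) diam by linarith
      hence "z' = a0 + b - v2" using bs(6) w(10) by linarith
      hence "z' = - v2 + (a + b0)" using diam by linarith
      thus False using v2(2) w(11) by simp
    qed
  qed
qed

end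

lemma two_sceneries_sym: "two_sceneries \<alpha> \<eta> \<eta>' B p \<Longrightarrow> two_sceneries \<alpha> \<eta>' \<eta> B p"
  unfolding two_sceneries_def by (simp add: Un_commute)

text \<open>The orientation lemma maps defects to defects but says nothing about sites with value
  \<alpha>. The map in the other direction gives the opposite inequality of cardinalities, so the
  isometry is onto the defects, and by injectivity it sends no other site to a defect.\<close>

lemma sceneries_equivalent:
  assumes "two_sceneries \<alpha> \<eta> \<eta>' B p"
  shows "\<exists>c. \<eta>' = \<eta> \<circ> (\<lambda>z. z + c) \<or> \<eta>' = \<eta> \<circ> (\<lambda>z. - z + c)"
proof -
  interpret s: two_sceneries \<alpha> \<eta> \<eta>' B p by (fact assms)
  interpret s': two_sceneries \<alpha> \<eta>' \<eta> B p by (fact two_sceneries_sym[OF assms])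
  let ?V = "defects \<alpha> \<eta>" and ?V' = "defects \<alpha> \<eta>'"
  show ?thesis
  proof (cases "?V' = {}")
    case True
    hence "?V = {}" using s'.pair_transfer by blast
    with True have "\<eta> = (\<lambda>_. \<alpha>)" "\<eta>' = (\<lambda>_. \<alpha>)" by (auto simp: defects_def)
    thus ?thesis by auto
  next
    case ne': False
    hence ne: "?V \<noteq> {}" using s.pair_transfer by blast
    define a b a0 b0 where "a = Min ?V'" and "b = Max ?V'" and "a0 = Min ?V" and "b0 = Max ?V"
    have m: "a \<in> ?V'" "b \<in> ?V'" "?V' \<subseteq> {a..b}" "a0 \<in> ?V" "b0 \<in> ?V" "?V \<subseteq> {a0..b0}"
      using ne ne' s.fin by (auto simp: a_def b_def a0_def b0_def)
    have "a \<le> b" "a0 \<le> b0" using m by auto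
    moreover obtain x y where "x \<in> ?V" "y \<in> ?V" "\<bar>y - x\<bar> = \<bar>b - a\<bar>"
      using s.pair_transfer[OF m(1,2)] by blast
    hence "\<bar>b - a\<bar> \<le> b0 - a0" using subsetD[OF m(6), of x] subsetD[OF m(6), of y] by auto
    moreover obtain x y where "x \<in> ?V'" "y \<in> ?V'" "\<bar>y - x\<bar> = \<bar>b0 - a0\<bar>"
      using s'.pair_transfer[OF m(4,5)] by blast
    hence "\<bar>b0 - a0\<bar> \<le> b - a" using subsetD[OF m(3), of x] subsetD[OF m(3), of y] by auto
    ultimately have diam: "b - a = b0 - a0" by linarith
    define R where "R = {\<lambda>z. z + (a0 - a), \<lambda>z. - z + (a + b0)}"
    have injR: "inj T" if "T \<in> R" for T :: "int \<Rightarrow> int"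
      using that by (auto simp: R_def inj_def)
    obtain T where T: "T \<in> R" "\<And>v. v \<in> ?V' \<Longrightarrow> \<eta> (T v) = \<eta>' v"
      using s.orientation[OF diam m(1-3,6)] by (auto simp: R_def)
    obtain T' :: "int \<Rightarrow> int" where T': "inj T'" "\<And>v. v \<in> ?V \<Longrightarrow> \<eta>' (T' v) = \<eta> v"
    proof -
      have "inj (\<lambda>z. z + (a - a0))" "inj (\<lambda>z. - z + (a0 + b))" by (auto simp: inj_def)
      thus ?thesis using s'.orientation[OF diam[symmetric] m(4-6,3)] that by blast
    qed
    have "T v \<in> ?V" if "v \<in> ?V'" for v using T(2)[OF that] that by (simp add: defects_def)
    moreover have "T' v \<in> ?V'" if "v \<in> ?V" for v using T'(2)[OF that] that by (simp add: defects_def)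
    ultimately have sub: "T ` ?V' \<subseteq> ?V" "T' ` ?V \<subseteq> ?V'" by blast+
    have "card ?V \<le> card ?V'"
      using sub(2) s.fin(2) T'(1) by (metis card_inj_on_le inj_on_subset subset_UNIV)
    hence TV: "T ` ?V' = ?V"
      using sub(1) s.fin injR[OF T(1)] by (metis card_image card_seteq inj_on_subset subset_UNIV)
    have "\<eta>' z = \<eta> (T z)" for z
    proof (cases "z \<in> ?V'")
      case False
      hence "T z \<notin> ?V" using TV injR[OF T(1)] by (metis image_iff injD)
      thus ?thesis using False by (simp add: defects_def)
    qed (simp add: T(2))
    hence "\<eta>' = \<eta> \<circ> T" by auto
    thus ?thesis using T(1) unfolding R_def by blast
  qed
qed

section \<open>A second moment bound\<close>

lemma sum_lessThan_le_two_sqrt: "(\<Sum>j<n. 1 / sqrt (real (Suc j))) \<le> 2 * sqrt (real n)"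
proof (induction n)
  case (Suc n)
  have "1 / sqrt (real (Suc n)) \<le> 2 * (sqrt (real (Suc n)) - sqrt (real n))"
  proof -
    define a b where "a = sqrt (real n)" and "b = sqrt (real (Suc n))"
    have ab: "0 \<le> a" "a \<le> b" "b > 0" "b * b - a * a = 1" by (simp_all add: a_def b_def)
    have "1 = (b - a) * (b + a)" using ab(4) by (simp add: algebra_simps)
    also have "\<dots> \<le> (b - a) * (2 * b)" using ab by (intro mult_left_mono) auto
    finally show ?thesis using ab(3) unfolding a_def[symmetric] b_def[symmetric]
      by (simp add: field_simps)
  qed
  thus ?case using Suc by simp
qed simp

text \<open>Isolates the features of the return probabilities on which the variance estimate rests:
  monotonicity and an upper bound of order n^(-1/2).\<close>

locale decay =
  fixes u :: "nat \<Rightarrow> real" and C :: real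
  assumes u_pos: "u n > 0" and u_dec: "m \<le> n \<Longrightarrow> u n \<le> u m" and u_0: "u 0 \<le> 1"
    and u_sqrt: "u n \<le> C / sqrt (real (Suc n))"
begin

lemma u_le_1: "u n \<le> 1" using u_dec[of 0 n] u_0 by simp

lemma C_pos: "C > 0"
proof (rule ccontr)
  assume "\<not> C > 0"
  hence "C / sqrt (real (Suc 0)) \<le> 0" by simp
  thus False using u_sqrt[of 0] u_pos[of 0] by linarith
qed

definition B :: "nat \<Rightarrow> real" where "B N = (\<Sum>n<N. (u n)\<^sup>2)"

text \<open>The sum is at most \<open>2 * C * sqrt (Suc m)\<close>, of order m^(1/2), which the
  decay of \<open>u m\<close> cancels.\<close>

lemma u_sum_bound: "u m * (\<Sum>j<Suc m. u j) \<le> 2 * C\<^sup>2"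
proof -
  have "(\<Sum>j<Suc m. u j) \<le> (\<Sum>j<Suc m. C * (1 / sqrt (real (Suc j))))"
    using u_sqrt by (intro sum_mono) simp
  also have "\<dots> \<le> C * (2 * sqrt (real (Suc m)))"
    unfolding sum_distrib_left[symmetric] using C_pos
    by (intro mult_left_mono sum_lessThan_le_two_sqrt) auto
  finally have "u m * (\<Sum>j<Suc m. u j) \<le> (C / sqrt (real (Suc m))) * (C * (2 * sqrt (real (Suc m))))"
    using u_sqrt[of m] u_pos C_pos
    by (intro mult_mono sum_nonneg) (simp_all add: less_imp_le)
  also have "\<dots> = 2 * C\<^sup>2" by (simp add: power2_eq_square)
  finally show ?thesis .
qed

text \<open>Replacing the first factor by \<open>u m\<close> leaves a telescoping sum, bounded by
  the sum of the first \<open>m\<close> terms of \<open>u\<close>; \<open>u_sum_bound\<close> then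
  gives a bound uniform in \<open>m\<close> and \<open>N\<close>.\<close>

lemma shift_diff_bound: "(\<Sum>j<N. u (j + m) * (u j - u (j + m))) \<le> 4 * C\<^sup>2"
proof -
  have "(\<Sum>j<N. u (j + m) * (u j - u (j + m))) \<le> (\<Sum>j<N. u m * (u j - u (j + m)))"
    using u_dec u_pos by (intro sum_mono mult_right_mono) auto
  also have "\<dots> = u m * ((\<Sum>j<N. u j) - (\<Sum>j<N. u (j + m)))"
    by (simp only: sum_distrib_left[symmetric] sum_subtractf)
  also have "(\<Sum>j<N. u j) - (\<Sum>j<N. u (j + m)) \<le> (\<Sum>j<m. u j)"
  proof -
    have "(\<Sum>j<N + m. u j) = (\<Sum>j<m. u j) + (\<Sum>j<N. u (j + m))"
      by (induction N) simp_all
    moreover have "(\<Sum>j<N. u j) \<le> (\<Sum>j<N + m. u j)"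
      using u_pos by (intro sum_mono2) (auto simp: less_imp_le)
    ultimately show ?thesis by simp
  qed
  also have "\<dots> \<le> (\<Sum>j<Suc m. u j)" using u_pos[of m] by simp
  finally have "(\<Sum>j<N. u (j + m) * (u j - u (j + m))) \<le> u m * (\<Sum>j<Suc m. u j)"
    using u_pos[of m] by (simp add: less_imp_le)
  thus ?thesis using u_sum_bound[of m] by (smt (verit) zero_le_power2)
qed

end

text \<open>With \<open>G m n\<close> and \<open>E n\<close> the mixed and first moments of the summands, the main term of the
  covariance at times \<open>m\<close> and \<open>m + j\<close> is \<open>H\<^sup>2 u m (u j - u (m + j))\<close>; by telescoping,
  \<open>shift_diff_bound\<close> makes its weighted sum over \<open>j\<close> bounded.\<close>

lemma (in decay) second_moment:
  fixes G :: "nat \<Rightarrow> nat \<Rightarrow> real" and E e :: "nat \<Rightarrow> real"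
  assumes e: "\<And>n. e n \<ge> 0" "\<And>n. (\<Sum>j<n. e j) \<le> K"
    and G_sym: "\<And>m n. G m n = G n m"
    and mean: "\<And>n. \<bar>E n - H * u n\<bar> \<le> e n"
    and cov: "\<And>m j. \<bar>G m (m + j) - H\<^sup>2 * u m * u j\<bar> \<le> e m * u j + e j"
  shows "(\<Sum>m<N. \<Sum>n<N. u m * u n * (G m n - H * u n * E m - H * u m * E n + H\<^sup>2 * u m * u n))
      \<le> 2 * (4 * H\<^sup>2 * C\<^sup>2 + 2 * K + 2 * \<bar>H\<bar> * K) * B N"
proof -
  define g where "g m n = u m * u n * (G m n - H * u n * E m - H * u m * E n + H\<^sup>2 * u m * u n)" for m n
  have K: "K \<ge> 0" using e(2)[of 0] by simp
  have gsym: "g m n = g n m" for m n by (simp add: g_def G_sym[of m n] algebra_simps)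
  \<comment> \<open>Majorant of the summand with \<open>n = m + j\<close>: the main term, the two
    errors of the covariance and the two errors of the means. Each is arranged as a square of
    \<open>u\<close> times a factor with bounded sums, so that each contributes a multiple of
    \<open>B N\<close>.\<close>
  define b where "b m j = H\<^sup>2 * (u m)\<^sup>2 * (u (j + m) * (u j - u (j + m))) + e m * (u j)\<^sup>2
     + (u m)\<^sup>2 * e j + \<bar>H\<bar> * (e m * (u j)\<^sup>2) + \<bar>H\<bar> * ((u m)\<^sup>2 * e (m + j))" for m j
  have gb: "g m (m + j) \<le> b m j" for m j
  proof -
    let ?n = "m + j"
    have un: "u ?n \<le> u j" "u ?n \<le> u m" "0 \<le> u ?n" "0 \<le> u m" "0 \<le> u j" "u m \<le> 1" "u ?n \<le> 1" "u j \<le> 1"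
      using u_dec u_pos u_le_1 by (auto simp: less_imp_le)
    have split: "G m ?n - H * u ?n * E m - H * u m * E ?n + H\<^sup>2 * u m * u ?n
        = H\<^sup>2 * u m * (u j - u ?n) + (G m ?n - H\<^sup>2 * u m * u j) - H * u ?n * (E m - H * u m) - H * u m * (E ?n - H * u ?n)"
      by (simp add: algebra_simps power2_eq_square)
    have t1: "- (H * u ?n * (E m - H * u m)) \<le> \<bar>H\<bar> * u ?n * e m"
    proof -
      have "- (H * u ?n * (E m - H * u m)) \<le> \<bar>H * u ?n * (E m - H * u m)\<bar>" by simp
      also have "\<dots> = \<bar>H\<bar> * u ?n * \<bar>E m - H * u m\<bar>" using un by (simp add: abs_mult)
      also have "\<dots> \<le> \<bar>H\<bar> * u ?n * e m" using un mean by (intro mult_left_mono) auto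
      finally show ?thesis .
    qed
    have t2: "- (H * u m * (E ?n - H * u ?n)) \<le> \<bar>H\<bar> * u m * e ?n"
    proof -
      have "- (H * u m * (E ?n - H * u ?n)) \<le> \<bar>H * u m * (E ?n - H * u ?n)\<bar>" by simp
      also have "\<dots> = \<bar>H\<bar> * u m * \<bar>E ?n - H * u ?n\<bar>" using un by (simp add: abs_mult)
      also have "\<dots> \<le> \<bar>H\<bar> * u m * e ?n" using un mean by (intro mult_left_mono) auto
      finally show ?thesis .
    qed
    have "g m ?n \<le> u m * u ?n * (H\<^sup>2 * u m * (u j - u ?n) + (e m * u j + e j) + \<bar>H\<bar> * u ?n * e m + \<bar>H\<bar> * u m * e ?n)"
      unfolding g_def split using t1 t2 cov[of m j] un by (intro mult_left_mono) auto
    also have "\<dots> = H\<^sup>2 * (u m)\<^sup>2 * (u ?n * (u j - u ?n)) + u m * (u ?n * u j) * e m + (u m * u ?n) * e j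
        + \<bar>H\<bar> * (u m * (u ?n * u ?n) * e m) + \<bar>H\<bar> * ((u m * u m) * u ?n * e ?n)"
      by (simp add: algebra_simps power2_eq_square)
    also have "\<dots> \<le> H\<^sup>2 * (u m)\<^sup>2 * (u ?n * (u j - u ?n)) + 1 * (u j * u j) * e m + (u m * u m) * e j
        + \<bar>H\<bar> * (1 * (u j * u j) * e m) + \<bar>H\<bar> * ((u m * u m) * 1 * e ?n)"
      using un e(1) by (intro add_mono mult_left_mono mult_right_mono mult_mono order_refl) auto
    also have "\<dots> = b m j" unfolding b_def by (simp add: power2_eq_square add.commute mult_ac)
    finally show ?thesis .
  qed
  have b0: "b m j \<ge> 0" for m j
    unfolding b_def using e(1) u_pos u_dec
    by (intro add_nonneg_nonneg mult_nonneg_nonneg) (auto simp: less_imp_le)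
  \<comment> \<open>Symmetry reduces the double sum to \<open>m \<le> n\<close>; the diagonal is
    counted twice, which is harmless because \<open>b\<close> is nonnegative.\<close>
  have "(\<Sum>m<N. \<Sum>n<N. g m n) \<le> (\<Sum>m<N. \<Sum>n<N. (if m \<le> n then b m (n - m) else 0) + (if n \<le> m then b n (m - n) else 0))"
  proof (intro sum_mono)
    fix m n
    show "g m n \<le> (if m \<le> n then b m (n - m) else 0) + (if n \<le> m then b n (m - n) else 0)"
      using gb[of m "n - m"] gb[of n "m - n"] gsym[of m n] b0[of m "n - m"] b0[of n "m - n"] by auto
  qed
  also have "\<dots> = 2 * (\<Sum>m<N. \<Sum>n<N. (if m \<le> n then b m (n - m) else 0))"
    by (simp add: sum.distrib) (subst (2) sum.swap, simp)
  also have "(\<Sum>m<N. \<Sum>n<N. (if m \<le> n then b m (n - m) else 0)) \<le> (\<Sum>m<N. \<Sum>j<N. b m j)"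
  proof (rule sum_mono)
    fix m assume "m \<in> {..<N}"
    have "(\<Sum>n<N. (if m \<le> n then b m (n - m) else 0)) = (\<Sum>n\<in>{m..<N}. b m (n - m))"
      by (intro sum.mono_neutral_cong_right) auto
    also have "\<dots> = (\<Sum>j<N - m. b m j)"
      by (rule sum.reindex_bij_witness[of _ "\<lambda>j. j + m" "\<lambda>n. n - m"]) auto
    also have "\<dots> \<le> (\<Sum>j<N. b m j)" using b0 by (intro sum_mono2) auto
    finally show "(\<Sum>n<N. (if m \<le> n then b m (n - m) else 0)) \<le> (\<Sum>j<N. b m j)" .
  qed
  also have "(\<Sum>m<N. \<Sum>j<N. b m j) \<le> (\<Sum>m<N. H\<^sup>2 * (u m)\<^sup>2 * (4 * C\<^sup>2) + e m * B N + (u m)\<^sup>2 * K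
      + \<bar>H\<bar> * (e m * B N) + \<bar>H\<bar> * ((u m)\<^sup>2 * K))"
  proof (rule sum_mono)
    fix m
    have e': "(\<Sum>j<N. e (m + j)) \<le> K"
    proof -
      have "(\<Sum>j<N. e (m + j)) = (\<Sum>j\<in>{m..<m+N}. e j)"
        by (rule sum.reindex_bij_witness[of _ "\<lambda>j. j - m" "\<lambda>n. n + m"])
           (auto simp: add.commute)
      also have "\<dots> \<le> (\<Sum>j<m + N. e j)" using e(1) by (intro sum_mono2) auto
      finally show ?thesis using e(2)[of "m + N"] by simp
    qed
    have "(\<Sum>j<N. b m j) = H\<^sup>2 * (u m)\<^sup>2 * (\<Sum>j<N. u (j + m) * (u j - u (j + m))) + e m * B N
       + (u m)\<^sup>2 * (\<Sum>j<N. e j) + \<bar>H\<bar> * (e m * B N) + \<bar>H\<bar> * ((u m)\<^sup>2 * (\<Sum>j<N. e (m + j)))"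
      by (simp only: b_def sum.distrib sum_distrib_left[symmetric] B_def)
    also have "\<dots> \<le> H\<^sup>2 * (u m)\<^sup>2 * (4 * C\<^sup>2) + e m * B N + (u m)\<^sup>2 * K
      + \<bar>H\<bar> * (e m * B N) + \<bar>H\<bar> * ((u m)\<^sup>2 * K)"
      using shift_diff_bound e(2) e' by (intro add_mono mult_left_mono order_refl) auto
    finally show "(\<Sum>j<N. b m j) \<le> H\<^sup>2 * (u m)\<^sup>2 * (4 * C\<^sup>2) + e m * B N + (u m)\<^sup>2 * K
      + \<bar>H\<bar> * (e m * B N) + \<bar>H\<bar> * ((u m)\<^sup>2 * K)" .
  qed
  also have "\<dots> = 4 * H\<^sup>2 * C\<^sup>2 * B N + (\<Sum>j<N. e j) * B N + K * B N + \<bar>H\<bar> * ((\<Sum>j<N. e j) * B N) + \<bar>H\<bar> * (K * B N)"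
    by (simp only: sum.distrib sum_distrib_left[symmetric] sum_distrib_right[symmetric] B_def[symmetric])
       (simp add: algebra_simps)
  also have "\<dots> \<le> 4 * H\<^sup>2 * C\<^sup>2 * B N + K * B N + K * B N + \<bar>H\<bar> * (K * B N) + \<bar>H\<bar> * (K * B N)"
    using e(2) by (intro add_mono mult_left_mono mult_right_mono order_refl) (auto simp: B_def sum_nonneg)
  also have "\<dots> = (4 * H\<^sup>2 * C\<^sup>2 + 2 * K + 2 * \<bar>H\<bar> * K) * B N" by (simp add: algebra_simps)
  finally show ?thesis unfolding g_def by (simp only: mult.assoc mult_left_mono)
qed

section \<open>Fourier analysis of the walk\<close>

lemma expectation_bind_pmf:
  fixes f :: "'b \<Rightarrow> real"
  assumes "\<And>y. \<bar>f y\<bar> \<le> K"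
  shows "measure_pmf.expectation (bind_pmf p N) f
    = measure_pmf.expectation p (\<lambda>x. measure_pmf.expectation (N x) f)"
  unfolding measure_pmf_bind
  using assms
  by (intro integral_bind[where B = K and K = "count_space UNIV" and B' = 1])
     (auto simp: measure_pmf.emeasure_space_1 measure_pmf_in_subprob_algebra)

lemma integrable_pmf_bounded:
  fixes f :: "'a \<Rightarrow> real"
  assumes "\<And>y. \<bar>f y\<bar> \<le> K"
  shows "integrable (measure_pmf p) f"
  using assms by (intro measure_pmf.integrable_const_bound[of _ K]) auto

text \<open>Fubini, after the gauge integral has been rewritten as a Lebesgue integral over the
  interval. Joint measurability comes from the countability of the integers.\<close>

lemma expectation_integral_swap:
  fixes f :: "int \<Rightarrow> real \<Rightarrow> real" and p :: "int pmf"
  assumes cont: "\<And>y. continuous_on {a..b} (f y)" and bnd: "\<And>y x. \<bar>f y x\<bar> \<le> K"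
    and contE: "continuous_on {a..b} (\<lambda>x. measure_pmf.expectation p (\<lambda>y. f y x))"
  shows "measure_pmf.expectation p (\<lambda>y. integral {a..b} (f y))
       = integral {a..b} (\<lambda>x. measure_pmf.expectation p (\<lambda>y. f y x))"
proof -
  define L where "L = restrict_space lborel {a..b}"
  interpret L: finite_measure L
    unfolding L_def by (intro finite_measureI) (simp add: emeasure_restrict_space space_restrict_space emeasure_lborel_Icc_eq)
  interpret P: pair_sigma_finite "measure_pmf p" L by standard
  have LI: "(LINT x|L. g x) = integral {a..b} g" if "continuous_on {a..b} g" for g :: "real \<Rightarrow> real"
  proof -
    have "set_integrable lborel {a..b} g"
      using that by (intro borel_integrable_atLeastAtMost') auto
    hence "(LINT x:{a..b}|lborel. g x) = integral {a..b} g"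
      by (rule set_borel_integral_eq_integral(2))
    thus ?thesis by (simp add: L_def integral_restrict_space set_lebesgue_integral_def)
  qed
  have fm: "(\<lambda>x. f y x) \<in> borel_measurable L" for y
    using borel_measurable_continuous_on_restrict[OF cont[of y]]
    by (simp add: L_def cong: measurable_cong_sets) 
  have meas: "case_prod f \<in> borel_measurable (measure_pmf p \<Otimes>\<^sub>M L)"
  proof -
    have "case_prod f \<in> borel_measurable (count_space UNIV \<Otimes>\<^sub>M L)"
      using fm by (intro measurable_pair_measure_countable1) auto
    thus ?thesis
      by (subst measurable_cong_sets[OF sets_pair_measure_cong[OF sets_measure_pmf_count_space refl] refl])
  qed
  have int: "integrable (measure_pmf p \<Otimes>\<^sub>M L) (case_prod f)"
  proof (rule finite_measure.integrable_const_bound[where B = K])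
    show "finite_measure (measure_pmf p \<Otimes>\<^sub>M L)"
      by (intro finite_measure_pair_measure) (auto intro: measure_pmf.finite_measure_axioms L.finite_measure_axioms)
  qed (use bnd meas in auto)
  have "measure_pmf.expectation p (\<lambda>y. integral {a..b} (f y)) = (\<integral>y. (\<integral>x. f y x \<partial>L) \<partial>measure_pmf p)"
    using LI[OF cont] by simp
  also have "\<dots> = (\<integral>x. (\<integral>y. f y x \<partial>measure_pmf p) \<partial>L)"
    using P.Fubini_integral[OF int] by simp
  also have "\<dots> = integral {a..b} (\<lambda>x. measure_pmf.expectation p (\<lambda>y. f y x))"
    by (rule LI[OF contE])
  finally show ?thesis .
qed

lemma integral_cos_int:
  "integral {-pi..pi} (\<lambda>\<theta>. cos (\<theta> * real_of_int k)) = (if k = 0 then 2 * pi else 0)"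
proof (cases "k = 0")
  case False
  have "((\<lambda>\<theta>. cos (\<theta> * real_of_int k)) has_integral
      (sin (pi * real_of_int k) / real_of_int k - sin (- pi * real_of_int k) / real_of_int k)) {-pi..pi}"
    using False
    by (intro fundamental_theorem_of_calculus)
       (auto intro!: derivative_eq_intros simp: has_real_derivative_iff_has_vector_derivative[symmetric])
  thus ?thesis using False by (auto dest!: integral_unique simp: sin_zero_iff_int2)
qed simp

lemma one_minus_cos_le: "1 - cos (x::real) \<le> x\<^sup>2 / 2"
proof -
  have "1 - cos x = 2 * (sin (x / 2))\<^sup>2"
    using cos_double_sin[of "x / 2"] by simp
  also have "(sin (x / 2))\<^sup>2 \<le> (x / 2)\<^sup>2"
    using abs_sin_x_le_abs_x[of "x/2"] by (subst abs_le_square_iff[symmetric])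
  finally show ?thesis by (simp add: power2_eq_square)
qed

locale symmetric_walk =
  fixes q :: "int pmf"
  assumes standing: "standing_assms q"
begin

lemma q_sym: "pmf q z = pmf q (- z)" using standing by (simp add: standing_assms_def)

lemma map_uminus_q: "map_pmf uminus q = q"
proof (rule pmf_eqI)
  fix z :: int
  have "pmf (map_pmf uminus q) (- (- z)) = pmf q (- z)" by (rule pmf_map_inj') (auto simp: inj_def)
  thus "pmf (map_pmf uminus q) z = pmf q z" using q_sym[of z] by simp
qed

lemma integrable_square: "integrable (measure_pmf q) (\<lambda>z. (real_of_int z)\<^sup>2)"
proof -
  have "(\<lambda>z. real_of_int z ^ 2 * pmf q z) summable_on UNIV" using standing by (simp add: standing_assms_def)
  hence "Infinite_Sum.abs_summable_on (\<lambda>z. real_of_int z ^ 2 * pmf q z) UNIV"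
    by (rule iffD1[OF summable_on_iff_abs_summable_on_real])
  hence "integrable (count_space UNIV) (\<lambda>z. real_of_int z ^ 2 * pmf q z)"
    unfolding abs_summable_equivalent Infinite_Set_Sum.abs_summable_on_def .
  thus ?thesis unfolding measure_pmf_eq_density
    by (subst integrable_density) (auto simp: mult.commute)
qed

definition second_moment_q :: real where
  "second_moment_q = measure_pmf.expectation q (\<lambda>z. (real_of_int z)\<^sup>2)"

text \<open>The characteristic function of \<open>q\<close>, real because \<open>q\<close> is
  symmetric.\<close>

definition \<phi> :: "real \<Rightarrow> real" where
  "\<phi> \<theta> = measure_pmf.expectation q (\<lambda>z. cos (\<theta> * real_of_int z))"

definition p :: "nat \<Rightarrow> int \<Rightarrow> real" where "p t z = pmf (conv_pow q t) z"

lemma integrable_cos [simp]: "integrable (measure_pmf r) (\<lambda>z. cos (\<theta> * real_of_int z))"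
  by (intro integrable_pmf_bounded[of _ 1]) simp
lemma integrable_sin [simp]: "integrable (measure_pmf r) (\<lambda>z. sin (\<theta> * real_of_int z))"
  by (intro integrable_pmf_bounded[of _ 1]) simp

lemma expectation_sin: "measure_pmf.expectation q (\<lambda>z. sin (\<theta> * real_of_int z)) = 0"
proof -
  have "measure_pmf.expectation q (\<lambda>z. sin (\<theta> * real_of_int z))
      = measure_pmf.expectation (map_pmf uminus q) (\<lambda>z. sin (\<theta> * real_of_int z))"
    by (simp only: map_uminus_q)
  also have "\<dots> = - measure_pmf.expectation q (\<lambda>z. sin (\<theta> * real_of_int z))"
    by simp
  finally show ?thesis by simp
qed

lemma conv_pow_trig:
  "measure_pmf.expectation (conv_pow q t) (\<lambda>z. cos (\<theta> * real_of_int z)) = \<phi> \<theta> ^ t \<and>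
   measure_pmf.expectation (conv_pow q t) (\<lambda>z. sin (\<theta> * real_of_int z)) = 0"
proof (induction t)
  case (Suc t)
  have "measure_pmf.expectation (conv_pow q (Suc t)) (\<lambda>z. cos (\<theta> * real_of_int z))
     = measure_pmf.expectation (conv_pow q t) (\<lambda>x. measure_pmf.expectation q (\<lambda>y. cos (\<theta> * real_of_int (x + y))))"
    unfolding conv_pow.simps by (subst expectation_bind_pmf[of _ 1]) simp_all
  also have "\<dots> = measure_pmf.expectation (conv_pow q t) (\<lambda>x. \<phi> \<theta> * cos (\<theta> * real_of_int x))"
    by (simp add: distrib_left cos_add expectation_sin \<phi>_def mult.commute)
  finally have 1: "measure_pmf.expectation (conv_pow q (Suc t)) (\<lambda>z. cos (\<theta> * real_of_int z)) = \<phi> \<theta> ^ Suc t"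
    using Suc by simp
  have "measure_pmf.expectation (conv_pow q (Suc t)) (\<lambda>z. sin (\<theta> * real_of_int z))
     = measure_pmf.expectation (conv_pow q t) (\<lambda>x. measure_pmf.expectation q (\<lambda>y. sin (\<theta> * real_of_int (x + y))))"
    unfolding conv_pow.simps by (subst expectation_bind_pmf[of _ 1]) simp_all
  also have "\<dots> = measure_pmf.expectation (conv_pow q t) (\<lambda>x. \<phi> \<theta> * sin (\<theta> * real_of_int x))"
    by (simp add: distrib_left sin_add expectation_sin \<phi>_def mult.commute)
  finally have 2: "measure_pmf.expectation (conv_pow q (Suc t)) (\<lambda>z. sin (\<theta> * real_of_int z)) = 0"
    using Suc by simp
  from 1 2 show ?case by blast
qed simp

lemma abs_\<phi>_le_1: "\<bar>\<phi> \<theta>\<bar> \<le> 1"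
proof -
  have "\<bar>\<phi> \<theta>\<bar> \<le> measure_pmf.expectation q (\<lambda>z. \<bar>cos (\<theta> * real_of_int z)\<bar>)"
    unfolding \<phi>_def by (rule integral_abs_bound)
  also have "\<dots> \<le> measure_pmf.expectation q (\<lambda>z. 1)"
    by (intro integral_mono integrable_pmf_bounded[of _ 1]) auto
  finally show ?thesis by simp
qed

lemma \<phi>_0: "\<phi> 0 = 1" by (simp add: \<phi>_def)
lemma \<phi>_even: "\<phi> (- \<theta>) = \<phi> \<theta>" by (simp add: \<phi>_def)

lemma one_minus_\<phi>_le: "1 - \<phi> \<theta> \<le> second_moment_q / 2 * \<theta>\<^sup>2"
proof -
  have "1 - \<phi> \<theta> = measure_pmf.expectation q (\<lambda>z. 1 - cos (\<theta> * real_of_int z))"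
    by (simp add: \<phi>_def)
  also have "\<dots> \<le> measure_pmf.expectation q (\<lambda>z. \<theta>\<^sup>2 / 2 * (real_of_int z)\<^sup>2)"
    using integrable_square one_minus_cos_le[of "\<theta> * real_of_int _"]
    by (intro integral_mono) (auto simp: power_mult_distrib)
  finally show ?thesis by (simp add: second_moment_q_def mult.commute)
qed

text \<open>Lipschitz with the second moment as constant: integers satisfy
  \<open>\<bar>z\<bar> \<le> z\<^sup>2\<close>, so the second moment also controls the first
  absolute moment.\<close>

lemma continuous_\<phi>: "continuous_on A \<phi>"
proof -
  define K where "K = second_moment_q"
  have K: "K \<ge> 0" unfolding K_def second_moment_q_def by (intro Bochner_Integration.integral_nonneg) auto
  have lip: "\<bar>\<phi> x - \<phi> y\<bar> \<le> K * \<bar>x - y\<bar>" for x y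
  proof -
    have "\<bar>cos a - cos b\<bar> \<le> \<bar>a - b\<bar>" for a b :: real
    proof -
      have "cos a - cos b = 2 * (sin ((a + b) / 2) * sin ((b - a) / 2))"
        by (simp add: cos_diff_cos)
      hence "\<bar>cos a - cos b\<bar> = 2 * (\<bar>sin ((a + b) / 2)\<bar> * \<bar>sin ((b - a) / 2)\<bar>)"
        by (simp add: abs_mult)
      also have "\<dots> \<le> 2 * (1 * \<bar>(b - a) / 2\<bar>)"
        by (intro mult_left_mono mult_mono abs_sin_x_le_abs_x) auto
      finally show ?thesis by simp
    qed
    hence *: "\<bar>cos (x * real_of_int z) - cos (y * real_of_int z)\<bar> \<le> \<bar>x - y\<bar> * (real_of_int z)\<^sup>2" for z
    proof -
      have "\<bar>cos (x * real_of_int z) - cos (y * real_of_int z)\<bar> \<le> \<bar>x - y\<bar> * \<bar>real_of_int z\<bar>"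
        using \<open>\<And>a b. \<bar>cos a - cos b\<bar> \<le> \<bar>a - b\<bar>\<close>[of "x * real_of_int z" "y * real_of_int z"]
        by (simp add: left_diff_distrib[symmetric] abs_mult)
      also have "\<bar>real_of_int z\<bar> \<le> (real_of_int z)\<^sup>2"
      proof -
        have "\<bar>z\<bar> * 1 \<le> \<bar>z\<bar> * \<bar>z\<bar>" by (cases "z = 0") (simp, intro mult_left_mono, auto)
        hence "\<bar>z\<bar> \<le> z\<^sup>2" by (simp add: power2_eq_square)
        thus ?thesis by (metis of_int_abs of_int_le_iff of_int_power)
      qed
      finally show ?thesis by (simp add: mult_left_mono)
    qed
    have "\<bar>\<phi> x - \<phi> y\<bar> = \<bar>measure_pmf.expectation q (\<lambda>z. cos (x * real_of_int z) - cos (y * real_of_int z))\<bar>"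
      by (simp add: \<phi>_def)
    also have "\<dots> \<le> measure_pmf.expectation q (\<lambda>z. \<bar>cos (x * real_of_int z) - cos (y * real_of_int z)\<bar>)"
      by (rule integral_abs_bound)
    also have "\<dots> \<le> measure_pmf.expectation q (\<lambda>z. \<bar>x - y\<bar> * (real_of_int z)\<^sup>2)"
      using * integrable_square by (intro integral_mono) auto
    also have "\<dots> = K * \<bar>x - y\<bar>" by (simp add: K_def second_moment_q_def)
    finally show ?thesis .
  qed
  have "K-lipschitz_on A \<phi>"
    using lip K by (intro lipschitz_onI) (auto simp: dist_real_def)
  thus ?thesis by (rule lipschitz_on_continuous_on)
qed

lemma \<phi>_continuous_intros [continuous_intros]:
  "continuous_on A f \<Longrightarrow> continuous_on A (\<lambda>x. \<phi> (f x))"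
  using continuous_on_compose2[OF continuous_\<phi>[of UNIV]] by auto

lemma inversion: "integral {-pi..pi} (\<lambda>\<theta>. \<phi> \<theta> ^ t * cos (\<theta> * real_of_int z)) = 2 * pi * p t z"
proof -
  have E: "measure_pmf.expectation (conv_pow q t) (\<lambda>y. cos (\<theta> * real_of_int (y - z))) = \<phi> \<theta> ^ t * cos (\<theta> * real_of_int z)" for \<theta>
    using conv_pow_trig[of t \<theta>] by (simp add: right_diff_distrib cos_diff)
  have "integral {-pi..pi} (\<lambda>\<theta>. \<phi> \<theta> ^ t * cos (\<theta> * real_of_int z))
      = integral {-pi..pi} (\<lambda>\<theta>. measure_pmf.expectation (conv_pow q t) (\<lambda>y. cos (\<theta> * real_of_int (y - z))))"
    by (simp only: E)
  also have "\<dots> = measure_pmf.expectation (conv_pow q t) (\<lambda>y. integral {-pi..pi} (\<lambda>\<theta>. cos (\<theta> * real_of_int (y - z))))"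
    by (rule expectation_integral_swap[symmetric, where K = 1])
       (auto intro!: continuous_intros simp: E[simplified])
  also have "\<dots> = measure_pmf.expectation (conv_pow q t) (\<lambda>y. 2 * pi * indicator {z} y)"
    by (intro Bochner_Integration.integral_cong) (auto simp: integral_cos_int[of "_ - z", simplified] integral_cos_int)
  also have "\<dots> = 2 * pi * p t z"
    by (simp add: p_def measure_pmf_single)
  finally show ?thesis .
qed

text \<open>The integers \<open>z\<close> with \<open>cos (\<theta> * z) = 1\<close> form a
  subgroup, since the sine vanishes there. If \<open>\<phi> \<theta> = 1\<close>, it contains the
  support of \<open>q\<close> and hence 1, but \<open>cos \<theta> = 1\<close> is impossible for
  these \<theta>.\<close>

lemma \<phi>_neq_1:
  assumes "0 < \<theta>" "\<theta> \<le> pi" shows "\<phi> \<theta> \<noteq> 1"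
proof
  assume "\<phi> \<theta> = 1"
  hence "measure_pmf.expectation q (\<lambda>z. 1 - cos (\<theta> * real_of_int z)) = 0" by (simp add: \<phi>_def)
  hence "AE z in measure_pmf q. 1 - cos (\<theta> * real_of_int z) = 0"
    by (subst (asm) integral_nonneg_eq_0_iff_AE) auto
  hence sub: "set_pmf q \<subseteq> {z. cos (\<theta> * real_of_int z) = 1}" by (auto simp: AE_measure_pmf_iff)
  let ?G = "{z::int. cos (\<theta> * real_of_int z) = 1}"
  have "a - b \<in> ?G" if "a \<in> ?G" "b \<in> ?G" for a b
  proof -
    have "sin (\<theta> * real_of_int a) = 0" "sin (\<theta> * real_of_int b) = 0"
      using that by (auto intro: cos_one_sin_zero)
    thus ?thesis using that by (simp add: right_diff_distrib cos_diff)
  qed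
  hence "int_subgroup_gen (set_pmf q) \<subseteq> ?G"
    unfolding int_subgroup_gen_def using sub by (intro Inter_lower) auto
  moreover have "int_subgroup_gen (set_pmf q) = UNIV" using standing by (simp add: standing_assms_def)
  ultimately have "1 \<in> ?G" by blast
  hence "cos \<theta> = 1" by simp
  thus False using assms cos_monotone_0_pi[of 0 \<theta>] by simp
qed

text \<open>Otherwise the odd convolution powers live on points where the cosine is -1 and never
  charge 0, so all return times are even, against the gcd assumption.\<close>

lemma \<phi>_neq_minus_1: "\<phi> \<theta> \<noteq> -1"
proof
  assume m1: "\<phi> \<theta> = -1"
  have "even n" if "n \<ge> 1" "pmf (conv_pow q n) 0 > 0" for n
  proof (rule ccontr)
    assume "odd n"
    hence "measure_pmf.expectation (conv_pow q n) (\<lambda>z. cos (\<theta> * real_of_int z)) = -1"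
      using conv_pow_trig[of n \<theta>] m1 by simp
    hence "measure_pmf.expectation (conv_pow q n) (\<lambda>z. 1 + cos (\<theta> * real_of_int z)) = 0" by simp
    hence "AE z in measure_pmf (conv_pow q n). 1 + cos (\<theta> * real_of_int z) = 0"
    proof (subst (asm) integral_nonneg_eq_0_iff_AE)
      show "AE z in measure_pmf (conv_pow q n). 0 \<le> 1 + cos (\<theta> * real_of_int z)"
        using cos_ge_minus_one by (intro AE_I2) (smt (verit))
    qed auto
    moreover have "0 \<in> set_pmf (conv_pow q n)" using that by (simp add: set_pmf_iff)
    ultimately have "1 + cos (\<theta> * real_of_int 0) = 0" unfolding AE_measure_pmf_iff by blast
    thus False by simp
  qed
  hence "2 dvd Gcd {n::nat. n \<ge> 1 \<and> pmf (conv_pow q n) 0 > 0}" by (intro Gcd_greatest) auto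
  thus False using standing by (simp add: standing_assms_def)
qed

lemma abs_\<phi>_less_1: "0 < \<bar>\<theta>\<bar> \<Longrightarrow> \<bar>\<theta>\<bar> \<le> pi \<Longrightarrow> \<bar>\<phi> \<theta>\<bar> < 1"
  using \<phi>_neq_1[of "\<bar>\<theta>\<bar>"] \<phi>_neq_minus_1[of \<theta>] abs_\<phi>_le_1[of \<theta>] \<phi>_even[of \<theta>]
  by (cases "\<theta> \<ge> 0") (auto simp: abs_if split: if_splits)

end

text \<open>These are the Chebyshev polynomials, built by their three-term recurrence.\<close>

lemma poly_cos_multiple: "\<exists>P::real poly. \<forall>\<theta>. cos (\<theta> * real n) = poly P (cos \<theta>)"
proof (induction n rule: less_induct)
  case (less n)
  consider "n = 0" | "n = 1" | m where "n = Suc (Suc m)"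
    by (metis One_nat_def not0_implies_Suc)
  thus ?case
  proof cases
    case 1
    thus ?thesis by (intro exI[of _ 1]) simp
  next
    case 2
    thus ?thesis by (intro exI[of _ "[:0, 1:]"]) simp
  next
    case (3 m)
    obtain P Q where P: "\<And>\<theta>. cos (\<theta> * real m) = poly P (cos \<theta>)"
      and Q: "\<And>\<theta>. cos (\<theta> * real (Suc m)) = poly Q (cos \<theta>)"
      using less.IH[of m] less.IH[of "Suc m"] 3 by auto
    have "cos (\<theta> * real n) = 2 * cos \<theta> * cos (\<theta> * real (Suc m)) - cos (\<theta> * real m)" for \<theta>
    proof -
      have "cos (\<theta> * real (Suc m) + \<theta>) + cos (\<theta> * real (Suc m) - \<theta>) = 2 * cos \<theta> * cos (\<theta> * real (Suc m))"
        by (simp add: cos_add cos_diff)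
      moreover have "\<theta> * real (Suc m) + \<theta> = \<theta> * real n" "\<theta> * real (Suc m) - \<theta> = \<theta> * real m"
        by (simp_all add: 3 algebra_simps)
      ultimately show ?thesis by (simp only: algebra_simps)
    qed
    hence "\<forall>\<theta>. cos (\<theta> * real n) = poly ([:0, 2:] * Q - P) (cos \<theta>)" by (simp add: P Q del: of_nat_Suc)
    thus ?thesis by blast
  qed
qed

lemma poly_cos_sum:
  "\<exists>P::real poly. \<forall>\<theta>. (\<Sum>d\<in>{-M..M}. c d * cos (\<theta> * real_of_int d)) = poly P (cos \<theta>)"
proof -
  obtain P :: "nat \<Rightarrow> real poly" where P: "\<And>n \<theta>. cos (\<theta> * real n) = poly (P n) (cos \<theta>)"
    using poly_cos_multiple by metis
  have "cos (\<theta> * real_of_int d) = poly (P (nat \<bar>d\<bar>)) (cos \<theta>)" for \<theta> d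
    using P[of \<theta> "nat \<bar>d\<bar>"] by (cases "d \<ge> 0") auto
  hence "(\<Sum>d\<in>{-M..M}. c d * cos (\<theta> * real_of_int d)) = poly (\<Sum>d\<in>{-M..M}. smult (c d) (P (nat \<bar>d\<bar>))) (cos \<theta>)" for \<theta>
    by (simp add: poly_sum)
  thus ?thesis by blast
qed

text \<open>Factoring out the full power of the root 1 leaves a cofactor that keeps its sign near
  \<open>cos 0 = 1\<close>, and the power of \<open>cos \<theta> - 1\<close> has constant sign off
  0. The number \<open>s\<close> combines the two signs.\<close>

lemma poly_cos_sign:
  fixes P :: "real poly"
  assumes "P \<noteq> 0"
  shows "\<exists>s \<delta>. \<delta> > 0 \<and> (\<forall>\<theta>. 0 < \<bar>\<theta>\<bar> \<and> \<bar>\<theta>\<bar> \<le> \<delta> \<longrightarrow> s * poly P (cos \<theta>) > 0)"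
proof -
  obtain R where R: "P = [:- 1, 1:] ^ order 1 P * R" "\<not> [:- 1, 1:] dvd R"
    using order_decomp[OF assms, of 1] by auto
  have R1: "poly R 1 \<noteq> 0" using R(2) by (simp add: poly_eq_0_iff_dvd)
  define r where "r = poly R 1"
  have "continuous (at 0) (\<lambda>\<theta>. r * poly R (cos \<theta>))" by (intro continuous_intros)
  hence "((\<lambda>\<theta>. r * poly R (cos \<theta>)) \<longlongrightarrow> r * poly R (cos 0)) (at 0)" by (simp add: continuous_within)
  moreover have "r * poly R (cos 0) > 0" using R1 by (auto simp: r_def zero_less_mult_iff)
  ultimately have "\<forall>\<^sub>F \<theta> in at 0. r * poly R (cos \<theta>) > 0" by (rule order_tendstoD)
  then obtain d where d: "d > 0" "\<And>\<theta>. \<theta> \<noteq> 0 \<Longrightarrow> \<bar>\<theta>\<bar> < d \<Longrightarrow> r * poly R (cos \<theta>) > 0"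
    unfolding eventually_at by (auto simp: dist_real_def)
  define s where "s = (-1) ^ order 1 P * r"
  have "s * poly P (cos \<theta>) > 0" if "0 < \<bar>\<theta>\<bar>" "\<bar>\<theta>\<bar> \<le> min (d/2) 1" for \<theta>
  proof -
    have "cos \<bar>\<theta>\<bar> < cos 0" using that pi_gt3 by (intro cos_monotone_0_pi) auto
    hence "cos \<theta> < 1" by simp
    have "s * poly P (cos \<theta>) = ((-1) ^ order 1 P * (cos \<theta> - 1) ^ order 1 P) * (r * poly R (cos \<theta>))"
      unfolding s_def by (subst R(1)) (simp add: mult_ac)
    also have "(-1) ^ order 1 P * (cos \<theta> - 1) ^ order 1 P = (1 - cos \<theta>) ^ order 1 P"
      by (simp add: power_mult_distrib[symmetric])
    also have "\<dots> * (r * poly R (cos \<theta>)) > 0"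
      using \<open>cos \<theta> < 1\<close> d(2)[of \<theta>] d(1) that by (intro mult_pos_pos[OF zero_less_power]) auto
    finally show ?thesis .
  qed
  thus ?thesis using d(1) by (intro exI[of _ s] exI[of _ "min (d/2) 1"]) auto
qed

section \<open>Return and transition probabilities: bounds and asymptotics\<close>

context symmetric_walk
begin

text \<open>Only even times: there the Fourier integrand is an even power of \<phi>, hence
  nonnegative, which gives monotonicity and two-sided bounds. At odd times the return probability
  may vanish.\<close>

definition u :: "nat \<Rightarrow> real" where "u n = p (2 * n) 0"

lemma u_integral: "2 * pi * u n = integral {-pi..pi} (\<lambda>\<theta>. \<phi> \<theta> ^ (2 * n))"
  using inversion[of "2 * n" 0] by (simp add: u_def)

lemma support_nonzero: "\<exists>z0\<in>set_pmf q. z0 \<noteq> 0"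
proof (rule ccontr)
  assume "\<not> ?thesis"
  hence "set_pmf q \<subseteq> {0}" by auto
  hence "int_subgroup_gen (set_pmf q) \<subseteq> {0}" unfolding int_subgroup_gen_def by (intro Inter_lower) auto
  moreover have "int_subgroup_gen (set_pmf q) = UNIV" using standing by (simp add: standing_assms_def)
  ultimately have "(1::int) \<in> {0}" by blast
  thus False by simp
qed

text \<open>All terms \<open>1 - cos\<close> are nonnegative, so a single atom
  \<open>z0 \<noteq> 0\<close> of \<open>q\<close> suffices. The 1/4 in the constant is a choice
  below the limit 1/2 of \<open>(1 - cos x) / x\<^sup>2\<close> at 0.\<close>

lemma one_minus_\<phi>_near_0: "\<exists>c>0. \<forall>\<^sub>F \<theta> in at 0. 1 - \<phi> \<theta> \<ge> c * \<theta>\<^sup>2"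
proof -
  obtain z0 where z0: "z0 \<in> set_pmf q" "z0 \<noteq> 0" using support_nonzero by blast
  define b where "b = real_of_int z0"
  have b: "b \<noteq> 0" using z0 by (simp add: b_def)
  have le: "pmf q z0 * (1 - cos (\<theta> * b)) \<le> 1 - \<phi> \<theta>" for \<theta>
  proof -
    have "pmf q z0 * (1 - cos (\<theta> * b)) = measure_pmf.expectation q (\<lambda>z. (1 - cos (\<theta> * b)) * indicator {z0} z)"
      by (simp add: measure_pmf_single)
    also have "\<dots> \<le> measure_pmf.expectation q (\<lambda>z. 1 - cos (\<theta> * real_of_int z))"
      by (intro integral_mono integrable_pmf_bounded[of _ 2])
         (auto simp: indicator_def b_def abs_if intro: order_trans[OF cos_le_one] dest: order_trans[OF cos_ge_minus_one])
    also have "\<dots> = 1 - \<phi> \<theta>" by (simp add: \<phi>_def)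
    finally show ?thesis .
  qed
  have "((\<lambda>x::real. (1 - cos x) / x\<^sup>2) \<longlongrightarrow> 1 / 2) (at 0)" by real_asymp
  hence "\<forall>\<^sub>F x in at 0. (1 - cos x) / x\<^sup>2 > (1 / 4 :: real)" by (rule order_tendstoD) simp
  then obtain d where d: "d > 0" "\<And>x. x \<noteq> 0 \<Longrightarrow> \<bar>x\<bar> < d \<Longrightarrow> (1 - cos x) / x\<^sup>2 > (1 / 4 :: real)"
    unfolding eventually_at by (auto simp: dist_real_def)
  define c where "c = pmf q z0 * (b\<^sup>2 / 4)"
  have "c > 0" using z0 b by (auto simp: c_def pmf_positive)
  moreover have "\<forall>\<^sub>F \<theta> in at 0. 1 - \<phi> \<theta> \<ge> c * \<theta>\<^sup>2"
    unfolding eventually_at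
  proof (intro exI[of _ "d / \<bar>b\<bar>"] conjI ballI impI)
    show "0 < d / \<bar>b\<bar>" using d b by simp
    fix \<theta> :: real assume "\<theta> \<noteq> 0 \<and> dist \<theta> 0 < d / \<bar>b\<bar>"
    hence "\<theta> * b \<noteq> 0" "\<bar>\<theta> * b\<bar> < d" using b by (auto simp: dist_real_def abs_mult field_simps)
    from d(2)[OF this] have "(\<theta> * b)\<^sup>2 / 4 \<le> 1 - cos (\<theta> * b)"
      using \<open>\<theta> * b \<noteq> 0\<close> by (simp add: field_simps)
    hence "pmf q z0 * ((\<theta> * b)\<^sup>2 / 4) \<le> pmf q z0 * (1 - cos (\<theta> * b))" by (intro mult_left_mono) auto
    moreover have "pmf q z0 * ((\<theta> * b)\<^sup>2 / 4) = c * \<theta>\<^sup>2" by (simp add: c_def power_mult_distrib mult_ac)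
    ultimately show "1 - \<phi> \<theta> \<ge> c * \<theta>\<^sup>2" using le[of \<theta>] by linarith
  qed
  ultimately show ?thesis by blast
qed

text \<open>Near 0 the previous bound applies because
  \<open>(\<phi> \<theta>)\<^sup>2 \<le> \<phi> \<theta>\<close> where \<phi> is positive. Away from
  0 compactness gives a positive minimum \<open>m\<close>, and \<open>m / pi\<^sup>2\<close>
  converts it into a multiple of \<open>\<theta>\<^sup>2\<close>.\<close>

lemma \<phi>_gap: "\<exists>c>0. \<forall>\<theta>. \<bar>\<theta>\<bar> \<le> pi \<longrightarrow> 1 - (\<phi> \<theta>)\<^sup>2 \<ge> c * \<theta>\<^sup>2"
proof -
  obtain c where c: "c > 0" "\<forall>\<^sub>F \<theta> in at 0. 1 - \<phi> \<theta> \<ge> c * \<theta>\<^sup>2" using one_minus_\<phi>_near_0 by blast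
  have "continuous (at 0) \<phi>" using continuous_\<phi>[of UNIV] by (simp add: continuous_on_eq_continuous_at)
  hence "(\<phi> \<longlongrightarrow> 1) (at 0)" using \<phi>_0 by (simp add: continuous_within)
  hence "\<forall>\<^sub>F \<theta> in at 0. \<phi> \<theta> > 0" by (rule order_tendstoD) simp
  with c(2) have "\<forall>\<^sub>F \<theta> in at 0. 1 - (\<phi> \<theta>)\<^sup>2 \<ge> c * \<theta>\<^sup>2"
  proof eventually_elim
    case (elim \<theta>)
    have "(\<phi> \<theta>)\<^sup>2 \<le> \<phi> \<theta>" using elim abs_\<phi>_le_1[of \<theta>] by (simp add: power2_eq_square mult_le_cancel_left1)
    thus ?case using elim by linarith
  qed
  then obtain d where d: "d > 0" "\<And>\<theta>. \<theta> \<noteq> 0 \<Longrightarrow> \<bar>\<theta>\<bar> < d \<Longrightarrow> 1 - (\<phi> \<theta>)\<^sup>2 \<ge> c * \<theta>\<^sup>2"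
    unfolding eventually_at by (auto simp: dist_real_def)
  define d' where "d' = min d pi"
  have d': "0 < d'" "d' \<le> pi" using d by (auto simp: d'_def)
  have "\<exists>x\<in>{d'..pi}. \<forall>y\<in>{d'..pi}. 1 - (\<phi> x)\<^sup>2 \<le> 1 - (\<phi> y)\<^sup>2"
    using d' by (intro continuous_attains_inf) (auto intro!: continuous_intros)
  then obtain x where x: "x \<in> {d'..pi}" "\<And>y. y \<in> {d'..pi} \<Longrightarrow> 1 - (\<phi> x)\<^sup>2 \<le> 1 - (\<phi> y)\<^sup>2" by blast
  define m where "m = 1 - (\<phi> x)\<^sup>2"
  have "\<bar>\<phi> x\<bar> < 1" using x(1) d' by (intro abs_\<phi>_less_1) auto
  hence m: "m > 0" by (simp add: m_def abs_square_less_1)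
  define c' where "c' = min c (m / pi\<^sup>2)"
  have "1 - (\<phi> \<theta>)\<^sup>2 \<ge> c' * \<theta>\<^sup>2" if "\<bar>\<theta>\<bar> \<le> pi" for \<theta>
  proof (cases "\<bar>\<theta>\<bar> < d'")
    case True
    have "c' * \<theta>\<^sup>2 \<le> c * \<theta>\<^sup>2" by (intro mult_right_mono) (auto simp: c'_def)
    moreover have "c * \<theta>\<^sup>2 \<le> 1 - (\<phi> \<theta>)\<^sup>2"
      using d(2)[of \<theta>] True \<phi>_0 by (cases "\<theta> = 0") (auto simp: d'_def)
    ultimately show ?thesis by linarith
  next
    case False
    have "c' * \<theta>\<^sup>2 \<le> (m / pi\<^sup>2) * pi\<^sup>2"
      using m that by (intro mult_mono) (auto simp: c'_def abs_le_square_iff[symmetric])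
    also have "\<dots> = m" by simp
    also have "m \<le> 1 - (\<phi> \<bar>\<theta>\<bar>)\<^sup>2" unfolding m_def using False that by (intro x(2)) auto
    also have "\<phi> \<bar>\<theta>\<bar> = \<phi> \<theta>" using \<phi>_even[of \<theta>] by (simp add: abs_if)
    finally show ?thesis .
  qed
  moreover have "c' > 0" using c m by (simp add: c'_def)
  ultimately show ?thesis by blast
qed

lemma integrable_\<phi>: "continuous_on {-pi..pi} f \<Longrightarrow> f integrable_on {-pi..pi}"
  for f :: "real \<Rightarrow> real"
  by (rule integrable_continuous_interval)

lemma u_diff_integral: "2 * pi * (u n - u (Suc n)) = integral {-pi..pi} (\<lambda>\<theta>. \<phi> \<theta> ^ (2 * n) * (1 - (\<phi> \<theta>)\<^sup>2))"
proof -
  have "2 * pi * (u n - u (Suc n)) = integral {-pi..pi} (\<lambda>\<theta>. \<phi> \<theta> ^ (2 * n)) - integral {-pi..pi} (\<lambda>\<theta>. \<phi> \<theta> ^ (2 * Suc n))"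
    by (simp only: u_integral[symmetric] right_diff_distrib)
  also have "\<dots> = integral {-pi..pi} (\<lambda>\<theta>. \<phi> \<theta> ^ (2 * n) - \<phi> \<theta> ^ (2 * Suc n))"
    by (intro integral_diff[symmetric] integrable_\<phi> continuous_intros)
  finally show ?thesis by (simp add: algebra_simps power2_eq_square power_add)
qed

lemma u_Suc_le: "u (Suc n) \<le> u n"
proof -
  have "0 \<le> 2 * pi * (u n - u (Suc n))"
    unfolding u_diff_integral using abs_\<phi>_le_1
    by (intro integral_nonneg integrable_\<phi> continuous_intros mult_nonneg_nonneg) (auto simp: abs_square_le_1)
  thus ?thesis using pi_gt_zero by (simp add: zero_le_mult_iff del: pi_gt_zero)
qed

lemma u_antimono: "m \<le> n \<Longrightarrow> u n \<le> u m"
  by (rule lift_Suc_antimono_le[of u]) (rule u_Suc_le)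

lemma u_0: "u 0 = 1" by (simp add: u_def p_def)

text \<open>With \<open>x = c * \<theta>\<^sup>2\<close>, the power \<open>(1 - x) ^ n\<close> is
  dominated by \<open>2 / (1 + real (Suc n) * x)\<close>, whose integral is an arctangent of the
  right order; this replaces a Gaussian integral.\<close>

lemma u_upper: "\<exists>C. \<forall>n. u n \<le> C / sqrt (real (Suc n))"
proof -
  obtain c where c: "c > 0" "\<And>\<theta>. \<bar>\<theta>\<bar> \<le> pi \<Longrightarrow> 1 - (\<phi> \<theta>)\<^sup>2 \<ge> c * \<theta>\<^sup>2" using \<phi>_gap by blast
  have "u n \<le> (1 / sqrt c) / sqrt (real (Suc n))" for n
  proof -
    define k where "k = sqrt (real (Suc n) * c)"
    have k: "k > 0" "k\<^sup>2 = real (Suc n) * c" using c by (auto simp: k_def)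
    have pw: "\<phi> \<theta> ^ (2 * n) \<le> 2 / (1 + (k * \<theta>)\<^sup>2)" if "\<bar>\<theta>\<bar> \<le> pi" for \<theta>
    proof -
      define x where "x = c * \<theta>\<^sup>2"
      have x: "0 \<le> x" "x \<le> 1" "(\<phi> \<theta>)\<^sup>2 \<le> 1 - x"
        using c(1) c(2)[OF that] zero_le_power2[of "\<phi> \<theta>"] by (auto simp: x_def intro: order_trans)
      have "\<phi> \<theta> ^ (2 * n) = ((\<phi> \<theta>)\<^sup>2) ^ n" by (simp add: power_mult)
      also have "\<dots> \<le> (1 - x) ^ n" using x by (intro power_mono) auto
      finally have 1: "\<phi> \<theta> ^ (2 * n) \<le> (1 - x) ^ n" .
      \<comment> \<open>Bernoulli's inequality bounds the second factor by
        \<open>(1 + x) ^ Suc n\<close>, and the product collapses to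
        \<open>(1 - x\<^sup>2) ^ n * (1 + x) \<le> 2\<close>.\<close>
      have "(1 - x) ^ n * (1 + real (Suc n) * x) \<le> (1 - x) ^ n * (1 + x) ^ Suc n"
        using x Bernoulli_inequality[of x "Suc n"] by (intro mult_left_mono) auto
      also have "\<dots> = ((1 - x) * (1 + x)) ^ n * (1 + x)" by (simp add: power_mult_distrib)
      also have "\<dots> \<le> 1 ^ n * 2" using x
        by (intro mult_mono power_mono) (auto simp: algebra_simps mult_le_one intro: mult_nonneg_nonneg)
      finally have "(1 - x) ^ n \<le> 2 / (1 + real (Suc n) * x)"
        using x by (subst pos_le_divide_eq) (auto intro: add_pos_nonneg)
      moreover have "real (Suc n) * x = (k * \<theta>)\<^sup>2" by (simp add: x_def power_mult_distrib k)
      ultimately show ?thesis using 1 by simp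
    qed
    have "((\<lambda>\<theta>. 2 / (1 + (k * \<theta>)\<^sup>2)) has_integral (2 / k * arctan (k * pi) - 2 / k * arctan (k * - pi))) {-pi..pi}"
      using k(1) by (intro fundamental_theorem_of_calculus)
       (auto intro!: derivative_eq_intros simp: has_real_derivative_iff_has_vector_derivative[symmetric] divide_inverse)
    hence int: "integral {-pi..pi} (\<lambda>\<theta>. 2 / (1 + (k * \<theta>)\<^sup>2)) = 4 / k * arctan (k * pi)"
      by (auto dest!: integral_unique simp: arctan_minus)
    have nz: "1 + (k * \<theta>)\<^sup>2 \<noteq> 0" for \<theta> by (smt (verit) zero_le_power2)
    have "2 * pi * u n \<le> integral {-pi..pi} (\<lambda>\<theta>. 2 / (1 + (k * \<theta>)\<^sup>2))"
      unfolding u_integral using pw nz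
      by (intro integral_le integrable_\<phi> continuous_intros) auto
    also have "\<dots> \<le> 4 / k * (pi / 2)" unfolding int using k arctan_ubound[of "k * pi"]
      by (intro mult_left_mono) auto
    finally have "u n \<le> 1 / k" using k by (simp add: field_simps)
    thus ?thesis by (simp add: k_def real_sqrt_mult mult.commute)
  qed
  thus ?thesis by blast
qed

lemma second_moment_q_nonneg: "second_moment_q \<ge> 0"
  unfolding second_moment_q_def by (intro Bochner_Integration.integral_nonneg) auto

lemma u_lower: "\<exists>c>0. \<forall>n. u n \<ge> c / sqrt (real (Suc n))"
proof -
  \<comment> \<open>Adding 1 ensures \<open>s \<ge> 1\<close>, whence \<open>l \<le> 1\<close>
    below, so that the small interval lies inside the period.\<close>
  define s where "s = second_moment_q + 1"
  have s: "s \<ge> 1" using second_moment_q_nonneg by (simp add: s_def)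
  have "u n \<ge> (1 / (4 * pi * sqrt s)) / sqrt (real (Suc n))" for n
  proof -
    \<comment> \<open>Chosen so that \<open>n * s * \<theta>\<^sup>2 \<le> 1 / 2\<close> for
      \<open>\<bar>\<theta>\<bar> \<le> l\<close>; by Bernoulli's inequality the integrand is then
      at least 1/2.\<close>
    define l where "l = 1 / sqrt (2 * s * real (Suc n))"
    have pos: "2 * s * real (Suc n) \<ge> 1" using s mult_mono[of 1 "2 * s" 1 "real (Suc n)"] by simp
    have l: "l > 0" "l \<le> 1" "l\<^sup>2 = 1 / (2 * s * real (Suc n))" using pos s by (auto simp: l_def power_divide)
    have "1 / 2 \<le> \<phi> \<theta> ^ (2 * n)" if "\<bar>\<theta>\<bar> \<le> l" for \<theta>
    proof -
      define x where "x = s * \<theta>\<^sup>2"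
      have "\<theta>\<^sup>2 \<le> l\<^sup>2" using that l(1) by (subst abs_le_square_iff[symmetric]) simp
      hence "x \<le> s * l\<^sup>2" unfolding x_def using s by (intro mult_left_mono) auto
      also have "\<dots> = 1 / (2 * real (Suc n))" using s unfolding l(3) by (simp add: divide_simps)
      finally have x: "x * real (Suc n) \<le> 1 / 2" by (simp add: field_simps)
      have x0: "x \<ge> 0" using s by (simp add: x_def)
      have x1: "x \<le> 1" "real n * x \<le> 1 / 2"
        using x mult_left_mono[of 1 "real (Suc n)" x] mult_left_mono[of "real n" "real (Suc n)" x] x0
        by (simp_all add: mult.commute)
      have "1 - \<phi> \<theta> \<le> x / 2"
      proof -
        have "second_moment_q / 2 * \<theta>\<^sup>2 \<le> s / 2 * \<theta>\<^sup>2" by (intro mult_right_mono) (auto simp: s_def)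
        thus ?thesis using one_minus_\<phi>_le[of \<theta>] by (simp add: x_def)
      qed
      hence "(1 - x / 2)\<^sup>2 \<le> (\<phi> \<theta>)\<^sup>2" using x1 by (intro power_mono) auto
      moreover have "(1 - x / 2)\<^sup>2 = 1 - x + x\<^sup>2 / 4" by (simp add: power2_eq_square field_simps)
      ultimately have "1 - x \<le> (\<phi> \<theta>)\<^sup>2" by (smt (verit) zero_le_power2 divide_nonneg_pos)
      hence "(1 - x) ^ n \<le> ((\<phi> \<theta>)\<^sup>2) ^ n" using x1 by (intro power_mono) auto
      moreover have "1 + real n * (- x) \<le> (1 + (- x)) ^ n" using x1 by (intro Bernoulli_inequality) auto
      ultimately show ?thesis using x1 by (simp add: power_mult)
    qed
    hence "integral {-l..l} (\<lambda>\<theta>. 1 / 2) \<le> integral {-l..l} (\<lambda>\<theta>. \<phi> \<theta> ^ (2 * n))"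
      by (intro integral_le integrable_continuous_interval continuous_intros) auto
    also have "\<dots> \<le> integral {-pi..pi} (\<lambda>\<theta>. \<phi> \<theta> ^ (2 * n))"
      using l pi_gt3 by (intro integral_subset_le integrable_continuous_interval continuous_intros) (auto simp: power_mult)
    finally have "l \<le> 2 * pi * u n" using l unfolding u_integral by simp
    hence "l / (2 * pi) \<le> u n" by (simp add: field_simps)
    moreover have "l / (2 * pi) \<ge> (1 / (4 * pi * sqrt s)) / sqrt (real (Suc n))"
    proof -
      have "sqrt 2 \<le> (2::real)" by (rule real_le_lsqrt) auto
      hence "1 / (2 * (sqrt s * sqrt (real (Suc n)))) \<le> 1 / (sqrt 2 * (sqrt s * sqrt (real (Suc n))))"
        using s by (intro divide_left_mono mult_right_mono mult_pos_pos) auto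
      also have "\<dots> = l" by (simp only: l_def real_sqrt_mult mult.assoc)
      finally have "1 / (2 * (sqrt s * sqrt (real (Suc n)))) / (2 * pi) \<le> l / (2 * pi)"
        by (intro divide_right_mono) auto
      thus ?thesis by (simp add: mult_ac)
    qed
    ultimately show ?thesis by linarith
  qed
  moreover have "1 / (4 * pi * sqrt s) > 0" using s by simp
  ultimately show ?thesis by blast
qed

lemma u_pos: "u n > 0"
  using u_lower by (metis divide_pos_pos less_le_trans of_nat_0_less_iff real_sqrt_gt_0_iff zero_less_Suc)

lemma sum_u_square_unbounded: "\<exists>N. (\<Sum>n<N. (u n)\<^sup>2) \<ge> K"
proof -
  obtain c where c: "c > 0" "\<And>n. u n \<ge> c / sqrt (real (Suc n))" using u_lower by blast
  have sq: "c\<^sup>2 * (1 / real (Suc n)) \<le> (u n)\<^sup>2" for n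
    using power_mono[OF c(2)[of n], of 2] c(1) by (simp add: power_divide)
  have "\<not> summable (\<lambda>n. (u n)\<^sup>2)"
  proof
    assume "summable (\<lambda>n. (u n)\<^sup>2)"
    hence "summable (\<lambda>n. c\<^sup>2 * (1 / real (Suc n)))"
      by (rule summable_comparison_test'[where N = 0]) (use sq in auto)
    hence "summable (\<lambda>n. inverse (real (Suc n)))"
      using c(1) by (subst (asm) summable_cmult_iff) (simp add: inverse_eq_divide)
    thus False using not_summable_harmonic[where 'a = real] by (subst (asm) summable_Suc_iff) (simp add: inverse_eq_divide)
  qed
  hence "\<not> bdd_above (range (\<lambda>N. \<Sum>n<N. (u n)\<^sup>2))"
    using bounded_imp_summable[of "\<lambda>n. (u n)\<^sup>2"] 
    by (metis (no_types, lifting) summableI_nonneg_bounded bdd_above_def rangeI zero_le_power2)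
  thus ?thesis by (metis (no_types, lifting) bdd_aboveI2 nle_le)
qed

text \<open>A first window of total gap \<tau> leaves \<open>2 * j - \<tau>\<close> steps before the
  second one begins. The difference \<open>cos (\<theta> * z) - \<phi> \<theta> ^ \<tau>\<close> is
  of order \<theta>^2 and so dominated by \<open>1 - (\<phi> \<theta>)\<^sup>2\<close>. Integrated
  against an even power of \<phi>, the latter gives, up to the factor 2 pi, a difference of
  consecutive \<open>u\<close>, so the error is summable over \<open>j\<close>.\<close>

lemma transition_approx:
  "\<exists>K\<ge>0. \<forall>j\<ge>\<tau>. \<bar>p (2 * j - \<tau>) z - u j\<bar> \<le> K * (u (j - \<tau>) - u (Suc (j - \<tau>)))"
proof -
  obtain c where c: "c > 0" "\<And>\<theta>. \<bar>\<theta>\<bar> \<le> pi \<Longrightarrow> 1 - (\<phi> \<theta>)\<^sup>2 \<ge> c * \<theta>\<^sup>2" using \<phi>_gap by blast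
  \<comment> \<open>The first summand comes from \<open>1 - cos (\<theta> * z)\<close>, the second
    from \<open>1 - \<phi> \<theta> ^ \<tau>\<close>, both relative to
    \<open>\<theta>\<^sup>2\<close>.\<close>
  define K0 where "K0 = (real_of_int z)\<^sup>2 / 2 + real \<tau> * (second_moment_q / 2)"
  have K0: "K0 \<ge> 0" using second_moment_q_nonneg by (simp add: K0_def)
  have "\<bar>p (2 * j - \<tau>) z - u j\<bar> \<le> K0 / c * (u (j - \<tau>) - u (Suc (j - \<tau>)))" if j: "j \<ge> \<tau>" for j
  proof -
    have pt: "\<bar>\<phi> \<theta> ^ (2 * j - \<tau>) * cos (\<theta> * real_of_int z) - \<phi> \<theta> ^ (2 * j)\<bar>
       \<le> K0 / c * (\<phi> \<theta> ^ (2 * (j - \<tau>)) * (1 - (\<phi> \<theta>)\<^sup>2))" if "\<bar>\<theta>\<bar> \<le> pi" for \<theta>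
    proof -
      have "\<phi> \<theta> ^ (2 * j) = \<phi> \<theta> ^ (2 * j - \<tau>) * \<phi> \<theta> ^ \<tau>"
        using j by (simp add: power_add[symmetric])
      hence "\<bar>\<phi> \<theta> ^ (2 * j - \<tau>) * cos (\<theta> * real_of_int z) - \<phi> \<theta> ^ (2 * j)\<bar>
         = \<bar>\<phi> \<theta>\<bar> ^ (2 * j - \<tau>) * \<bar>cos (\<theta> * real_of_int z) - \<phi> \<theta> ^ \<tau>\<bar>"
        by (simp add: right_diff_distrib[symmetric] abs_mult power_abs)
      also have "\<dots> \<le> \<phi> \<theta> ^ (2 * (j - \<tau>)) * (K0 / c * (1 - (\<phi> \<theta>)\<^sup>2))"
      proof (rule mult_mono)
        have "\<bar>\<phi> \<theta>\<bar> ^ (2 * j - \<tau>) \<le> \<bar>\<phi> \<theta>\<bar> ^ (2 * (j - \<tau>))"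
          using abs_\<phi>_le_1[of \<theta>] j by (intro power_decreasing) auto
        thus "\<bar>\<phi> \<theta>\<bar> ^ (2 * j - \<tau>) \<le> \<phi> \<theta> ^ (2 * (j - \<tau>))" by (simp add: power_mult)
        have 1: "1 - cos (\<theta> * real_of_int z) \<le> \<theta>\<^sup>2 * ((real_of_int z)\<^sup>2 / 2)"
          using one_minus_cos_le[of "\<theta> * real_of_int z"] by (simp add: power_mult_distrib)
        \<comment> \<open>Bernoulli's inequality is applied for
          \<open>\<phi> \<theta> \<ge> 0\<close>. For negative values and
          \<open>\<tau> \<ge> 2\<close> the bound \<open>\<tau> * (1 - \<phi> \<theta>)\<close> is
          at least 2 anyway.\<close>
        have "1 + real \<tau> * (\<phi> \<theta> - 1) \<le> (1 + (\<phi> \<theta> - 1)) ^ \<tau> \<or> \<phi> \<theta> < 0"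
          using Bernoulli_inequality[of "\<phi> \<theta> - 1" \<tau>] by auto
        hence 2: "1 - \<phi> \<theta> ^ \<tau> \<le> real \<tau> * (1 - \<phi> \<theta>)"
        proof
          assume neg: "\<phi> \<theta> < 0"
          show ?thesis
          proof (cases "\<tau> \<ge> 2")
            case True
            have "2 * 1 \<le> real \<tau> * (1 - \<phi> \<theta>)" using True neg by (intro mult_mono) auto
            moreover have "- 1 \<le> \<phi> \<theta> ^ \<tau>"
              using abs_\<phi>_le_1[of \<theta>] power_le_one[of "\<bar>\<phi> \<theta>\<bar>" \<tau>] by (simp add: power_abs[symmetric] abs_le_iff)
            ultimately show ?thesis by linarith
          next
            case False
            hence "\<tau> = 0 \<or> \<tau> = 1" by linarith
            thus ?thesis by auto
          qed
        qed (simp add: algebra_simps)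
        have "\<bar>cos (\<theta> * real_of_int z) - \<phi> \<theta> ^ \<tau>\<bar> \<le> (1 - cos (\<theta> * real_of_int z)) + (1 - \<phi> \<theta> ^ \<tau>)"
          using cos_le_one[of "\<theta> * real_of_int z"] abs_\<phi>_le_1[of \<theta>] power_le_one[of "\<bar>\<phi> \<theta>\<bar>" \<tau>]
          by (simp add: power_abs[symmetric] abs_le_iff)
        also have "\<dots> \<le> \<theta>\<^sup>2 * ((real_of_int z)\<^sup>2 / 2) + real \<tau> * (second_moment_q / 2 * \<theta>\<^sup>2)"
          using 1 2 mult_left_mono[OF one_minus_\<phi>_le[of \<theta>], of "real \<tau>"] by simp
        also have "\<dots> = K0 / c * (c * \<theta>\<^sup>2)" using c(1) by (simp add: K0_def field_simps)
        also have "\<dots> \<le> K0 / c * (1 - (\<phi> \<theta>)\<^sup>2)" using K0 c that by (intro mult_left_mono) auto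
        finally show "\<bar>cos (\<theta> * real_of_int z) - \<phi> \<theta> ^ \<tau>\<bar> \<le> K0 / c * (1 - (\<phi> \<theta>)\<^sup>2)" .
      qed (auto simp: power_mult)
      finally show ?thesis by (simp add: mult_ac)
    qed
    have "2 * pi * \<bar>p (2 * j - \<tau>) z - u j\<bar> = \<bar>2 * pi * p (2 * j - \<tau>) z - 2 * pi * u j\<bar>"
      by (simp add: right_diff_distrib[symmetric] abs_mult)
    also have "2 * pi * p (2 * j - \<tau>) z - 2 * pi * u j
       = integral {-pi..pi} (\<lambda>\<theta>. \<phi> \<theta> ^ (2 * j - \<tau>) * cos (\<theta> * real_of_int z) - \<phi> \<theta> ^ (2 * j))"
      unfolding inversion[symmetric] u_integral
      by (intro integral_diff[symmetric] integrable_\<phi> continuous_intros)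
    also have "\<bar>\<dots>\<bar> \<le> integral {-pi..pi} (\<lambda>\<theta>. K0 / c * (\<phi> \<theta> ^ (2 * (j - \<tau>)) * (1 - (\<phi> \<theta>)\<^sup>2)))"
      unfolding real_norm_def[symmetric] using pt
      by (intro integral_norm_bound_integral integrable_\<phi> continuous_intros) auto
    also have "\<dots> = 2 * pi * (K0 / c * (u (j - \<tau>) - u (Suc (j - \<tau>))))"
      by (subst integral_mult_right) (simp add: u_diff_integral[symmetric])
    finally show ?thesis by (simp only: mult_le_cancel_left_pos[OF mult_pos_pos[OF zero_less_numeral pi_gt_zero]])
  qed
  moreover have "K0 / c \<ge> 0" using K0 c by simp
  ultimately show ?thesis by blast
qed

text \<open>The hypothesis makes the cosine polynomial \<open>h\<close> orthogonal to all powers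
  \<open>\<phi> ^ t\<close> with \<open>t \<ge> 1\<close>. A nonzero \<open>h\<close> has a sign
  near 0, where \<phi> is close to 1, while farther out the modulus of \<phi> stays below some
  \<rho> < 1; for large even \<open>t\<close> the part near 0 wins and the integral cannot vanish.
  So \<open>h = 0\<close>, and orthogonality of cosines isolates the coefficients at
  \<open>d0\<close> and \<open>- d0\<close>, which enter \<open>h\<close> only through their
  sum.\<close>

lemma kernel_determines_even_part:
  assumes "\<And>t. t \<ge> 1 \<Longrightarrow> (\<Sum>d\<in>{-M..M}. p t d * c d) = 0" and "\<bar>d0\<bar> \<le> M"
  shows "c d0 + c (- d0) = 0"
proof -
  define h where "h \<theta> = (\<Sum>d\<in>{-M..M}. c d * cos (\<theta> * real_of_int d))" for \<theta>
  have cont_h: "continuous_on A h" for A unfolding h_def by (intro continuous_intros)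
  have zero: "integral {-pi..pi} (\<lambda>\<theta>. \<phi> \<theta> ^ t * h \<theta>) = 0" if "t \<ge> 1" for t
  proof -
    have "integral {-pi..pi} (\<lambda>\<theta>. \<phi> \<theta> ^ t * h \<theta>)
        = integral {-pi..pi} (\<lambda>\<theta>. \<Sum>d\<in>{-M..M}. c d * (\<phi> \<theta> ^ t * cos (\<theta> * real_of_int d)))"
      by (simp add: h_def sum_distrib_left mult_ac)
    also have "\<dots> = (\<Sum>d\<in>{-M..M}. c d * (2 * pi * p t d))"
      by (subst integral_sum) (auto intro!: integrable_\<phi> continuous_intros simp: inversion)
    also have "\<dots> = 2 * pi * (\<Sum>d\<in>{-M..M}. p t d * c d)"
      by (simp add: sum_distrib_left mult_ac)
    finally show ?thesis using assms(1)[OF that] by simp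
  qed
  obtain P where P: "\<And>\<theta>. h \<theta> = poly P (cos \<theta>)" using poly_cos_sum[of c M] by (auto simp: h_def)
  have "P = 0"
  proof (rule ccontr)
    assume "P \<noteq> 0"
    then obtain s \<delta> where "\<delta> > 0" "\<forall>\<theta>. 0 < \<bar>\<theta>\<bar> \<and> \<bar>\<theta>\<bar> \<le> \<delta> \<longrightarrow> s * poly P (cos \<theta>) > 0"
      using poly_cos_sign by blast
    define \<delta>' where "\<delta>' = min \<delta> pi"
    define g where "g \<theta> = s * h \<theta>" for \<theta>
    have \<delta>': "0 < \<delta>'" "\<delta>' \<le> pi" using \<open>\<delta> > 0\<close> by (auto simp: \<delta>'_def)
    have g_pos: "g \<theta> > 0" if "0 < \<bar>\<theta>\<bar>" "\<bar>\<theta>\<bar> \<le> \<delta>'" for \<theta>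
      using \<open>\<forall>\<theta>. _\<close> that by (simp add: g_def P \<delta>'_def)
    have cont_g: "continuous_on A g" for A unfolding g_def by (intro continuous_intros cont_h)
    have g_zero: "integral {-pi..pi} (\<lambda>\<theta>. \<phi> \<theta> ^ t * g \<theta>) = 0" if "t \<ge> 1" for t
    proof -
      have "(\<lambda>\<theta>. \<phi> \<theta> ^ t * g \<theta>) = (\<lambda>\<theta>. s * (\<phi> \<theta> ^ t * h \<theta>))" by (simp add: g_def mult_ac)
      thus ?thesis using zero[OF that] by simp
    qed
    have "\<exists>x\<in>{\<delta>'..pi}. \<forall>y\<in>{\<delta>'..pi}. \<bar>\<phi> y\<bar> \<le> \<bar>\<phi> x\<bar>"
      using \<delta>' by (intro continuous_attains_sup) (auto intro!: continuous_intros)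
    then obtain x where x: "x \<in> {\<delta>'..pi}" "\<And>y. y \<in> {\<delta>'..pi} \<Longrightarrow> \<bar>\<phi> y\<bar> \<le> \<bar>\<phi> x\<bar>" by blast
    define \<rho> where "\<rho> = \<bar>\<phi> x\<bar>"
    \<comment> \<open>Halfway between \<rho> and 1: \<phi> exceeds \<open>r\<close> near 0, and the
      powers of \<open>\<rho> / r\<close> tend to 0.\<close>
    define r where "r = (1 + \<rho>) / 2"
    have \<rho>: "0 \<le> \<rho>" "\<rho> < 1" using x(1) \<delta>' abs_\<phi>_less_1[of x] by (auto simp: \<rho>_def)
    have r: "0 < r" "\<rho> < r" "r < 1" using \<rho> by (auto simp: r_def)
    have "continuous (at 0) \<phi>" using continuous_\<phi>[of UNIV] by (simp add: continuous_on_eq_continuous_at)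
    hence "(\<phi> \<longlongrightarrow> 1) (at 0)" using \<phi>_0 by (simp add: continuous_within)
    hence "\<forall>\<^sub>F \<theta> in at 0. \<phi> \<theta> > r" using r by (intro order_tendstoD) auto
    then obtain d where d: "d > 0" "\<And>\<theta>. \<theta> \<noteq> 0 \<Longrightarrow> \<bar>\<theta>\<bar> < d \<Longrightarrow> \<phi> \<theta> > r"
      unfolding eventually_at by (auto simp: dist_real_def)
    define \<epsilon> where "\<epsilon> = min (d / 2) \<delta>'"
    have \<epsilon>: "0 < \<epsilon>" "\<epsilon> < d" "\<epsilon> \<le> \<delta>'" using d(1) \<delta>' by (auto simp: \<epsilon>_def)
    \<comment> \<open>This interval stays off 0, where \<open>g\<close> may vanish, so the minimum
      is positive.\<close>
    have "\<exists>x\<in>{\<epsilon>/2..\<epsilon>}. \<forall>y\<in>{\<epsilon>/2..\<epsilon>}. g x \<le> g y"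
      using \<epsilon> by (intro continuous_attains_inf cont_g) auto
    then obtain x0 where x0: "x0 \<in> {\<epsilon>/2..\<epsilon>}" "\<And>y. y \<in> {\<epsilon>/2..\<epsilon>} \<Longrightarrow> g x0 \<le> g y" by blast
    have m: "g x0 > 0" using x0(1) \<epsilon> by (intro g_pos) auto
    have "\<exists>x\<in>{-pi..pi}. \<forall>y\<in>{-pi..pi}. \<bar>g y\<bar> \<le> \<bar>g x\<bar>"
      by (intro continuous_attains_sup) (auto intro!: continuous_intros cont_g)
    then obtain x1 where x1: "\<And>y. y \<in> {-pi..pi} \<Longrightarrow> \<bar>g y\<bar> \<le> \<bar>g x1\<bar>" by blast
    define G where "G = \<bar>g x1\<bar>"
    have "\<forall>\<^sub>F \<theta> in at 0. g \<theta> \<ge> 0"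
      unfolding eventually_at using \<delta>' g_pos by (intro exI[of _ \<delta>']) (auto simp: dist_real_def less_imp_le)
    moreover have "(g \<longlongrightarrow> g 0) (at 0)"
      using cont_g[of UNIV] by (simp add: continuous_on_eq_continuous_at continuous_within)
    ultimately have g0: "g 0 \<ge> 0" by (intro tendsto_lowerbound[of g]) auto
    have lower: "r ^ (2 * k) * (\<epsilon> / 2 * g x0) \<le> 2 * pi * G * \<rho> ^ (2 * k)" if "k \<ge> 1" for k
    proof -
      \<comment> \<open>The added constant outweighs any negative contribution from beyond
        \<open>\<delta>'\<close>; with a nonnegative integrand the integral may be restricted to a
        subinterval.\<close>
      have nn: "0 \<le> \<phi> \<theta> ^ (2 * k) * g \<theta> + G * \<rho> ^ (2 * k)" if "\<theta> \<in> {-pi..pi}" for \<theta>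
      proof (cases "\<bar>\<theta>\<bar> \<le> \<delta>'")
        case True
        hence "g \<theta> \<ge> 0" using g_pos[of \<theta>] g0 by (cases "\<theta> = 0") auto
        thus ?thesis using \<rho> by (auto simp: power_mult G_def intro!: add_nonneg_nonneg mult_nonneg_nonneg)
      next
        case False
        have "\<bar>\<phi> \<theta>\<bar> = \<bar>\<phi> \<bar>\<theta>\<bar>\<bar>" using \<phi>_even[of \<theta>] by (simp add: abs_if)
        also have "\<dots> \<le> \<rho>" unfolding \<rho>_def using False that by (intro x(2)) auto
        finally have "\<bar>\<phi> \<theta>\<bar> ^ (2 * k) * \<bar>g \<theta>\<bar> \<le> \<rho> ^ (2 * k) * G"
          using x1[OF that] \<rho> by (intro mult_mono power_mono) (auto simp: G_def)
        moreover have "- (\<bar>\<phi> \<theta>\<bar> ^ (2 * k) * \<bar>g \<theta>\<bar>) \<le> \<phi> \<theta> ^ (2 * k) * g \<theta>"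
          using abs_ge_minus_self[of "\<phi> \<theta> ^ (2 * k) * g \<theta>"] by (simp only: abs_mult power_abs)
        ultimately show ?thesis by (simp add: mult.commute)
      qed
      have "integral {\<epsilon>/2..\<epsilon>} (\<lambda>\<theta>. r ^ (2 * k) * g x0) \<le> integral {\<epsilon>/2..\<epsilon>} (\<lambda>\<theta>. \<phi> \<theta> ^ (2 * k) * g \<theta> + G * \<rho> ^ (2 * k))"
      proof (intro integral_le integrable_continuous_interval continuous_intros cont_g)
        fix \<theta> assume \<theta>: "\<theta> \<in> {\<epsilon>/2..\<epsilon>}"
        have "\<phi> \<theta> > r" using \<theta> \<epsilon> by (intro d(2)) auto
        hence "r ^ (2 * k) * g x0 \<le> \<phi> \<theta> ^ (2 * k) * g \<theta>"
          using x0(2)[OF \<theta>] m r by (intro mult_mono power_mono) auto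
        also have "\<dots> \<le> \<phi> \<theta> ^ (2 * k) * g \<theta> + G * \<rho> ^ (2 * k)" using \<rho> by (simp add: G_def)
        finally show "r ^ (2 * k) * g x0 \<le> \<phi> \<theta> ^ (2 * k) * g \<theta> + G * \<rho> ^ (2 * k)" .
      qed
      also have "\<dots> \<le> integral {-pi..pi} (\<lambda>\<theta>. \<phi> \<theta> ^ (2 * k) * g \<theta> + G * \<rho> ^ (2 * k))"
        using nn \<epsilon> \<delta>' by (intro integral_subset_le integrable_continuous_interval continuous_intros cont_g) auto
      also have "\<dots> = integral {-pi..pi} (\<lambda>\<theta>. \<phi> \<theta> ^ (2 * k) * g \<theta>) + integral {-pi..pi} (\<lambda>\<theta>. G * \<rho> ^ (2 * k))"
        by (intro Henstock_Kurzweil_Integration.integral_add integrable_continuous_interval continuous_intros cont_g)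
      also have "\<dots> = 2 * pi * G * \<rho> ^ (2 * k)" using g_zero[of "2 * k"] that by simp
      finally show ?thesis using \<epsilon> by (simp add: field_simps)
    qed
    have "\<bar>(\<rho> / r)\<^sup>2\<bar> < 1" using \<rho> r by (simp add: abs_square_less_1 power_abs)
    hence "(\<lambda>k. ((\<rho> / r)\<^sup>2) ^ k) \<longlonglongrightarrow> 0" by (intro LIMSEQ_power_zero) (simp only: real_norm_def)
    hence "(\<lambda>k. 2 * pi * G * ((\<rho> / r)\<^sup>2) ^ k) \<longlonglongrightarrow> 2 * pi * G * 0" by (rule tendsto_mult_left)
    hence "\<forall>\<^sub>F k in sequentially. 2 * pi * G * ((\<rho> / r)\<^sup>2) ^ k < \<epsilon> / 2 * g x0"
      using \<epsilon> m by (intro order_tendstoD) auto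
    hence "\<forall>\<^sub>F k in sequentially. 2 * pi * G * ((\<rho> / r)\<^sup>2) ^ k < \<epsilon> / 2 * g x0 \<and> k \<ge> 1"
      by (intro eventually_conj eventually_ge_at_top)
    then obtain k where k: "2 * pi * G * ((\<rho> / r)\<^sup>2) ^ k < \<epsilon> / 2 * g x0" "k \<ge> 1"
      by (auto simp: eventually_sequentially)
    have "r ^ (2 * k) * (2 * pi * G * ((\<rho> / r)\<^sup>2) ^ k) < r ^ (2 * k) * (\<epsilon> / 2 * g x0)"
      using k(1) r by (intro mult_strict_left_mono) auto
    moreover have "r ^ (2 * k) * (2 * pi * G * ((\<rho> / r)\<^sup>2) ^ k) = 2 * pi * G * \<rho> ^ (2 * k)"
      using r by (simp add: power_mult[symmetric] power_divide)
    ultimately show False using lower[OF k(2)] by linarith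
  qed
  hence "0 = integral {-pi..pi} (\<lambda>\<theta>. h \<theta> * cos (\<theta> * real_of_int d0))" by (simp add: P)
  also have "\<dots> = integral {-pi..pi} (\<lambda>\<theta>. \<Sum>d\<in>{-M..M}. c d / 2 * (cos (\<theta> * real_of_int (d - d0)) + cos (\<theta> * real_of_int (d + d0))))"
    by (simp add: h_def sum_distrib_right mult.assoc cos_times_cos right_diff_distrib distrib_left
        add_divide_distrib)
  also have "\<dots> = (\<Sum>d\<in>{-M..M}. c d / 2 * ((if d - d0 = 0 then 2 * pi else 0) + (if d + d0 = 0 then 2 * pi else 0)))"
  proof (subst integral_sum)
    show "(\<Sum>d\<in>{-M..M}. integral {-pi..pi} (\<lambda>\<theta>. c d / 2 * (cos (\<theta> * real_of_int (d - d0)) + cos (\<theta> * real_of_int (d + d0)))))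
      = (\<Sum>d\<in>{-M..M}. c d / 2 * ((if d - d0 = 0 then 2 * pi else 0) + (if d + d0 = 0 then 2 * pi else 0)))"
      by (intro sum.cong refl, subst integral_mult_right, subst Henstock_Kurzweil_Integration.integral_add)
         (auto intro!: integrable_\<phi> continuous_intros simp only: integral_cos_int)
  qed (auto intro!: integrable_\<phi> continuous_intros)
  also have "\<dots> = (\<Sum>d\<in>{-M..M}. (if d = d0 then pi * c d else 0) + (if d = - d0 then pi * c d else 0))"
    by (intro sum.cong refl) auto
  also have "\<dots> = pi * c d0 + pi * c (- d0)"
  proof -
    have "d0 \<in> {-M..M}" "- d0 \<in> {-M..M}" using assms(2) by auto
    thus ?thesis by (simp only: sum.distrib sum.delta finite_atLeastAtMost_int if_True)
  qed
  finally show ?thesis by (simp add: distrib_left[symmetric])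
qed

end

section \<open>Moments of the observations\<close>

text \<open>Times are recorded as gaps, \<open>n\<close> being the time already reached, so that the
  list has the shape of a path sum with one kernel per gap.\<close>

primrec obs_prod :: "nat \<Rightarrow> (nat \<times> (real \<Rightarrow> real)) list \<Rightarrow> (nat \<Rightarrow> real) \<Rightarrow> real" where
  "obs_prod n [] x = 1"
| "obs_prod n (a # w) x = snd a (x (n + fst a)) * obs_prod (n + fst a) w x"

primrec mean_prod :: "nat \<Rightarrow> (nat \<times> (real \<Rightarrow> real)) list \<Rightarrow> (nat \<Rightarrow> real measure) \<Rightarrow> real" where
  "mean_prod n [] M = 1"
| "mean_prod n (a # w) M = integral\<^sup>L (M (n + fst a)) (snd a) * mean_prod (n + fst a) w M"

definition test_functions :: "(real \<Rightarrow> real) set" where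
  "test_functions = {f. f \<in> borel_measurable borel \<and> (\<forall>x. \<bar>f x\<bar> \<le> 1)}"

lemma obs_prod_measurable [measurable]:
  assumes "snd ` set w \<subseteq> test_functions"
  shows "obs_prod n w \<in> borel_measurable (PiM UNIV (\<lambda>_. borel))"
  using assms
proof (induction w arbitrary: n)
  case (Cons a w)
  have [measurable]: "snd a \<in> borel_measurable borel" using Cons.prems by (auto simp: test_functions_def)
  have [measurable]: "obs_prod (n + fst a) w \<in> borel_measurable (PiM UNIV (\<lambda>_. borel))"
    using Cons by auto
  show ?case unfolding obs_prod.simps(2)[abs_def] by measurable
qed (simp add: obs_prod.simps(1)[abs_def])

lemma abs_obs_prod_le_1: "snd ` set w \<subseteq> test_functions \<Longrightarrow> \<bar>obs_prod n w x\<bar> \<le> 1"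
  by (induction w arbitrary: n) (auto simp: abs_mult test_functions_def intro!: mult_le_one)

lemma obs_prod_append:
  "obs_prod n (v @ w) x = obs_prod n v x * obs_prod (n + sum_list (map fst v)) w x"
  by (induction v arbitrary: n) (simp_all add: add.assoc)

text \<open>Gaps of at least 1 make the observation times distinct, so that no coordinate occurs
  twice and independence given the path applies to the product over \<open>J\<close>. The first gap
  may be 0.\<close>

lemma obs_prod_eq_prod:
  assumes "snd ` set (a # w) \<subseteq> test_functions" "\<forall>b\<in>set w. fst b \<ge> 1"
  shows "\<exists>J g. finite J \<and> (\<forall>i\<in>J. i \<ge> n + fst a) \<and> (\<forall>i\<in>J. g i \<in> test_functions) \<and>
    (\<forall>x. obs_prod n (a # w) x = (\<Prod>i\<in>J. g i (x i))) \<and>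
    (\<forall>M. mean_prod n (a # w) M = (\<Prod>i\<in>J. integral\<^sup>L (M i) (g i)))"
  using assms
proof (induction w arbitrary: a n)
  case Nil
  show ?case
    by (rule exI[of _ "{n + fst a}"], rule exI[of _ "\<lambda>_. snd a"]) (use Nil in auto)
next
  case (Cons b w)
  obtain J g where J: "finite J" "\<forall>i\<in>J. i \<ge> n + fst a + fst b" "\<forall>i\<in>J. g i \<in> test_functions"
    "\<And>x. obs_prod (n + fst a) (b # w) x = (\<Prod>i\<in>J. g i (x i))"
    "\<And>M. mean_prod (n + fst a) (b # w) M = (\<Prod>i\<in>J. integral\<^sup>L (M i) (g i))"
    using Cons.IH[of b "n + fst a"] Cons.prems by (auto simp del: obs_prod.simps mean_prod.simps)
  have notin: "n + fst a \<notin> J" using J(2) Cons.prems(2) by fastforce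
  define g' where "g' = g(n + fst a := snd a)"
  have 1: "(\<Prod>i\<in>J. g' i (x i)) = (\<Prod>i\<in>J. g i (x i))" for x
    using notin by (intro prod.cong) (auto simp: g'_def)
  have 2: "(\<Prod>i\<in>J. integral\<^sup>L (M i) (g' i)) = (\<Prod>i\<in>J. integral\<^sup>L (M i) (g i))" for M :: "nat \<Rightarrow> real measure"
    using notin by (intro prod.cong) (auto simp: g'_def)
  show ?case
  proof (intro exI[of _ "insert (n + fst a) J"] exI[of _ g'] conjI allI)
    fix x show "obs_prod n (a # b # w) x = (\<Prod>i\<in>insert (n + fst a) J. g' i (x i))"
      unfolding obs_prod.simps(2)[of n a] J(4) using J(1) notin 1[of x] by (simp add: g'_def)
  next
    fix M show "mean_prod n (a # b # w) M = (\<Prod>i\<in>insert (n + fst a) J. integral\<^sup>L (M i) (g' i))"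
      unfolding mean_prod.simps(2)[of n a] J(5) using J(1) notin 2[of M] by (simp add: g'_def)
  qed (use J Cons.prems in \<open>auto simp: g'_def\<close>)
qed

lemma integral_PiM_prod:
  fixes M :: "nat \<Rightarrow> real measure"
  assumes "\<And>i. prob_space (M i)" "\<And>i. sets (M i) = sets borel" "finite J" "\<And>i. i \<in> J \<Longrightarrow> g i \<in> test_functions"
  shows "(\<integral>x. (\<Prod>i\<in>J. g i (x i)) \<partial>PiM UNIV M) = (\<Prod>i\<in>J. integral\<^sup>L (M i) (g i))"
proof -
  interpret product_prob_space M UNIV
    by (intro product_prob_spaceI assms)
  have meas: "g i \<in> borel_measurable (M i)" if "i \<in> J" for i
    using assms(4)[OF that] assms(2)[of i] by (simp add: test_functions_def cong: measurable_cong_sets)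
  have int: "integrable (M i) (g i)" if "i \<in> J" for i
    using assms(4)[OF that] meas[OF that] prob_space.finite_measure[OF assms(1)]
    by (intro finite_measure.integrable_const_bound[where B = 1]) (auto simp: test_functions_def)
  have [measurable]: "(\<lambda>x. \<Prod>i\<in>J. g i (x i)) \<in> borel_measurable (PiM J M)"
    using meas by (intro borel_measurable_prod) (auto intro: measurable_compose[OF measurable_component_singleton])
  have "(\<Prod>i\<in>J. integral\<^sup>L (M i) (g i)) = (\<integral>x. (\<Prod>i\<in>J. g i (x i)) \<partial>PiM J M)"
    using int by (intro product_integral_prod[symmetric] assms(3)) auto
  also have "PiM J M = distr (PiM UNIV M) (PiM J M) (\<lambda>x. restrict x J)"
    using assms(3) by (intro distr_PiM_restrict_finite[symmetric]) auto
  also have "(\<integral>x. (\<Prod>i\<in>J. g i (x i)) \<partial>distr (PiM UNIV M) (PiM J M) (\<lambda>x. restrict x J))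
      = (\<integral>x. (\<Prod>i\<in>J. g i (x i)) \<partial>PiM UNIV M)"
    by (subst integral_distr) (auto intro!: measurable_restrict_subset)
  finally show ?thesis ..
qed

text \<open>Makes the mixture in \<open>obs_law\<close> a genuine probability measure. It suffices
  to test finite-dimensional cylinders, whose measure is a finite product of functions of single
  discrete coordinates.\<close>

lemma observation_kernel_measurable:
  assumes "is_scenery \<eta>"
  shows "(\<lambda>s. PiM UNIV (\<lambda>n. \<eta> (s n))) \<in> PiM UNIV (\<lambda>_::nat. count_space UNIV) \<rightarrow>\<^sub>M prob_algebra (PiM UNIV (\<lambda>_. borel))"
proof -
  have ps: "prob_space (\<eta> z)" and st: "sets (\<eta> z) = sets borel" for z
    using assms by (auto simp: is_scenery_def)
  show ?thesis
  proof (rule measurable_prob_algebra_generated[OF sets_PiM Int_stable_prod_algebra prod_algebra_sets_into_space])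
    fix s :: "nat \<Rightarrow> int"
    show "prob_space (PiM UNIV (\<lambda>n. \<eta> (s n)))" by (intro prob_space_PiM ps)
    show "sets (PiM UNIV (\<lambda>n. \<eta> (s n))) = sets (PiM UNIV (\<lambda>_. borel))"
      by (intro sets_PiM_cong refl st)
  next
    fix A assume "A \<in> prod_algebra UNIV (\<lambda>_::nat. borel :: real measure)"
    then obtain J E where A: "A = prod_emb UNIV (\<lambda>_. borel) J (\<Pi>\<^sub>E j\<in>J. E j)" "finite J"
      "\<And>j. j \<in> J \<Longrightarrow> E j \<in> sets (borel :: real measure)"
      by (force elim!: prod_algebraE)
    have "emeasure (PiM UNIV (\<lambda>n. \<eta> (s n))) A = (\<Prod>j\<in>J. emeasure (\<eta> (s j)) (E j))" for s
    proof -
      have "A = prod_emb UNIV (\<lambda>n. \<eta> (s n)) J (\<Pi>\<^sub>E j\<in>J. E j)"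
        unfolding A(1) prod_emb_def using sets_eq_imp_space_eq[OF st] by simp
      thus ?thesis using A(2,3) st ps by (simp only:) (intro emeasure_PiM_emb, auto)
    qed
    moreover have "(\<lambda>s. \<Prod>j\<in>J. emeasure (\<eta> (s j)) (E j)) \<in> borel_measurable (PiM UNIV (\<lambda>_::nat. count_space UNIV))"
    proof (intro borel_measurable_prod_ennreal)
      fix j
      show "(\<lambda>s. emeasure (\<eta> (s j)) (E j)) \<in> borel_measurable (PiM UNIV (\<lambda>_::nat. count_space UNIV))"
        by (rule measurable_compose[OF measurable_component_singleton[of j UNIV "\<lambda>_. count_space UNIV"],
              where g = "\<lambda>z. emeasure (\<eta> z) (E j)"]) auto
    qed
    ultimately show "(\<lambda>s. emeasure (PiM UNIV (\<lambda>n. \<eta> (s n))) A) \<in> borel_measurable (PiM UNIV (\<lambda>_::nat. count_space UNIV))"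
      by simp
  qed
qed

lemma partial_sum_measurable:
  "(\<lambda>\<xi>. x + (\<Sum>i<n. \<xi> i)) \<in> PiM UNIV (\<lambda>_::nat. measure_pmf q) \<rightarrow>\<^sub>M count_space (UNIV :: int set)"
proof (induction n)
  case (Suc n)
  have c: "(\<lambda>\<xi>. \<xi> n) \<in> PiM UNIV (\<lambda>_::nat. measure_pmf q) \<rightarrow>\<^sub>M measure_pmf q"
    by (rule measurable_component_singleton) simp
  have "(\<lambda>\<xi>. (x + (\<Sum>i<n. \<xi> i)) + \<xi> n) \<in> PiM UNIV (\<lambda>_::nat. measure_pmf q) \<rightarrow>\<^sub>M count_space (UNIV :: int set)"
    by (rule measurable_compose_countable[OF measurable_compose[OF c] Suc]) auto
  thus ?case by (simp add: add.assoc)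
qed simp

lemma walk_path_measurable:
  "(\<lambda>\<xi> n. \<Sum>i<n. \<xi> i) \<in> PiM UNIV (\<lambda>_::nat. measure_pmf q) \<rightarrow>\<^sub>M PiM UNIV (\<lambda>_::nat. count_space (UNIV :: int set))"
  using partial_sum_measurable[of 0] by (intro measurable_PiM_single') auto

text \<open>Integrals are expressed over the i.i.d. increments rather than the path, so that the
  Markov property becomes concatenation of independent sequences.\<close>

lemma
  assumes "is_scenery \<eta>"
  shows prob_space_obs_law: "prob_space (obs_law q \<eta>)"
    and sets_obs_law: "sets (obs_law q \<eta>) = sets (PiM UNIV (\<lambda>_. borel))"
    and integral_obs_law: "\<lbrakk>f \<in> borel_measurable (PiM UNIV (\<lambda>_. borel)); \<And>x. \<bar>f x\<bar> \<le> (K::real)\<rbrakk> \<Longrightarrow>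
      integral\<^sup>L (obs_law q \<eta>) f = (\<integral>\<xi>. integral\<^sup>L (PiM UNIV (\<lambda>n. \<eta> (\<Sum>i<n. \<xi> i))) f \<partial>PiM UNIV (\<lambda>_. measure_pmf q))"
proof -
  let ?W = "walk_law q" and ?B = "PiM UNIV (\<lambda>_::nat. borel :: real measure)"
  let ?k = "\<lambda>s. PiM UNIV (\<lambda>n::nat. \<eta> (s n))"
  have W: "prob_space ?W" unfolding walk_law_def
    by (intro prob_space.prob_space_distr prob_space_PiM walk_path_measurable prob_space_measure_pmf)
  have sW: "sets ?W = sets (PiM UNIV (\<lambda>_::nat. count_space UNIV))" by (simp add: walk_law_def)
  have k: "?k \<in> ?W \<rightarrow>\<^sub>M prob_algebra ?B"
    using observation_kernel_measurable[OF assms] by (simp add: measurable_cong_sets[OF sW refl])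
  have ks: "?k \<in> ?W \<rightarrow>\<^sub>M subprob_algebra ?B" using k by (rule measurable_prob_algebraD)
  have ne: "space ?W \<noteq> {}" using W by (rule prob_space.not_empty)
  show sets: "sets (obs_law q \<eta>) = sets ?B"
    unfolding obs_law_def using ne sets_kernel[OF ks] by (intro sets_bind) auto
  have kp: "prob_space (?k s)" for s
    using assms by (intro prob_space_PiM) (auto simp: is_scenery_def)
  show "prob_space (obs_law q \<eta>)"
    unfolding obs_law_def by (rule prob_space.prob_space_bind[OF W _ ks]) (use kp in auto)
  assume f: "f \<in> borel_measurable ?B" and b: "\<And>x. \<bar>f x\<bar> \<le> K"
  have "integral\<^sup>L (obs_law q \<eta>) f = (\<integral>s. integral\<^sup>L (?k s) f \<partial>?W)"
    unfolding obs_law_def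
    by (rule integral_bind[OF f _ ks, where B = K and B' = 1])
       (use b prob_space.emeasure_space_1[OF kp] W in \<open>auto intro: prob_space.finite_measure\<close>)
  also have "\<dots> = (\<integral>\<xi>. integral\<^sup>L (PiM UNIV (\<lambda>n. \<eta> (\<Sum>i<n. \<xi> i))) f \<partial>PiM UNIV (\<lambda>_. measure_pmf q))"
    unfolding walk_law_def
  proof (rule integral_distr[OF walk_path_measurable])
    have "?k \<in> PiM UNIV (\<lambda>_::nat. count_space UNIV) \<rightarrow>\<^sub>M subprob_algebra ?B"
      using observation_kernel_measurable[OF assms] by (rule measurable_prob_algebraD)
    from measurable_compose[OF this integral_measurable_subprob_algebra[OF f]]
    show "(\<lambda>s. integral\<^sup>L (?k s) f) \<in> borel_measurable (PiM UNIV (\<lambda>_::nat. count_space UNIV))" .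
  qed
  finally show "integral\<^sup>L (obs_law q \<eta>) f = (\<integral>\<xi>. integral\<^sup>L (PiM UNIV (\<lambda>n. \<eta> (\<Sum>i<n. \<xi> i))) f \<partial>PiM UNIV (\<lambda>_. measure_pmf q))" .
qed

lemma integral_obs_prod:
  assumes "is_scenery \<eta>" "snd ` set (a # w) \<subseteq> test_functions" "\<forall>b\<in>set w. fst b \<ge> 1"
  shows "(\<integral>x. obs_prod 0 (a # w) x \<partial>obs_law q \<eta>)
     = (\<integral>\<xi>. mean_prod 0 (a # w) (\<lambda>k. \<eta> (\<Sum>i<k. \<xi> i)) \<partial>PiM UNIV (\<lambda>_. measure_pmf q))"
proof -
  obtain J g where J: "finite J" "\<forall>i\<in>J. g i \<in> test_functions"
    "\<And>x. obs_prod 0 (a # w) x = (\<Prod>i\<in>J. g i (x i))"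
    "\<And>M. mean_prod 0 (a # w) M = (\<Prod>i\<in>J. integral\<^sup>L (M i) (g i))"
    using obs_prod_eq_prod[OF assms(2,3), of 0] by (auto simp del: obs_prod.simps mean_prod.simps)
  have "(\<integral>x. obs_prod 0 (a # w) x \<partial>obs_law q \<eta>)
     = (\<integral>\<xi>. integral\<^sup>L (PiM UNIV (\<lambda>n. \<eta> (\<Sum>i<n. \<xi> i))) (obs_prod 0 (a # w)) \<partial>PiM UNIV (\<lambda>_. measure_pmf q))"
    by (rule integral_obs_law[OF assms(1) obs_prod_measurable[OF assms(2)] abs_obs_prod_le_1[OF assms(2)]])
  also have "\<dots> = (\<integral>\<xi>. mean_prod 0 (a # w) (\<lambda>k. \<eta> (\<Sum>i<k. \<xi> i)) \<partial>PiM UNIV (\<lambda>_. measure_pmf q))"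
    unfolding J(3)[abs_def] J(4)
    using assms(1) J(1,2)
    by (intro Bochner_Integration.integral_cong refl integral_PiM_prod) (auto simp: is_scenery_def)
  finally show ?thesis .
qed

section \<open>The Markov property and expectations along the walk\<close>

primrec walk_prod :: "(int \<Rightarrow> 'm) \<Rightarrow> int \<Rightarrow> nat \<Rightarrow> (nat \<times> ('m \<Rightarrow> real)) list \<Rightarrow> (nat \<Rightarrow> int) \<Rightarrow> real" where
  "walk_prod \<eta> x n [] \<xi> = 1"
| "walk_prod \<eta> x n (a # w) \<xi> = snd a (\<eta> (x + (\<Sum>i<n + fst a. \<xi> i))) * walk_prod \<eta> x (n + fst a) w \<xi>"

lemma mean_prod_eq_walk_prod:
  "mean_prod n w (\<lambda>k. \<eta> (\<Sum>i<k. \<xi> i)) = walk_prod \<eta> 0 n (map (\<lambda>(t, f). (t, \<lambda>\<mu>. integral\<^sup>L \<mu> f)) w) \<xi>"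
  by (induction w arbitrary: n) (auto simp: split_beta)

text \<open>\<open>comb_seq t\<close> uses its first argument before time \<open>t\<close> and its
  second from then on, so after time \<open>t\<close> the walk restarts at the site it has
  reached.\<close>

lemma walk_prod_shift:
  "walk_prod \<eta> x (t + n) w (comb_seq t \<omega> \<omega>') = walk_prod \<eta> (x + (\<Sum>i<t. \<omega> i)) n w \<omega>'"
proof (induction w arbitrary: n)
  case (Cons a w)
  have s: "(\<Sum>i<t + m. comb_seq t \<omega> \<omega>' i) = (\<Sum>i<t. \<omega> i) + (\<Sum>i<m. \<omega>' i)" for m
    by (induction m) (simp_all add: comb_seq_def add.assoc)
  show ?case using Cons.IH[of "n + fst a"] s[of "n + fst a"] by (simp add: add.assoc)
qed simp

lemma walk_prod_measurable [measurable]: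
  "walk_prod \<eta> x n w \<in> borel_measurable (PiM UNIV (\<lambda>_. measure_pmf (q :: int pmf)))"
proof (induction w arbitrary: n)
  case (Cons a w)
  note Cons.IH [measurable]
  have [measurable]: "(\<lambda>\<xi>. snd a (\<eta> (x + (\<Sum>i<n + fst a. \<xi> i)))) \<in> borel_measurable (PiM UNIV (\<lambda>_. measure_pmf q))"
    by (rule measurable_compose[OF partial_sum_measurable, where g = "\<lambda>z. snd a (\<eta> z)"]) auto
  thus ?case unfolding walk_prod.simps(2)[abs_def] by measurable
qed (simp add: walk_prod.simps(1)[abs_def])

lemma abs_walk_prod_le_1:
  assumes "\<And>a m. a \<in> set w \<Longrightarrow> \<bar>snd a (\<eta> m)\<bar> \<le> 1"
  shows "\<bar>walk_prod \<eta> x n w \<xi>\<bar> \<le> 1"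
  using assms by (induction w arbitrary: n) (auto simp: abs_mult intro!: mult_le_one)

context
  fixes q :: "int pmf"
begin

interpretation S: sequence_space "measure_pmf q" ..

abbreviation "\<Xi> \<equiv> PiM (UNIV :: nat set) (\<lambda>_. measure_pmf q)"

text \<open>The increments before and after time \<open>t\<close> are independent; together with
  \<open>walk_prod_shift\<close> this is the Markov property at a fixed time.\<close>

lemma integral_comb_seq:
  fixes f :: "(nat \<Rightarrow> int) \<Rightarrow> real"
  assumes f: "f \<in> borel_measurable \<Xi>" and b: "\<And>\<xi>. \<bar>f \<xi>\<bar> \<le> K"
  shows "integral\<^sup>L \<Xi> f = (\<integral>\<omega>. (\<integral>\<omega>'. f (comb_seq t \<omega> \<omega>') \<partial>\<Xi>) \<partial>\<Xi>)"
proof -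
  interpret P: pair_prob_space \<Xi> \<Xi> ..
  have m: "(\<lambda>(\<omega>, \<omega>'). comb_seq t \<omega> \<omega>') \<in> \<Xi> \<Otimes>\<^sub>M \<Xi> \<rightarrow>\<^sub>M \<Xi>" by (rule measurable_comb_seq)
  have "integral\<^sup>L \<Xi> f = integral\<^sup>L (distr (\<Xi> \<Otimes>\<^sub>M \<Xi>) \<Xi> (\<lambda>(\<omega>, \<omega>'). comb_seq t \<omega> \<omega>')) f"
    by (simp only: S.PiM_comb_seq)
  also have "\<dots> = (\<integral>p. f (case p of (\<omega>, \<omega>') \<Rightarrow> comb_seq t \<omega> \<omega>') \<partial>(\<Xi> \<Otimes>\<^sub>M \<Xi>))"
    by (rule integral_distr[OF m f])
  also have "\<dots> = (\<integral>(\<omega>, \<omega>'). f (comb_seq t \<omega> \<omega>') \<partial>(\<Xi> \<Otimes>\<^sub>M \<Xi>))"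
    by (intro Bochner_Integration.integral_cong) auto
  also have "\<dots> = (\<integral>\<omega>. (\<integral>\<omega>'. f (comb_seq t \<omega> \<omega>') \<partial>\<Xi>) \<partial>\<Xi>)"
  proof -
    have "integrable (\<Xi> \<Otimes>\<^sub>M \<Xi>) (\<lambda>(\<omega>, \<omega>'). f (comb_seq t \<omega> \<omega>'))"
      using measurable_compose[OF m f] b
      by (intro P.P.integrable_const_bound[where B = K]) (auto simp: split_beta')
    from P.integral_fst'[OF this] show ?thesis by simp
  qed
  finally show ?thesis .
qed

lemma integral_partial_sum:
  fixes f :: "int \<Rightarrow> real"
  assumes b: "\<And>z. \<bar>f z\<bar> \<le> K"
  shows "(\<integral>\<omega>. f (\<Sum>i<t. \<omega> i) \<partial>\<Xi>) = measure_pmf.expectation (conv_pow q t) f"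
  using b
proof (induction t arbitrary: f)
  case 0
  then show ?case using S.P.prob_space by simp
next
  case (Suc t)
  have m: "(\<lambda>\<omega>. f (\<Sum>i<Suc t. \<omega> i)) \<in> borel_measurable \<Xi>"
    by (rule measurable_compose[OF partial_sum_measurable[of 0, simplified]]) simp
  have one: "(\<integral>\<omega>'. f (a + \<omega>' 0) \<partial>\<Xi>) = measure_pmf.expectation q (\<lambda>y. f (a + y))" for a
  proof -
    have "measure_pmf.expectation q (\<lambda>y. f (a + y)) = (\<integral>y. f (a + y) \<partial>distr \<Xi> (measure_pmf q) (\<lambda>\<omega>. \<omega> 0))"
      using S.PiM_component[of 0] by simp
    also have "\<dots> = (\<integral>\<omega>'. f (a + \<omega>' 0) \<partial>\<Xi>)"
      by (rule integral_distr) auto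
    finally show ?thesis ..
  qed
  have "(\<integral>\<omega>. f (\<Sum>i<Suc t. \<omega> i) \<partial>\<Xi>)
      = (\<integral>\<omega>. (\<integral>\<omega>'. f (\<Sum>i<Suc t. comb_seq t \<omega> \<omega>' i) \<partial>\<Xi>) \<partial>\<Xi>)"
    using Suc.prems by (intro integral_comb_seq[OF m])
  also have "\<dots> = (\<integral>\<omega>. (\<integral>\<omega>'. f ((\<Sum>i<t. \<omega> i) + \<omega>' 0) \<partial>\<Xi>) \<partial>\<Xi>)"
    by (simp add: comb_seq_def)
  also have "\<dots> = (\<integral>\<omega>. measure_pmf.expectation q (\<lambda>y. f ((\<Sum>i<t. \<omega> i) + y)) \<partial>\<Xi>)"
    by (simp only: one)
  also have "\<dots> = measure_pmf.expectation (conv_pow q t) (\<lambda>x. measure_pmf.expectation q (\<lambda>y. f (x + y)))"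
  proof (rule Suc.IH)
    fix z
    have "\<bar>measure_pmf.expectation q (\<lambda>y. f (z + y))\<bar> \<le> measure_pmf.expectation q (\<lambda>y. \<bar>f (z + y)\<bar>)"
      by (rule integral_abs_bound)
    also have "\<dots> \<le> measure_pmf.expectation q (\<lambda>y. K)"
      using Suc.prems abs_ge_zero[of "f 0"] order_trans[OF abs_ge_zero Suc.prems]
      by (intro integral_mono integrable_pmf_bounded[of _ K]) auto
    finally show "\<bar>measure_pmf.expectation q (\<lambda>y. f (z + y))\<bar> \<le> K" by simp
  qed
  also have "\<dots> = measure_pmf.expectation (conv_pow q (Suc t)) f"
    unfolding conv_pow.simps using Suc.prems by (subst expectation_bind_pmf[of _ K]) simp_all
  finally show ?case .
qed

text \<open>Splitting at the first gap turns the first factor into a sum over sites weighted by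
  \<open>pmf (conv_pow q t)\<close>. The sum is confined to the defects because the marks vanish at
  \<alpha>, which is the purpose of centring.\<close>

lemma integral_walk_prod:
  assumes fin: "finite (defects \<alpha> \<eta>)"
    and b: "\<And>a m. a \<in> set w \<Longrightarrow> \<bar>snd a (\<eta> m)\<bar> \<le> 1"
    and z: "\<And>a. a \<in> set w \<Longrightarrow> snd a \<alpha> = 0"
  shows "(\<integral>\<xi>. walk_prod \<eta> x 0 w \<xi> \<partial>\<Xi>) = path_sum \<alpha> \<eta> (map (\<lambda>(t, h). (pmf (conv_pow q t), h)) w) x"
  using b z
proof (induction w arbitrary: x)
  case Nil
  then show ?case using S.P.prob_space by simp
next
  case (Cons a w)
  obtain t h where a: "a = (t, h)" by force
  let ?P = "path_sum \<alpha> \<eta> (map (\<lambda>(t, h). (pmf (conv_pow q t), h)) w)"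
  have IH: "(\<integral>\<xi>. walk_prod \<eta> y 0 w \<xi> \<partial>\<Xi>) = ?P y" for y
    using Cons.prems by (intro Cons.IH) auto
  have Pb: "\<bar>?P y\<bar> \<le> 1" for y
  proof -
    have "\<bar>\<integral>\<xi>. walk_prod \<eta> y 0 w \<xi> \<partial>\<Xi>\<bar> \<le> (\<integral>\<xi>. \<bar>walk_prod \<eta> y 0 w \<xi>\<bar> \<partial>\<Xi>)" by (rule integral_abs_bound)
    also have "\<dots> \<le> (\<integral>\<xi>. 1 \<partial>\<Xi>)"
      using abs_walk_prod_le_1[of w \<eta>] Cons.prems
      by (intro integral_mono S.P.integrable_const_bound[where B = 1]) auto
    finally show ?thesis using IH S.P.prob_space by simp
  qed
  define F where "F s = h (\<eta> (x + s)) * ?P (x + s)" for s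
  have Fb: "\<bar>F s\<bar> \<le> 1" for s
    using Pb[of "x + s"] Cons.prems(1)[of a "x + s"] by (auto simp: F_def abs_mult a intro!: mult_le_one)
  have "(\<integral>\<xi>. walk_prod \<eta> x 0 (a # w) \<xi> \<partial>\<Xi>)
     = (\<integral>\<omega>. (\<integral>\<omega>'. walk_prod \<eta> x 0 (a # w) (comb_seq t \<omega> \<omega>') \<partial>\<Xi>) \<partial>\<Xi>)"
    using abs_walk_prod_le_1[of "a # w" \<eta>] Cons.prems
    by (intro integral_comb_seq[where K = 1] walk_prod_measurable) blast
  also have "(\<lambda>\<omega> \<omega>'. walk_prod \<eta> x 0 (a # w) (comb_seq t \<omega> \<omega>'))
     = (\<lambda>\<omega> \<omega>'. h (\<eta> (x + (\<Sum>i<t. \<omega> i))) * walk_prod \<eta> (x + (\<Sum>i<t. \<omega> i)) 0 w \<omega>')"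
    using walk_prod_shift[of \<eta> x t 0 w] by (simp add: a comb_seq_def fun_eq_iff)
  also have "(\<integral>\<omega>. (\<integral>\<omega>'. h (\<eta> (x + (\<Sum>i<t. \<omega> i))) * walk_prod \<eta> (x + (\<Sum>i<t. \<omega> i)) 0 w \<omega>' \<partial>\<Xi>) \<partial>\<Xi>)
     = (\<integral>\<omega>. F (\<Sum>i<t. \<omega> i) \<partial>\<Xi>)"
    by (simp add: IH F_def)
  also have "\<dots> = measure_pmf.expectation (conv_pow q t) F"
    by (rule integral_partial_sum[OF Fb])
  also have "\<dots> = (\<Sum>s\<in>(\<lambda>z. z - x) ` defects \<alpha> \<eta>. pmf (conv_pow q t) s *\<^sub>R F s)"
  proof (rule integral_measure_pmf)
    fix s assume "F s \<noteq> 0"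
    hence "\<eta> (x + s) \<noteq> \<alpha>" using Cons.prems(2)[of a] by (auto simp: F_def a)
    hence "x + s \<in> defects \<alpha> \<eta>" by (simp add: defects_def)
    thus "s \<in> (\<lambda>z. z - x) ` defects \<alpha> \<eta>" by (rule rev_image_eqI) simp
  qed (use fin in simp)
  also have "\<dots> = (\<Sum>z\<in>defects \<alpha> \<eta>. pmf (conv_pow q t) (z - x) * F (z - x))"
    by (subst sum.reindex) (auto simp: inj_on_def)
  also have "\<dots> = path_sum \<alpha> \<eta> (map (\<lambda>(t, h). (pmf (conv_pow q t), h)) (a # w)) x"
    by (simp add: a F_def mult.assoc)
  finally show ?case .
qed

end

lemma expectation_obs_prod:
  assumes "is_scenery \<eta>" "finite (defects \<alpha> \<eta>)"
    and "w \<noteq> []" "snd ` set w \<subseteq> test_functions" "\<forall>b\<in>set (tl w). fst b \<ge> 1"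
    and z: "\<And>f. f \<in> snd ` set w \<Longrightarrow> integral\<^sup>L \<alpha> f = 0"
  shows "(\<integral>x. obs_prod 0 w x \<partial>obs_law q \<eta>)
     = path_sum \<alpha> \<eta> (map (\<lambda>(t, f). (pmf (conv_pow q t), \<lambda>\<mu>. integral\<^sup>L \<mu> f)) w) 0"
proof -
  obtain a v where w: "w = a # v" using assms(3) by (cases w) auto
  have bd: "\<bar>integral\<^sup>L (\<eta> m) f\<bar> \<le> 1" if "f \<in> test_functions" for f m
  proof -
    interpret prob_space "\<eta> m" using assms(1) by (simp add: is_scenery_def)
    have [measurable]: "f \<in> borel_measurable (\<eta> m)"
      using that assms(1) by (simp add: test_functions_def is_scenery_def cong: measurable_cong_sets)
    have "\<bar>integral\<^sup>L (\<eta> m) f\<bar> \<le> (\<integral>x. \<bar>f x\<bar> \<partial>\<eta> m)" by (rule integral_abs_bound)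
    also have "\<dots> \<le> (\<integral>x. 1 \<partial>\<eta> m)"
      using that by (intro integral_mono integrable_const_bound[where B = 1]) (auto simp: test_functions_def)
    finally show ?thesis by (simp add: prob_space)
  qed
  have "(\<integral>x. obs_prod 0 w x \<partial>obs_law q \<eta>)
     = (\<integral>\<xi>. walk_prod \<eta> 0 0 (map (\<lambda>(t, f). (t, \<lambda>\<mu>. integral\<^sup>L \<mu> f)) w) \<xi> \<partial>PiM UNIV (\<lambda>_. measure_pmf q))"
    unfolding mean_prod_eq_walk_prod[symmetric] w
    using assms by (intro integral_obs_prod) (auto simp: w)
  also have "\<dots> = path_sum \<alpha> \<eta> (map (\<lambda>(t, h). (pmf (conv_pow q t), h)) (map (\<lambda>(t, f). (t, \<lambda>\<mu>. integral\<^sup>L \<mu> f)) w)) 0"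
    using assms(4) bd z by (intro integral_walk_prod[OF assms(2)]) force+
  also have "map (\<lambda>(t, h). (pmf (conv_pow q t), h)) (map (\<lambda>(t, f). (t, \<lambda>\<mu>. integral\<^sup>L \<mu> f)) w)
     = map (\<lambda>(t, f). (pmf (conv_pow q t), \<lambda>\<mu>. integral\<^sup>L \<mu> f)) w"
    by auto
  finally show ?thesis .
qed

text \<open>By monotone convergence the sum of the squares has finite expectation, so it is finite
  almost surely and its terms tend to 0.\<close>

lemma (in prob_space) AE_tendsto_0_if_L2_summable:
  fixes X :: "nat \<Rightarrow> 'a \<Rightarrow> real"
  assumes "\<And>k. integrable M (\<lambda>x. (X k x)\<^sup>2)" and "\<And>k. (\<integral>x. (X k x)\<^sup>2 \<partial>M) \<le> c k" and "summable c"
  shows "AE x in M. (\<lambda>k. X k x) \<longlonglongrightarrow> 0"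
proof -
  have c0: "0 \<le> c k" for k
    by (rule order_trans[OF Bochner_Integration.integral_nonneg assms(2)]) simp
  have [measurable]: "(\<lambda>x. (X k x)\<^sup>2) \<in> borel_measurable M" for k using assms(1) by blast
  have "(\<integral>\<^sup>+x. (\<Sum>k. ennreal ((X k x)\<^sup>2)) \<partial>M) = (\<Sum>k. \<integral>\<^sup>+x. ennreal ((X k x)\<^sup>2) \<partial>M)"
    by (rule nn_integral_suminf) measurable
  also have "\<dots> = (\<Sum>k. ennreal (\<integral>x. (X k x)\<^sup>2 \<partial>M))"
    using assms(1) by (simp add: nn_integral_eq_integral)
  also have "\<dots> \<le> (\<Sum>k. ennreal (c k))"
    using assms(2) by (intro suminf_le ennreal_leI) auto
  also have "\<dots> < \<infinity>" using assms(3) c0 by (simp add: suminf_ennreal2)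
  finally have fin: "(\<integral>\<^sup>+x. (\<Sum>k. ennreal ((X k x)\<^sup>2)) \<partial>M) \<noteq> \<infinity>" by simp
  have "AE x in M. (\<Sum>k. ennreal ((X k x)\<^sup>2)) \<noteq> \<infinity>"
    by (rule nn_integral_noteq_infinite[OF _ fin]) measurable
  thus ?thesis
  proof eventually_elim
    case (elim x)
    hence "summable (\<lambda>k. (X k x)\<^sup>2)" by (intro summable_suminf_not_top) auto
    hence "(\<lambda>k. (X k x)\<^sup>2) \<longlonglongrightarrow> 0" by (rule summable_LIMSEQ_zero)
    hence "(\<lambda>k. sqrt ((X k x)\<^sup>2)) \<longlonglongrightarrow> sqrt 0" by (rule tendsto_real_sqrt)
    thus ?case by (simp add: tendsto_rabs_zero_iff)
  qed
qed

lemma path_sum_split_kernel: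
  "path_sum \<alpha> \<eta> (v @ (\<kappa>, h) # w) x
    = a * path_sum \<alpha> \<eta> (v @ (\<lambda>_. 1, h) # w) x + path_sum \<alpha> \<eta> (v @ (\<lambda>z. \<kappa> z - a, h) # w) x"
proof (induction v arbitrary: x)
  case Nil
  show ?case by (simp add: sum_distrib_left sum.distrib[symmetric] algebra_simps)
next
  case (Cons b v)
  have "path_sum \<alpha> \<eta> ((b # v) @ (\<kappa>, h) # w) x
     = (\<Sum>y\<in>defects \<alpha> \<eta>. a * (fst b (y - x) * snd b (\<eta> y) * path_sum \<alpha> \<eta> (v @ (\<lambda>_. 1, h) # w) y)
       + fst b (y - x) * snd b (\<eta> y) * path_sum \<alpha> \<eta> (v @ (\<lambda>z. \<kappa> z - a, h) # w) y)"
    unfolding append_Cons path_sum.simps(2) Cons.IH by (intro sum.cong refl) (simp add: algebra_simps)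
  thus ?case by (simp add: sum.distrib sum_distrib_left)
qed

text \<open>A constant kernel forgets the site reached by \<open>v\<close>, so what follows is a
  factor independent of it. This is the source of the asymptotic independence of distant
  windows.\<close>

lemma path_sum_const_kernel:
  "path_sum \<alpha> \<eta> (v @ (\<lambda>_. 1, h) # w) x = path_sum \<alpha> \<eta> v x * path_sum \<alpha> \<eta> ((\<lambda>_. 1, h) # w) 0"
proof (induction v arbitrary: x)
  case (Cons b v)
  show ?case unfolding append_Cons path_sum.simps(2)[of _ _ b] Cons.IH
    by (simp only: sum_distrib_right mult.assoc)
qed simp

text \<open>The order of quantifiers matters: \<open>C\<close> depends on the surrounding lists
  only, so the kernel may vary with the time gap. The starting point is a defect because the kernel
  is controlled only at differences of defects.\<close>

lemma path_sum_kernel_bound: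
  assumes "finite (defects \<alpha> \<eta>)"
  shows "\<exists>C\<ge>0. \<forall>\<kappa> b. 0 \<le> b \<longrightarrow> (\<forall>x\<in>defects \<alpha> \<eta>. \<forall>y\<in>defects \<alpha> \<eta>. \<bar>\<kappa> (y - x)\<bar> \<le> b) \<longrightarrow>
    (\<forall>x\<in>defects \<alpha> \<eta>. \<bar>path_sum \<alpha> \<eta> (v @ (\<kappa>, h) # w) x\<bar> \<le> C * b)"
proof (induction v)
  case Nil
  let ?D = "defects \<alpha> \<eta>"
  let ?C = "\<Sum>y\<in>?D. \<bar>h (\<eta> y) * path_sum \<alpha> \<eta> w y\<bar>"
  have "\<bar>path_sum \<alpha> \<eta> ([] @ (\<kappa>, h) # w) x\<bar> \<le> ?C * b"
    if "0 \<le> b" "\<forall>x\<in>?D. \<forall>y\<in>?D. \<bar>\<kappa> (y - x)\<bar> \<le> b" "x \<in> ?D" for \<kappa> b x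
  proof -
    have "\<bar>path_sum \<alpha> \<eta> ([] @ (\<kappa>, h) # w) x\<bar> \<le> (\<Sum>y\<in>?D. \<bar>\<kappa> (y - x)\<bar> * \<bar>h (\<eta> y) * path_sum \<alpha> \<eta> w y\<bar>)"
      using sum_abs[of "\<lambda>y. \<kappa> (y - x) * h (\<eta> y) * path_sum \<alpha> \<eta> w y" ?D] by (simp add: abs_mult mult.assoc)
    also have "\<dots> \<le> (\<Sum>y\<in>?D. b * \<bar>h (\<eta> y) * path_sum \<alpha> \<eta> w y\<bar>)"
      using that by (intro sum_mono mult_right_mono) auto
    finally show ?thesis by (simp add: sum_distrib_left mult.commute)
  qed
  thus ?case by (intro exI[of _ ?C]) (auto intro: sum_nonneg)
next
  case (Cons a v)
  let ?D = "defects \<alpha> \<eta>"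
  obtain C where C: "C \<ge> 0" "\<And>\<kappa> b x. 0 \<le> b \<Longrightarrow> \<forall>x\<in>?D. \<forall>y\<in>?D. \<bar>\<kappa> (y - x)\<bar> \<le> b \<Longrightarrow> x \<in> ?D \<Longrightarrow>
     \<bar>path_sum \<alpha> \<eta> (v @ (\<kappa>, h) # w) x\<bar> \<le> C * b"
    using Cons.IH by blast
  define S where "S = (\<Sum>x\<in>?D. \<Sum>y\<in>?D. \<bar>fst a (y - x) * snd a (\<eta> y)\<bar>)"
  have "\<bar>path_sum \<alpha> \<eta> ((a # v) @ (\<kappa>, h) # w) x\<bar> \<le> (S * C) * b"
    if "0 \<le> b" "\<forall>x\<in>?D. \<forall>y\<in>?D. \<bar>\<kappa> (y - x)\<bar> \<le> b" "x \<in> ?D" for \<kappa> b x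
  proof -
    have "\<bar>path_sum \<alpha> \<eta> ((a # v) @ (\<kappa>, h) # w) x\<bar>
       \<le> (\<Sum>y\<in>?D. \<bar>fst a (y - x) * snd a (\<eta> y)\<bar> * \<bar>path_sum \<alpha> \<eta> (v @ (\<kappa>, h) # w) y\<bar>)"
      using sum_abs[of "\<lambda>y. fst a (y - x) * snd a (\<eta> y) * path_sum \<alpha> \<eta> (v @ (\<kappa>, h) # w) y" ?D]
      by (simp add: abs_mult)
    also have "\<dots> \<le> (\<Sum>y\<in>?D. \<bar>fst a (y - x) * snd a (\<eta> y)\<bar> * (C * b))"
      using C(2)[OF that(1,2)] by (intro sum_mono mult_left_mono) auto
    also have "\<dots> = (\<Sum>y\<in>?D. \<bar>fst a (y - x) * snd a (\<eta> y)\<bar>) * (C * b)" by (simp add: sum_distrib_right)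
    also have "\<dots> \<le> S * (C * b)"
      unfolding S_def using that C assms
      by (intro mult_right_mono member_le_sum[where f = "\<lambda>x. \<Sum>y\<in>?D. \<bar>fst a (y - x) * snd a (\<eta> y)\<bar>"])
         (auto intro: sum_nonneg)
    finally show ?thesis by (simp add: mult.assoc)
  qed
  moreover have "S * C \<ge> 0" using C by (auto simp: S_def intro!: mult_nonneg_nonneg sum_nonneg)
  ultimately show ?case by blast
qed

section \<open>Mean and covariance of windows of observations\<close>

context symmetric_walk
begin

lemma transition_approx_finite:
  assumes "finite \<Delta>"
  shows "\<exists>K\<ge>0. \<forall>z\<in>\<Delta>. \<forall>j\<ge>\<tau>. \<bar>p (2 * j - \<tau>) z - u j\<bar> \<le> K * (u (j - \<tau>) - u (Suc (j - \<tau>)))"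
  using assms
proof induction
  case (insert z \<Delta>)
  then obtain K where K: "K \<ge> 0" "\<forall>z\<in>\<Delta>. \<forall>j\<ge>\<tau>. \<bar>p (2 * j - \<tau>) z - u j\<bar> \<le> K * (u (j - \<tau>) - u (Suc (j - \<tau>)))" by blast
  obtain K' where K': "K' \<ge> 0" "\<forall>j\<ge>\<tau>. \<bar>p (2 * j - \<tau>) z - u j\<bar> \<le> K' * (u (j - \<tau>) - u (Suc (j - \<tau>)))"
    using transition_approx by blast
  have d: "0 \<le> u i - u (Suc i)" for i using u_Suc_le by simp
  show ?case
    by (rule exI[of _ "K + K'"], use K K' d in \<open>auto simp: distrib_right intro: order_trans add_increasing add_increasing2\<close>)
qed (auto intro: exI[of _ 0])

abbreviation lift :: "(nat \<times> (real \<Rightarrow> real)) list \<Rightarrow> ((int \<Rightarrow> real) \<times> (real measure \<Rightarrow> real)) list" where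
  "lift w \<equiv> map (\<lambda>(t, f). (p t, \<lambda>\<mu>. integral\<^sup>L \<mu> f)) w"

definition window :: "(real \<Rightarrow> real) \<Rightarrow> (nat \<times> (real \<Rightarrow> real)) list \<Rightarrow> nat \<Rightarrow> (nat \<Rightarrow> real) \<Rightarrow> real" where
  "window f w n x = obs_prod 0 ((2 * n, f) # w) x"

text \<open>The mean of the window at time \<open>2 * n\<close> is the same sum with first kernel
  \<open>p (2 * n)\<close>, which on the defects is asymptotically the constant \<open>u n\<close>;
  dividing by \<open>u n\<close> leaves the kernel 1.\<close>

definition window_limit :: "real measure \<Rightarrow> (int \<Rightarrow> real measure) \<Rightarrow> (real \<Rightarrow> real) \<Rightarrow> (nat \<times> (real \<Rightarrow> real)) list \<Rightarrow> real" where
  "window_limit \<alpha> \<eta> f w = path_sum \<alpha> \<eta> ((\<lambda>_. 1, \<lambda>\<mu>. integral\<^sup>L \<mu> f) # lift w) 0"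

end

locale observed_walk = symmetric_walk q for q +
  fixes \<alpha> :: "real measure" and \<eta> :: "int \<Rightarrow> real measure"
    and f0 :: "real \<Rightarrow> real" and w :: "(nat \<times> (real \<Rightarrow> real)) list"
  assumes scenery: "is_scenery \<eta>" and fin: "finite (defects \<alpha> \<eta>)"
    and tests: "f0 \<in> test_functions" "snd ` set w \<subseteq> test_functions"
    and gaps: "\<forall>b\<in>set w. fst b \<ge> 1"
    and centred: "integral\<^sup>L \<alpha> f0 = 0" "\<And>f. f \<in> snd ` set w \<Longrightarrow> integral\<^sup>L \<alpha> f = 0"
begin

abbreviation "D \<equiv> defects \<alpha> \<eta>"
abbreviation "h0 \<equiv> \<lambda>\<mu> :: real measure. integral\<^sup>L \<mu> f0"
abbreviation "Yn \<equiv> window f0 w"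
abbreviation "H0 \<equiv> window_limit \<alpha> \<eta> f0 w"

sublocale O: prob_space "obs_law q \<eta>" by (rule prob_space_obs_law[OF scenery])

definition mean :: "nat \<Rightarrow> real" where "mean n = (\<integral>x. Yn n x \<partial>obs_law q \<eta>)"
definition mixed :: "nat \<Rightarrow> nat \<Rightarrow> real" where "mixed m n = (\<integral>x. Yn m x * Yn n x \<partial>obs_law q \<eta>)"

lemma Y_measurable [measurable]: "Yn n \<in> borel_measurable (obs_law q \<eta>)"
  unfolding window_def[abs_def] measurable_cong_sets[OF sets_obs_law[OF scenery] refl]
  using tests by (intro obs_prod_measurable) auto

lemma abs_Y_le_1: "\<bar>Yn n x\<bar> \<le> 1"
  unfolding window_def using tests by (intro abs_obs_prod_le_1) auto

lemma integrable_Y [simp]: "integrable (obs_law q \<eta>) (Yn n)"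
  using abs_Y_le_1 by (intro O.integrable_const_bound[where B = 1]) auto

lemma integrable_YY [simp]: "integrable (obs_law q \<eta>) (\<lambda>x. Yn m x * Yn n x)"
  using abs_Y_le_1 by (intro O.integrable_const_bound[where B = 1]) (auto simp: abs_mult mult_le_one)

lemma p_eq: "pmf (conv_pow q t) = p t" by (simp add: p_def fun_eq_iff)

lemma mean_eq: "mean n = path_sum \<alpha> \<eta> ((p (2 * n), h0) # lift w) 0"
  unfolding mean_def window_def using scenery fin tests gaps centred
  by (subst expectation_obs_prod[where \<alpha> = \<alpha>]) (auto simp: p_eq)

definition \<tau> :: nat where "\<tau> = sum_list (map fst w)"

text \<open>The first window ends at time \<open>2 * m + \<tau>\<close> and the second starts from
  \<open>2 * (m + j)\<close>. The bound on \<open>j\<close> makes the connecting gap at least 1,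
  also for \<open>\<tau> = 0\<close>, and fits the range of
  \<open>transition_approx\<close>.\<close>

lemma mixed_eq:
  assumes "j \<ge> Suc \<tau>"
  shows "mixed m (m + j) = path_sum \<alpha> \<eta> ((p (2 * m), h0) # lift w @ (p (2 * j - \<tau>), h0) # lift w) 0"
proof -
  let ?v = "(2 * m, f0) # w @ (2 * j - \<tau>, f0) # w"
  have *: "Yn m x * Yn (m + j) x = obs_prod 0 ?v x" for x
  proof -
    have "obs_prod 0 (((2 * m, f0) # w) @ (2 * j - \<tau>, f0) # w) x
        = Yn m x * obs_prod (2 * m + \<tau>) ((2 * j - \<tau>, f0) # w) x"
      by (subst obs_prod_append) (simp add: window_def \<tau>_def)
    also have "obs_prod (2 * m + \<tau>) ((2 * j - \<tau>, f0) # w) x = Yn (m + j) x"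
    proof -
      have e: "2 * m + \<tau> + (2 * j - \<tau>) = 2 * (m + j)" using assms by simp
      show ?thesis by (simp only: obs_prod.simps fst_conv snd_conv e window_def add_0)
    qed
    finally show ?thesis by simp
  qed
  have "mixed m (m + j) = (\<integral>x. obs_prod 0 ?v x \<partial>obs_law q \<eta>)" by (simp only: mixed_def *)
  also have "\<dots> = path_sum \<alpha> \<eta> (map (\<lambda>(t, f). (pmf (conv_pow q t), \<lambda>\<mu>. integral\<^sup>L \<mu> f)) ?v) 0"
    using scenery fin tests gaps centred assms by (intro expectation_obs_prod) auto
  finally show ?thesis by (simp add: p_eq)
qed

lemma mean_approx: "\<exists>A\<ge>0. \<forall>n. \<bar>mean n - H0 * u n\<bar> \<le> A * (u n - u (Suc n))"
proof -
  obtain K where K: "K \<ge> 0" "\<And>z j. z \<in> D \<Longrightarrow> \<bar>p (2 * j) z - u j\<bar> \<le> K * (u j - u (Suc j))"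
    using transition_approx_finite[OF fin, of 0] by auto
  define c where "c z = h0 (\<eta> z) * path_sum \<alpha> \<eta> (lift w) z" for z
  have "\<bar>mean n - H0 * u n\<bar> \<le> ((\<Sum>z\<in>D. \<bar>c z\<bar>) * K) * (u n - u (Suc n))" for n
  proof -
    have "mean n - H0 * u n = (\<Sum>z\<in>D. (p (2 * n) z - u n) * c z)"
      by (simp add: mean_eq window_limit_def c_def left_diff_distrib sum_subtractf sum_distrib_left mult.assoc mult.commute[of _ "u n"])
    also have "\<bar>\<dots>\<bar> \<le> (\<Sum>z\<in>D. \<bar>p (2 * n) z - u n\<bar> * \<bar>c z\<bar>)"
      using sum_abs[of "\<lambda>z. (p (2 * n) z - u n) * c z" D] by (simp add: abs_mult)
    also have "\<dots> \<le> (\<Sum>z\<in>D. (K * (u n - u (Suc n))) * \<bar>c z\<bar>)"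
      using K by (intro sum_mono mult_right_mono) auto
    also have "\<dots> = ((\<Sum>z\<in>D. \<bar>c z\<bar>) * K) * (u n - u (Suc n))"
      unfolding sum_distrib_left[symmetric] by (simp only: mult_ac)
    finally show ?thesis .
  qed
  moreover have "(\<Sum>z\<in>D. \<bar>c z\<bar>) * K \<ge> 0" using K by (auto intro!: mult_nonneg_nonneg sum_nonneg)
  ultimately show ?thesis by blast
qed

text \<open>The connecting kernel is the constant \<open>u j\<close> plus a small remainder. The
  constant part decouples the windows into \<open>mean m * H0\<close>, and
  \<open>path_sum_kernel_bound\<close> estimates the rest.\<close>

lemma mixed_approx:
  "\<exists>A\<ge>0. \<forall>m j. j \<ge> Suc \<tau> \<longrightarrow> \<bar>mixed m (m + j) - H0 * mean m * u j\<bar> \<le> A * (u (j - \<tau>) - u (Suc (j - \<tau>)))"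
proof -
  have "finite ((\<lambda>(x, y). y - x) ` (D \<times> D))" using fin by auto
  then obtain K where K: "K \<ge> 0" "\<And>x y j. x \<in> D \<Longrightarrow> y \<in> D \<Longrightarrow> j \<ge> \<tau> \<Longrightarrow>
     \<bar>p (2 * j - \<tau>) (y - x) - u j\<bar> \<le> K * (u (j - \<tau>) - u (Suc (j - \<tau>)))"
    using transition_approx_finite[of "(\<lambda>(x, y). y - x) ` (D \<times> D)" \<tau>] by fastforce
  obtain C where C: "C \<ge> 0" "\<And>\<kappa> b x. 0 \<le> b \<Longrightarrow> \<forall>x\<in>D. \<forall>y\<in>D. \<bar>\<kappa> (y - x)\<bar> \<le> b \<Longrightarrow> x \<in> D \<Longrightarrow>
     \<bar>path_sum \<alpha> \<eta> (lift w @ (\<kappa>, h0) # lift w) x\<bar> \<le> C * b"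
    using path_sum_kernel_bound[OF fin, of "lift w" h0 "lift w"] by blast
  let ?S = "\<Sum>z\<in>D. \<bar>h0 (\<eta> z)\<bar>"
  have "\<bar>mixed m (m + j) - H0 * mean m * u j\<bar> \<le> (?S * (C * K)) * (u (j - \<tau>) - u (Suc (j - \<tau>)))" if j: "j \<ge> Suc \<tau>" for m j
  proof -
    define b where "b = K * (u (j - \<tau>) - u (Suc (j - \<tau>)))"
    define \<kappa> where "\<kappa> z = p (2 * j - \<tau>) z - u j" for z
    have b: "0 \<le> b" using K u_Suc_le by (simp add: b_def)
    have R: "\<bar>path_sum \<alpha> \<eta> (lift w @ (\<kappa>, h0) # lift w) x\<bar> \<le> C * b" if "x \<in> D" for x
      using K(2) j that by (intro C(2)[OF b]) (auto simp: b_def \<kappa>_def)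
    have "mixed m (m + j) = u j * (mean m * H0) + path_sum \<alpha> \<eta> (((p (2 * m), h0) # lift w) @ (\<kappa>, h0) # lift w) 0"
      unfolding mixed_eq[OF j] mean_eq window_limit_def \<kappa>_def path_sum_const_kernel[symmetric]
      using path_sum_split_kernel[of \<alpha> \<eta> "(p (2 * m), h0) # lift w" "p (2 * j - \<tau>)" h0 "lift w" 0 "u j"] by simp
    hence "\<bar>mixed m (m + j) - H0 * mean m * u j\<bar> = \<bar>path_sum \<alpha> \<eta> (((p (2 * m), h0) # lift w) @ (\<kappa>, h0) # lift w) 0\<bar>"
      by (simp add: mult_ac)
    also have "\<dots> \<le> (\<Sum>z\<in>D. \<bar>p (2 * m) z * h0 (\<eta> z)\<bar> * \<bar>path_sum \<alpha> \<eta> (lift w @ (\<kappa>, h0) # lift w) z\<bar>)"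
      using sum_abs[of "\<lambda>z. p (2 * m) z * h0 (\<eta> z) * path_sum \<alpha> \<eta> (lift w @ (\<kappa>, h0) # lift w) z" D]
      by (simp add: abs_mult)
    also have "\<dots> \<le> (\<Sum>z\<in>D. \<bar>h0 (\<eta> z)\<bar> * (C * b))"
    proof (intro sum_mono mult_mono R)
      \<comment> \<open>Bounding the transition probability by 1 makes the estimate uniform in
        \<open>m\<close>.\<close>
      fix z show "\<bar>p (2 * m) z * h0 (\<eta> z)\<bar> \<le> \<bar>h0 (\<eta> z)\<bar>"
        by (simp add: abs_mult p_def pmf_le_1 mult_left_le_one_le)
    qed (use C b in auto)
    also have "\<dots> = (?S * (C * K)) * (u (j - \<tau>) - u (Suc (j - \<tau>)))"
      unfolding sum_distrib_right[symmetric] b_def by (simp only: mult_ac)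
    finally show ?thesis .
  qed
  moreover have "?S * (C * K) \<ge> 0" using C K by (auto intro!: mult_nonneg_nonneg sum_nonneg)
  ultimately show ?thesis by blast
qed

lemma abs_mixed_le_1: "\<bar>mixed m n\<bar> \<le> 1"
proof -
  have "\<bar>mixed m n\<bar> \<le> (\<integral>x. \<bar>Yn m x * Yn n x\<bar> \<partial>obs_law q \<eta>)" unfolding mixed_def by (rule integral_abs_bound)
  also have "\<dots> \<le> (\<integral>x. 1 \<partial>obs_law q \<eta>)"
    using abs_Y_le_1 by (intro integral_mono integrable_abs integrable_YY) (auto simp: abs_mult mult_le_one)
  finally show ?thesis by (simp add: O.prob_space)
qed

lemma sum_u_diff_le_1: "(\<Sum>j<n. u j - u (Suc j)) \<le> 1"
  using u_pos[of n] u_0 by (simp add: sum_lessThan_telescope' less_imp_le)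

lemma L2_bound:
  "\<exists>C. \<forall>N. (\<integral>x. (\<Sum>n<N. u n * (Yn n x - H0 * u n))\<^sup>2 \<partial>obs_law q \<eta>) \<le> C * (\<Sum>n<N. (u n)\<^sup>2)"
proof -
  obtain C where C: "\<And>n. u n \<le> C / sqrt (real (Suc n))" using u_upper by blast
  interpret decay u C
    using u_pos u_antimono u_0 C by unfold_locales auto
  obtain A1 where A1: "A1 \<ge> 0" "\<And>n. \<bar>mean n - H0 * u n\<bar> \<le> A1 * (u n - u (Suc n))"
    using mean_approx by blast
  obtain A2 where A2: "A2 \<ge> 0" "\<And>m j. j \<ge> Suc \<tau> \<Longrightarrow> \<bar>mixed m (m + j) - H0 * mean m * u j\<bar> \<le> A2 * (u (j - \<tau>) - u (Suc (j - \<tau>)))"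
    using mixed_approx by blast
  define d where "d n = u n - u (Suc n)" for n
  have d: "0 \<le> d n" for n using u_Suc_le by (simp add: d_def)
  \<comment> \<open>The first summand covers the error of the means, also after multiplication by
    \<open>\<bar>H0\<bar>\<close>. The second covers the covariance: the trivial bound
    \<open>1 + H0\<^sup>2\<close> for the finitely many \<open>j \<le> \<tau>\<close>, where windows
    may overlap, and the telescoping error beyond.\<close>
  define e where "e n = (A1 + \<bar>H0\<bar> * A1) * d n + (if n \<le> \<tau> then 1 + H0\<^sup>2 else A2 * d (n - \<tau>))" for n
  have e0: "e n \<ge> 0" for n using A1(1) A2(1) d by (auto simp: e_def)
  have sum_d: "(\<Sum>j<n. d j) \<le> 1" for n using sum_u_diff_le_1 by (simp add: d_def)
  have e_sum: "(\<Sum>j<n. e j) \<le> (A1 + \<bar>H0\<bar> * A1) + (real (Suc \<tau>) * (1 + H0\<^sup>2) + A2)" for n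
  proof -
    have "(\<Sum>j<n. (if j \<le> \<tau> then 1 + H0\<^sup>2 else A2 * d (j - \<tau>)))
       \<le> (\<Sum>j<Suc \<tau> + n. (if j \<le> \<tau> then 1 + H0\<^sup>2 else A2 * d (j - \<tau>)))"
      using A2 d by (intro sum_mono2) auto
    also have "\<dots> = (\<Sum>j<Suc \<tau>. 1 + H0\<^sup>2) + (\<Sum>i<n. A2 * d (Suc i))"
    proof -
      have "(\<Sum>j<Suc \<tau> + n. (if j \<le> \<tau> then 1 + H0\<^sup>2 else A2 * d (j - \<tau>)))
         = (\<Sum>j<Suc \<tau>. (if j \<le> \<tau> then 1 + H0\<^sup>2 else A2 * d (j - \<tau>)))
         + (\<Sum>i<n. (if Suc \<tau> + i \<le> \<tau> then 1 + H0\<^sup>2 else A2 * d (Suc \<tau> + i - \<tau>)))"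
        by (induction n) simp_all
      also have "(\<Sum>j<Suc \<tau>. (if j \<le> \<tau> then 1 + H0\<^sup>2 else A2 * d (j - \<tau>))) = (\<Sum>j<Suc \<tau>. 1 + H0\<^sup>2)"
        by (intro sum.cong) auto
      also have "(\<Sum>i<n. (if Suc \<tau> + i \<le> \<tau> then 1 + H0\<^sup>2 else A2 * d (Suc \<tau> + i - \<tau>))) = (\<Sum>i<n. A2 * d (Suc i))"
        by (intro sum.cong) auto
      finally show ?thesis .
    qed
    also have "(\<Sum>i<n. A2 * d (Suc i)) \<le> A2"
    proof -
      have "(\<Sum>i<n. d (Suc i)) \<le> d 0 + (\<Sum>i<n. d (Suc i))" using d by simp
      also have "\<dots> = (\<Sum>i<Suc n. d i)" by (rule sum.lessThan_Suc_shift[symmetric])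
      also have "\<dots> \<le> 1" by (rule sum_d)
      finally show ?thesis using A2(1) by (simp add: sum_distrib_left[symmetric] mult_left_le)
    qed
    finally have "(\<Sum>j<n. (if j \<le> \<tau> then 1 + H0\<^sup>2 else A2 * d (j - \<tau>))) \<le> real (Suc \<tau>) * (1 + H0\<^sup>2) + A2"
      by simp
    moreover have "(\<Sum>j<n. (A1 + \<bar>H0\<bar> * A1) * d j) \<le> A1 + \<bar>H0\<bar> * A1"
      using A1(1) sum_d[of n] by (simp only: sum_distrib_left[symmetric]) (intro mult_left_le, auto)
    ultimately show ?thesis unfolding e_def sum.distrib by linarith
  qed
  have mean_e: "\<bar>mean n - H0 * u n\<bar> \<le> e n" for n
  proof -
    have "\<bar>mean n - H0 * u n\<bar> \<le> A1 * d n" using A1(2) by (simp add: d_def)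
    also have "\<dots> \<le> (A1 + \<bar>H0\<bar> * A1) * d n" using A1(1) d by (intro mult_right_mono) auto
    also have "\<dots> \<le> e n" using A2(1) d by (auto simp: e_def)
    finally show ?thesis .
  qed
  have cov: "\<bar>mixed m (m + j) - H0\<^sup>2 * u m * u j\<bar> \<le> e m * u j + e j" for m j
  proof (cases "j \<le> \<tau>")
    case True
    have "H0\<^sup>2 * (u m * u j) \<le> H0\<^sup>2 * 1"
      using u_le_1 u_pos by (intro mult_left_mono mult_le_one) (auto simp: less_imp_le)
    moreover have "0 \<le> H0\<^sup>2 * (u m * u j)" using u_pos by (simp add: less_imp_le)
    ultimately have "\<bar>mixed m (m + j) - H0\<^sup>2 * u m * u j\<bar> \<le> 1 + H0\<^sup>2"
      using abs_mixed_le_1[of m "m + j"] by (simp add: mult.assoc abs_le_iff)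
    also have "\<dots> \<le> e j" using True A1(1) d by (auto simp: e_def)
    also have "\<dots> \<le> e m * u j + e j" using e0 u_pos by (simp add: less_imp_le)
    finally show ?thesis .
  next
    case False
    hence j: "j \<ge> Suc \<tau>" by simp
    have 1: "\<bar>H0 * (mean m - H0 * u m) * u j\<bar> \<le> e m * u j"
    proof -
      have "\<bar>H0 * (mean m - H0 * u m) * u j\<bar> = \<bar>H0\<bar> * \<bar>mean m - H0 * u m\<bar> * u j"
        using u_pos[of j] by (simp add: abs_mult)
      also have "\<dots> \<le> \<bar>H0\<bar> * (A1 * d m) * u j"
        using A1(2) u_pos[of j] by (intro mult_left_mono mult_right_mono) (auto simp: d_def less_imp_le)
      also have "\<dots> \<le> e m * u j"
      proof (rule mult_right_mono)
        have "\<bar>H0\<bar> * (A1 * d m) \<le> (A1 + \<bar>H0\<bar> * A1) * d m" using A1(1) d by (simp add: distrib_right)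
        also have "\<dots> \<le> e m" using A2(1) d by (auto simp: e_def)
        finally show "\<bar>H0\<bar> * (A1 * d m) \<le> e m" .
      qed (use u_pos[of j] in simp)
      finally show ?thesis .
    qed
    have 2: "\<bar>mixed m (m + j) - H0 * mean m * u j\<bar> \<le> e j"
    proof -
      have "\<bar>mixed m (m + j) - H0 * mean m * u j\<bar> \<le> A2 * d (j - \<tau>)" using A2(2)[OF j] by (simp add: d_def)
      also have "\<dots> \<le> e j" using False A1(1) d by (simp add: e_def)
      finally show ?thesis .
    qed
    have "mixed m (m + j) - H0\<^sup>2 * u m * u j
       = (mixed m (m + j) - H0 * mean m * u j) + H0 * (mean m - H0 * u m) * u j"
      by (simp add: algebra_simps power2_eq_square)
    thus ?thesis using 1 2 by linarith
  qed
  have eq: "(\<integral>x. (\<Sum>n<N. u n * (Yn n x - H0 * u n))\<^sup>2 \<partial>obs_law q \<eta>)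
    = (\<Sum>m<N. \<Sum>n<N. u m * u n * (mixed m n - H0 * u n * mean m - H0 * u m * mean n + H0\<^sup>2 * u m * u n))" for N
  proof -
    have "(\<Sum>n<N. u n * (Yn n x - H0 * u n))\<^sup>2
      = (\<Sum>m<N. \<Sum>n<N. u m * u n * (Yn m x * Yn n x - H0 * u n * Yn m x - H0 * u m * Yn n x + H0\<^sup>2 * u m * u n))" for x
      unfolding power2_eq_square[of "sum _ _"] sum_product
      by (intro sum.cong refl) (simp add: algebra_simps power2_eq_square)
    thus ?thesis by (simp add: mean_def mixed_def O.prob_space)
  qed
  have sym: "mixed m n = mixed n m" for m n by (simp add: mixed_def mult.commute)
  have "(\<integral>x. (\<Sum>n<N. u n * (Yn n x - H0 * u n))\<^sup>2 \<partial>obs_law q \<eta>)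
    \<le> 2 * (4 * H0\<^sup>2 * C\<^sup>2 + 2 * ((A1 + \<bar>H0\<bar> * A1) + (real (Suc \<tau>) * (1 + H0\<^sup>2) + A2))
       + 2 * \<bar>H0\<bar> * ((A1 + \<bar>H0\<bar> * A1) + (real (Suc \<tau>) * (1 + H0\<^sup>2) + A2))) * B N" for N
    unfolding eq by (rule second_moment[OF e0 e_sum sym mean_e cov])
  thus ?thesis unfolding B_def by blast
qed

end

section \<open>Almost sure convergence and reconstruction\<close>

text \<open>Right-continuity reduces the comparison to rational points. Countably many test
  functions then separate laws, so the exceptional null sets can be united.\<close>

lemma real_distribution_eqI_rat:
  assumes "real_distribution \<mu>" "real_distribution \<nu>"
    and eq: "\<And>r::rat. measure \<mu> {..of_rat r} = measure \<nu> {..of_rat r}"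
  shows "\<mu> = \<nu>"
proof (rule cdf_unique[OF assms(1,2)])
  have le: "cdf M x \<le> cdf N x"
    if d: "real_distribution M" "real_distribution N"
      and e: "\<And>r::rat. measure M {..of_rat r} = measure N {..of_rat r}" for M N x
  proof (rule ccontr)
    interpret M: real_distribution M by (fact d)
    interpret N: real_distribution N by (fact d)
    assume "\<not> cdf M x \<le> cdf N x"
    moreover have "(cdf N \<longlongrightarrow> cdf N x) (at_right x)"
      using N.cdf_is_right_cont[of x] by (simp add: continuous_within)
    ultimately have "\<forall>\<^sub>F y in at_right x. cdf N y < cdf M x" by (intro order_tendstoD(2)) auto
    then obtain b where b: "b > x" "\<And>y. x < y \<Longrightarrow> y < b \<Longrightarrow> cdf N y < cdf M x"
      by (auto simp: eventually_at_right_field)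
    obtain r where r: "x < of_rat r" "of_rat r < b" using of_rat_dense[OF b(1)] by blast
    have "cdf M x \<le> cdf M (of_rat r)" using r by (intro M.cdf_nondecreasing) simp
    also have "\<dots> = cdf N (of_rat r)" using e by (simp add: cdf_def)
    finally show False using b(2)[OF r] by simp
  qed
  show "cdf \<mu> = cdf \<nu>" using le[OF assms(1,2) eq] le[OF assms(2,1) eq[symmetric]] by (intro ext antisym)
qed

definition centred_indicator :: "real measure \<Rightarrow> rat \<Rightarrow> real \<Rightarrow> real" where
  "centred_indicator \<alpha> r x = indicator {..of_rat r} x - measure \<alpha> {..of_rat r}"

lemma centred_indicator_test:
  assumes "prob_space \<alpha>"
  shows "centred_indicator \<alpha> r \<in> test_functions"
proof -
  have "measure \<alpha> {..of_rat r} \<le> 1" using assms by (rule prob_space.prob_le_1)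
  moreover have "measure \<alpha> {..of_rat r} \<ge> 0" by simp
  ultimately show ?thesis
    by (auto simp: test_functions_def centred_indicator_def[abs_def] indicator_def abs_le_iff
        simp del: measure_nonneg)
qed

lemma integral_centred_indicator:
  assumes "prob_space \<mu>" "sets \<mu> = sets borel"
  shows "integral\<^sup>L \<mu> (centred_indicator \<alpha> r) = measure \<mu> {..of_rat r} - measure \<alpha> {..of_rat r}"
proof -
  interpret prob_space \<mu> by fact
  have sp: "space \<mu> = UNIV" using sets_eq_imp_space_eq[OF assms(2)] by simp
  have "integrable \<mu> (indicat_real {..of_rat r})"
    using assms(2) by (intro integrable_real_indicator) (auto simp: emeasure_eq_measure)
  thus ?thesis using prob_space unfolding centred_indicator_def[abs_def]
    by (subst Bochner_Integration.integral_diff) (simp_all add: sp)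
qed

context symmetric_walk
begin

text \<open>The sums of \<open>(u n)\<^sup>2\<close> grow only logarithmically; along times at which
  they exceed \<open>2 ^ k\<close> the variances are geometrically small.\<close>

definition sample_size :: "nat \<Rightarrow> nat" where
  "sample_size k = (SOME N. (\<Sum>n<N. (u n)\<^sup>2) \<ge> 2 ^ k)"

lemma sample_size: "(\<Sum>n<sample_size k. (u n)\<^sup>2) \<ge> 2 ^ k"
  unfolding sample_size_def using sum_u_square_unbounded by (rule someI_ex)

definition stat :: "(real \<Rightarrow> real) \<Rightarrow> (nat \<times> (real \<Rightarrow> real)) list \<Rightarrow> nat \<Rightarrow> (nat \<Rightarrow> real) \<Rightarrow> real" where
  "stat f w k x = (\<Sum>n<sample_size k. u n * window f w n x) / (\<Sum>n<sample_size k. (u n)\<^sup>2)"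

end

text \<open>By \<open>L2_bound\<close> the numerator of \<open>stat f0 w k x - H0\<close> has second
  moment at most a multiple of the denominator, so the quotient has second moment at most a constant
  over \<open>2 ^ k\<close>.\<close>

lemma (in observed_walk) stat_converges:
  "AE x in obs_law q \<eta>. (\<lambda>k. stat f0 w k x) \<longlonglongrightarrow> H0"
proof -
  obtain C where C: "\<And>N. (\<integral>x. (\<Sum>n<N. u n * (Yn n x - H0 * u n))\<^sup>2 \<partial>obs_law q \<eta>) \<le> C * (\<Sum>n<N. (u n)\<^sup>2)"
    using L2_bound by blast
  define B where "B k = (\<Sum>n<sample_size k. (u n)\<^sup>2)" for k
  have B: "B k \<ge> 2 ^ k" for k using sample_size by (simp add: B_def)
  have B_pos: "B k > 0" for k using B[of k] by (rule less_le_trans[rotated]) simp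
  define Z where "Z k x = (\<Sum>n<sample_size k. u n * (Yn n x - H0 * u n))" for k x
  have stat_eq: "stat f0 w k x - H0 = Z k x / B k" for k x
  proof -
    have "Z k x = (\<Sum>n<sample_size k. u n * Yn n x) - H0 * B k"
      by (simp add: Z_def B_def sum_distrib_left right_diff_distrib sum_subtractf power2_eq_square mult_ac)
    thus ?thesis using B_pos[of k] by (simp add: stat_def B_def[symmetric] field_simps)
  qed
  have "AE x in obs_law q \<eta>. (\<lambda>k. stat f0 w k x - H0) \<longlonglongrightarrow> 0"
  proof (rule O.AE_tendsto_0_if_L2_summable)
    fix k
    have [measurable]: "Z k \<in> borel_measurable (obs_law q \<eta>)" unfolding Z_def[abs_def] by measurable
    have Zb: "\<bar>Z k x\<bar> \<le> (\<Sum>n<sample_size k. u n * (1 + \<bar>H0\<bar> * u n))" for x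
    proof -
      have "\<bar>Z k x\<bar> \<le> (\<Sum>n<sample_size k. \<bar>u n * (Yn n x - H0 * u n)\<bar>)" unfolding Z_def by (rule sum_abs)
      also have "\<dots> \<le> (\<Sum>n<sample_size k. u n * (1 + \<bar>H0\<bar> * u n))"
      proof (rule sum_mono)
        fix n
        have "\<bar>Yn n x - H0 * u n\<bar> \<le> \<bar>Yn n x\<bar> + \<bar>H0 * u n\<bar>" by (rule abs_triangle_ineq4)
        also have "\<dots> \<le> 1 + \<bar>H0\<bar> * u n" using abs_Y_le_1[of n x] u_pos[of n] by (simp add: abs_mult)
        finally show "\<bar>u n * (Yn n x - H0 * u n)\<bar> \<le> u n * (1 + \<bar>H0\<bar> * u n)"
          using u_pos[of n] by (simp add: abs_mult)
      qed
      finally show ?thesis .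
    qed
    have "integrable (obs_law q \<eta>) (\<lambda>x. (Z k x)\<^sup>2)"
      using power_mono[OF Zb abs_ge_zero, of _ 2]
      by (intro O.integrable_const_bound[where B = "(\<Sum>n<sample_size k. u n * (1 + \<bar>H0\<bar> * u n))\<^sup>2"]) auto
    thus "integrable (obs_law q \<eta>) (\<lambda>x. (stat f0 w k x - H0)\<^sup>2)"
      unfolding stat_eq by (simp add: power_divide)
    have "(\<integral>x. (stat f0 w k x - H0)\<^sup>2 \<partial>obs_law q \<eta>) = (\<integral>x. (Z k x)\<^sup>2 \<partial>obs_law q \<eta>) / (B k)\<^sup>2"
      unfolding stat_eq by (simp add: power_divide)
    also have "\<dots> \<le> C * B k / (B k)\<^sup>2"
      using C[of "sample_size k"] by (intro divide_right_mono) (auto simp: Z_def B_def)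
    also have "\<dots> = C / B k" using B_pos[of k] by (simp add: power2_eq_square)
    also have "\<dots> \<le> \<bar>C\<bar> / B k" using B_pos[of k] by (intro divide_right_mono) auto
    also have "\<dots> \<le> \<bar>C\<bar> / 2 ^ k" using B[of k] by (intro divide_left_mono) (auto simp: B_pos)
    finally show "(\<integral>x. (stat f0 w k x - H0)\<^sup>2 \<partial>obs_law q \<eta>) \<le> \<bar>C\<bar> * (1 / 2) ^ k"
      by (simp add: power_divide)
  next
    show "summable (\<lambda>k. \<bar>C\<bar> * (1 / 2) ^ k)" by (intro summable_mult summable_geometric) simp
  qed
  thus ?thesis by (simp add: LIM_zero_iff)
qed

context symmetric_walk
begin

abbreviation tests :: "real measure \<Rightarrow> (nat \<times> rat) list \<Rightarrow> (nat \<times> (real \<Rightarrow> real)) list" where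
  "tests \<alpha> v \<equiv> map (\<lambda>(t, r). (t, centred_indicator \<alpha> r)) v"

text \<open>Tests a candidate against the observations through countably many statistics, without
  reference to the true scenery; any compatible candidate can serve as the reconstruction.\<close>

definition compatible :: "real measure \<Rightarrow> (nat \<Rightarrow> real) \<Rightarrow> (int \<Rightarrow> real measure) \<Rightarrow> bool" where
  "compatible \<alpha> x \<eta> \<longleftrightarrow> is_scenery \<eta> \<and> finite (defects \<alpha> \<eta>) \<and>
     (\<forall>r v. (\<forall>b\<in>set v. fst b \<ge> 1) \<longrightarrow>
        (\<lambda>k. stat (centred_indicator \<alpha> r) (tests \<alpha> v) k x) \<longlonglongrightarrow> window_limit \<alpha> \<eta> (centred_indicator \<alpha> r) (tests \<alpha> v))"

lemma AE_compatible:
  assumes "prob_space \<alpha>" "sets \<alpha> = sets borel" "is_scenery \<eta>" "finite (defects \<alpha> \<eta>)"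
  shows "AE x in obs_law q \<eta>. compatible \<alpha> x \<eta>"
proof -
  have "AE x in obs_law q \<eta>. (\<forall>b\<in>set v. fst b \<ge> 1) \<longrightarrow>
      (\<lambda>k. stat (centred_indicator \<alpha> r) (tests \<alpha> v) k x) \<longlonglongrightarrow> window_limit \<alpha> \<eta> (centred_indicator \<alpha> r) (tests \<alpha> v)" for r v
  proof (cases "\<forall>b\<in>set v. fst b \<ge> 1")
    case True
    interpret observed_walk q \<alpha> \<eta> "centred_indicator \<alpha> r" "tests \<alpha> v"
      using assms True centred_indicator_test[OF assms(1)] integral_centred_indicator[OF assms(1,2)]
      by unfold_locales auto
    show ?thesis using stat_converges True by simp
  qed auto
  thus ?thesis using assms(3,4) unfolding compatible_def by (simp add: AE_all_countable)
qed

lemma compatible_equivalent: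
  assumes "prob_space \<alpha>" "sets \<alpha> = sets borel" "compatible \<alpha> x \<eta>" "compatible \<alpha> x \<eta>'"
  shows "\<exists>c. \<eta>' = \<eta> \<circ> (\<lambda>z. z + c) \<or> \<eta>' = \<eta> \<circ> (\<lambda>z. - z + c)"
proof -
  define B where "B = range (\<lambda>r. \<lambda>\<mu>. integral\<^sup>L \<mu> (centred_indicator \<alpha> r))"
  have H_eq: "window_limit \<alpha> \<eta> (centred_indicator \<alpha> r) (tests \<alpha> v) = window_limit \<alpha> \<eta>' (centred_indicator \<alpha> r) (tests \<alpha> v)"
    if "\<forall>b\<in>set v. fst b \<ge> 1" for r v
    using assms(3,4) that unfolding compatible_def by (meson LIMSEQ_unique)
  have law: "prob_space \<mu> \<and> sets \<mu> = sets borel" if "\<mu> \<in> insert \<alpha> (range \<eta> \<union> range \<eta>')" for \<mu>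
    using assms that by (auto simp: compatible_def is_scenery_def)
  have rd: "real_distribution \<mu>" if "\<mu> \<in> insert \<alpha> (range \<eta> \<union> range \<eta>')" for \<mu>
    using law[OF that] sets_eq_imp_space_eq[of \<mu> borel]
    by (auto simp: real_distribution_def real_distribution_axioms_def)
  have "two_sceneries \<alpha> \<eta> \<eta>' B p"
  proof
    show "finite (defects \<alpha> \<eta>)" "finite (defects \<alpha> \<eta>')" using assms by (auto simp: compatible_def)
  next
    fix \<mu> \<nu> assume "\<mu> \<in> insert \<alpha> (range \<eta> \<union> range \<eta>')" "\<nu> \<in> range \<eta> \<union> range \<eta>'" and ne: "\<mu> \<noteq> \<nu>"
    hence m: "\<mu> \<in> insert \<alpha> (range \<eta> \<union> range \<eta>')" "\<nu> \<in> insert \<alpha> (range \<eta> \<union> range \<eta>')" by auto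
    then obtain r :: rat where "measure \<mu> {..of_rat r} \<noteq> measure \<nu> {..of_rat r}"
      using real_distribution_eqI_rat[OF rd[OF m(1)] rd[OF m(2)]] ne by blast
    thus "\<exists>f\<in>B. f \<mu> \<noteq> f \<nu>"
      using law[OF m(1)] law[OF m(2)] by (auto simp: B_def integral_centred_indicator intro!: exI[of _ r])
  next
    fix f assume "f \<in> B"
    thus "f \<alpha> = 0" using assms by (auto simp: B_def integral_centred_indicator)
  next
    fix M c d assume "\<And>t. t \<ge> 1 \<Longrightarrow> (\<Sum>d\<in>{-M..M}. p t d * c d) = 0" "\<bar>d\<bar> \<le> M"
    thus "c d + c (- d) = 0" by (rule kernel_determines_even_part)
  next
    fix f0 w assume "f0 \<in> B" and w: "w \<in> lists (p ` {1..} \<times> B)"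
    then obtain r where r: "f0 = (\<lambda>\<mu>. integral\<^sup>L \<mu> (centred_indicator \<alpha> r))" by (auto simp: B_def)
    \<comment> \<open>Every list allowed by the locale comes from gaps and rational thresholds, so
      the observed limits cover it.\<close>
    have "\<exists>v. (\<forall>b\<in>set v. fst b \<ge> 1) \<and> w = lift (tests \<alpha> v)"
      using w
    proof (induction w)
      case (Cons a w)
      then obtain v where v: "\<forall>b\<in>set v. fst b \<ge> 1" "w = lift (tests \<alpha> v)" by auto
      obtain t s where "t \<ge> 1" "a = (p t, \<lambda>\<mu>. integral\<^sup>L \<mu> (centred_indicator \<alpha> s))"
        using Cons.hyps by (auto simp: B_def)
      thus ?case using v by (intro exI[of _ "(t, s) # v"]) auto
    qed (auto intro: exI[of _ "[]"])
    then obtain v where "\<forall>b\<in>set v. fst b \<ge> 1" "w = lift (tests \<alpha> v)" by blast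
    thus "path_sum \<alpha> \<eta> ((\<lambda>_. 1, f0) # w) 0 = path_sum \<alpha> \<eta>' ((\<lambda>_. 1, f0) # w) 0"
      using H_eq[of v r] by (simp only: window_limit_def r)
  qed
  thus ?thesis by (rule sceneries_equivalent)
qed

end

theorem theorem2p1:
  fixes q :: "int pmf" and \<alpha> :: "real measure"
  assumes "standing_assms q"
    and "prob_space \<alpha>" and "sets \<alpha> = sets borel"
  shows "\<exists>F :: (nat \<Rightarrow> real) \<Rightarrow> (int \<Rightarrow> real measure).
           \<forall>\<eta>. is_scenery \<eta> \<and> finite {z. \<eta> z \<noteq> \<alpha>} \<longrightarrow>
             (AE x in obs_law q \<eta>.
                \<exists>c::int. F x = \<eta> \<circ> (\<lambda>z. z + c) \<or> F x = \<eta> \<circ> (\<lambda>z. - z + c))"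
proof -
  interpret symmetric_walk q by unfold_locales (fact assms)
  show ?thesis
  \<comment> \<open>Almost surely the true scenery is compatible, so the choice falls on a
    compatible scenery, and all of these are equivalent. Where no scenery is compatible, the value
    is arbitrary.\<close>
  proof (intro exI[of _ "\<lambda>x. SOME \<eta>. compatible \<alpha> x \<eta>"] allI impI)
    fix \<eta> assume \<eta>: "is_scenery \<eta> \<and> finite {z. \<eta> z \<noteq> \<alpha>}"
    hence "AE x in obs_law q \<eta>. compatible \<alpha> x \<eta>"
      using assms by (intro AE_compatible) (auto simp: defects_def)
    thus "AE x in obs_law q \<eta>. \<exists>c::int. (SOME \<eta>. compatible \<alpha> x \<eta>) = \<eta> \<circ> (\<lambda>z. z + c) \<or>
        (SOME \<eta>. compatible \<alpha> x \<eta>) = \<eta> \<circ> (\<lambda>z. - z + c)"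
    proof eventually_elim
      case (elim x)
      thus ?case using compatible_equivalent[OF assms(2,3)] someI[of "compatible \<alpha> x" \<eta>] by blast
    qed
  qed
qed

end
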